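(* Let $d\ge2$. If $F(0)\ge p_{\mathrm c}(\mathbb Z^d)$, then almost surely $$\hat\nu_{\Gamma^{(\ell)}}\Rightarrow\delta_0\quad\text{as }\ell\to\infty,\quad\text{for every }\Gamma\in\mathrm{Geo}_\infty,$$ where $\Rightarrow$ denotes weak convergence of measures on $[0,\infty)$.
   Context: First-passage percolation on $\mathbb Z^d$, $d\ge2$: $(\tau_e)_{e\in E(\mathbb Z^d)}$ are i.i.d. nonnegative edge-weights on a complete probability space, indexed by undirected nearest-neighbor edges, with $F(t)=\mathbb P(\tau_e\le t)$. $p_{\mathrm c}(\mathbb Z^d)$ is the critical probability of Bernoulli bond percolation on $\mathbb Z^d$. For $x,y\in\mathbb Z^d$, a finite geodesic from $x$ to $y$ is a self-avoiding nearest-neighbor path $\gamma$ from $x$ to $y$ minimizing $T(\gamma)=\sum_{e\in\gamma}\tau_e$ among all such paths. An infinite path $\Gamma=\{e_1,e_2,\dots\}$ ($e_1$ incident with $e_2$, $e_2$ with $e_3$, and so on) is an infinite geodesic if for each $\ell$ the subpath $\Gamma^{(\ell)}=\{e_1,\dots,e_\ell\}$ is a finite geodesic; $\mathrm{Geo}_\infty$ is the set of all infinite geodesics (any starting point). For a nonempty finite path $\gamma$ with $|\gamma|$ edges, $\hat\nu_\gamma=\frac1{|\gamma|}\sum_{e\in\gamma}\delta_{\tau_e}$. *)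

theory Defs
  imports "HOL-Probability.Probability"
begin

section \<open>The nearest-neighbour lattice\<close>

text \<open>The lattice of dimension d is the type \<^typ>\<open>int ^ 'd\<close> with d = CARD('d).\<close>

definition lattice_adj :: "int ^ 'd \<Rightarrow> int ^ 'd \<Rightarrow> bool" where
  "lattice_adj x y \<longleftrightarrow> (\<Sum>i\<in>UNIV. \<bar>x $ i - y $ i\<bar>) = 1"

definition lattice_edges :: "(int ^ 'd) set set" where
  "lattice_edges = {{x, y} | x y. lattice_adj x y}"

section \<open>Bernoulli bond percolation\<close>

definition bond_percolation :: "real \<Rightarrow> ((int ^ 'd) set \<Rightarrow> bool) measure" where
  "bond_percolation p = (\<Pi>\<^sub>M e\<in>lattice_edges. measure_pmf (bernoulli_pmf p))"

definition open_cluster :: "((int ^ 'd) set \<Rightarrow> bool) \<Rightarrow> int ^ 'd \<Rightarrow> (int ^ 'd) set" where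
  "open_cluster \<omega> x = {y. (x, y) \<in> {(u, v). lattice_adj u v \<and> \<omega> {u, v}}\<^sup>*}"

definition percolation_prob :: "'d::finite itself \<Rightarrow> real \<Rightarrow> real" where
  "percolation_prob _ p =
     measure (bond_percolation p)
       {\<omega> \<in> space (bond_percolation p). infinite (open_cluster \<omega> (0 :: int ^ 'd))}"

definition critical_prob :: "'d::finite itself \<Rightarrow> real" where
  "critical_prob d = Sup {p \<in> {0..1}. percolation_prob d p = 0}"

text \<open>The percolation event is measurable, so \<^const>\<open>percolation_prob\<close> is a genuine
  probability (\<^const>\<open>measure\<close> is 0 on non-measurable sets).\<close>

lemma measurable_infinite_open_cluster:
  fixes x :: "int ^ 'd::finite"
  shows "{\<omega> \<in> space (bond_percolation p). infinite (open_cluster \<omega> x)} \<in> sets (bond_percolation p)"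
proof -
  define R :: "((int ^ 'd) set \<Rightarrow> bool) \<Rightarrow> _"
    where "R \<omega> = {(u, v). lattice_adj u v \<and> \<omega> {u, v}}" for \<omega>
  have step: "Measurable.pred (bond_percolation p) (\<lambda>\<omega>. (u, v) \<in> R \<omega>)" for u v
  proof (cases "lattice_adj u v")
    case True
    then have "{u, v} \<in> lattice_edges"
      by (auto simp: lattice_edges_def)
    then have "(\<lambda>\<omega>. \<omega> {u, v}) \<in> bond_percolation p \<rightarrow>\<^sub>M measure_pmf (bernoulli_pmf p)"
      unfolding bond_percolation_def by (rule measurable_component_singleton)
    then have "(\<lambda>\<omega>. \<omega> {u, v}) \<in> bond_percolation p \<rightarrow>\<^sub>M count_space UNIV"
      by simp
    then show ?thesis
      using True by (simp add: R_def)
  qed (simp add: R_def)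
  have pow: "Measurable.pred (bond_percolation p) (\<lambda>\<omega>. (x, v) \<in> R \<omega> ^^ n)" for v n
  proof (induction n arbitrary: v)
    case 0
    then show ?case by simp
  next
    case (Suc n)
    have "(\<lambda>\<omega>. (x, v) \<in> R \<omega> ^^ Suc n) = (\<lambda>\<omega>. \<exists>z. (x, z) \<in> R \<omega> ^^ n \<and> (z, v) \<in> R \<omega>)"
      by auto
    with Suc step show ?case
      by (simp only:) measurable
  qed
  have mem: "Measurable.pred (bond_percolation p) (\<lambda>\<omega>. v \<in> open_cluster \<omega> x)" for v
  proof -
    have "(\<lambda>\<omega>. v \<in> open_cluster \<omega> x) = (\<lambda>\<omega>. \<exists>n. (x, v) \<in> R \<omega> ^^ n)"
      by (simp add: open_cluster_def R_def rtrancl_power)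
    with pow show ?thesis
      by (simp only:) measurable
  qed
  have inf_iff: "infinite S \<longleftrightarrow> (\<forall>F. \<exists>v. v \<notin> set F \<and> v \<in> S)" for S :: "(int ^ 'd) set"
    by (metis finite_list finite_set finite_subset subsetI)
  have "Measurable.pred (bond_percolation p) (\<lambda>\<omega>. infinite (open_cluster \<omega> x))"
    unfolding inf_iff using mem by measurable
  then show ?thesis
    by (simp add: pred_def)
qed

section \<open>Paths and geodesics\<close>

text \<open>A path is represented by its edges in the order in which they are traversed.\<close>

definition self_avoiding_path :: "int ^ 'd \<Rightarrow> int ^ 'd \<Rightarrow> (int ^ 'd) set list \<Rightarrow> bool" where
  "self_avoiding_path x y \<gamma> \<longleftrightarrow>
     (\<exists>vs. vs \<noteq> [] \<and> hd vs = x \<and> last vs = y \<and> distinct vs \<and> successively lattice_adj vs \<and>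
           \<gamma> = map2 (\<lambda>u v. {u, v}) (butlast vs) (tl vs))"

definition passage_time :: "('e \<Rightarrow> real) \<Rightarrow> 'e list \<Rightarrow> real" where
  "passage_time t \<gamma> = (\<Sum>e\<leftarrow>\<gamma>. t e)"

definition finite_geodesic ::
    "((int ^ 'd) set \<Rightarrow> real) \<Rightarrow> int ^ 'd \<Rightarrow> int ^ 'd \<Rightarrow> (int ^ 'd) set list \<Rightarrow> bool" where
  "finite_geodesic t x y \<gamma> \<longleftrightarrow>
     self_avoiding_path x y \<gamma> \<and>
     (\<forall>\<gamma>'. self_avoiding_path x y \<gamma>' \<longrightarrow> passage_time t \<gamma> \<le> passage_time t \<gamma>')"

definition initial_path :: "(nat \<Rightarrow> 'e) \<Rightarrow> nat \<Rightarrow> 'e list" where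
  "initial_path \<Gamma> l = map \<Gamma> [0..<l]"

text \<open>Edge sequences are indexed from 0: the edge usually written e_(i+1) is \<open>\<Gamma> i\<close>.\<close>

definition infinite_geodesics :: "((int ^ 'd) set \<Rightarrow> real) \<Rightarrow> (nat \<Rightarrow> (int ^ 'd) set) set" where
  "infinite_geodesics t =
     {\<Gamma>. (\<forall>i. \<Gamma> i \<inter> \<Gamma> (Suc i) \<noteq> {}) \<and>
         (\<forall>l\<ge>1. \<exists>x y. finite_geodesic t x y (initial_path \<Gamma> l))}"

section \<open>Empirical measures\<close>

definition empirical_measure :: "('e \<Rightarrow> real) \<Rightarrow> 'e list \<Rightarrow> real measure" where
  "empirical_measure t \<gamma> =
     measure_of UNIV (sets borel)
       (\<lambda>A. (\<Sum>e\<leftarrow>\<gamma>. emeasure (return borel (t e)) A) / ennreal (real (length \<gamma>)))"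

lemma space_empirical_measure [simp]: "space (empirical_measure t \<gamma>) = UNIV"
  by (simp add: empirical_measure_def)

lemma sets_empirical_measure [simp]: "sets (empirical_measure t \<gamma>) = sets borel"
  using sets.sigma_sets_eq[of "borel :: real measure"] by (simp add: empirical_measure_def)

lemma emeasure_empirical_measure:
  assumes "A \<in> sets borel"
  shows "emeasure (empirical_measure t \<gamma>) A =
           (\<Sum>e\<leftarrow>\<gamma>. emeasure (return borel (t e)) A) / ennreal (real (length \<gamma>))"
proof (rule emeasure_measure_of[OF empirical_measure_def])
  let ?S = "sets (empirical_measure t \<gamma>)"
  show "positive ?S (\<lambda>A. (\<Sum>e\<leftarrow>\<gamma>. emeasure (return borel (t e)) A) / ennreal (real (length \<gamma>)))"
    by (simp add: positive_def sum_list_triv)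
  have sums: "(\<Sum>n. \<Sum>e\<leftarrow>\<gamma>. emeasure (return borel (t e)) (B n)) =
      (\<Sum>e\<leftarrow>\<gamma>. emeasure (return borel (t e)) (\<Union>n. B n))"
    if "range B \<subseteq> sets borel" "disjoint_family B" for B :: "nat \<Rightarrow> real set"
    using that
  proof (induction \<gamma>)
    case (Cons e \<gamma>)
    then show ?case
      by (simp add: suminf_add[symmetric] suminf_emeasure del: emeasure_return)
  qed simp
  show "countably_additive ?S
      (\<lambda>A. (\<Sum>e\<leftarrow>\<gamma>. emeasure (return borel (t e)) A) / ennreal (real (length \<gamma>)))"
    by (rule countably_additiveI) (simp add: sums ennreal_suminf_divide del: emeasure_return)
qed (use assms in auto)

lemma prob_space_empirical_measure:
  assumes "\<gamma> \<noteq> []"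
  shows "prob_space (empirical_measure t \<gamma>)"
proof
  have "(\<Sum>e\<leftarrow>\<gamma>. emeasure (return borel (t e)) (UNIV :: real set)) = ennreal (real (length \<gamma>))"
    by (simp add: sum_list_triv ennreal_of_nat_eq_real_of_nat)
  with assms show "emeasure (empirical_measure t \<gamma>) (space (empirical_measure t \<gamma>)) = 1"
    by (simp add: emeasure_empirical_measure ennreal_divide_self)
qed

end

theory Submission
  imports Defs
begin

text \<open>Call an edge open if its weight vanishes, and let the distance of two vertices be the least
  number of closed edges on a walk between them. If, with edges open with probability
  \<open>p = F 0\<close>, some annulus were unlikely to be crossed by open edges, then by continuity and a
  Peierls argument there would be no percolation slightly above \<open>p\<close>. So for \<open>p \<ge> p\<^sub>c\<close> annuli of
  all sizes are crossed with a probability bounded below. A positive time constant of the distance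
  would contradict this, hence distances in a box of side \<open>n\<close> are uniformly \<open>o(n)\<close>.

  No moment of the weights is assumed, so walks realising the distance have to avoid the edges of
  weight above a large constant \<open>b\<close>. Given the open edges, these heavy edges are dominated by a
  sparse independent field; their clusters met by a given walk have total size of the order of its
  number of closed edges, and going around a cluster costs at most a multiple of its size, as the
  outer boundary of a connected set is *-connected. A geodesic soon reaches a vertex that is not
  enclosed by such a cluster, so the passage time of its first \<open>l\<close> edges is \<open>o(l)\<close>, up to \<open>o(l)\<close>
  edges at the beginning, and only \<open>o(l)\<close> of them have weight above a given \<open>\<epsilon> > 0\<close>.\<close>

section \<open>Walks on the lattice\<close>

text \<open>If \<open>F 0\<close> equals the critical probability, nothing is known about infinite
  open clusters, so none is used: criticality enters only as a lower bound on crossing probabilities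
  at all scales, which treats \<open>F 0 > critical_prob\<close> in the same way.

  Percolation estimates are made on finite edge sets. There an expectation is a polynomial in
  \<open>p\<close>, whence the continuity; and declaring all other edges closed can only lengthen
  distances, so upper bounds carry over to the lattice. The time constant appears as an infimum of
  means over finite edge sets, and a variance bound for sums of translated blocks takes the place of
  an ergodic theorem. That bound leaves an error of order \<open>1 / h\<close> at scale
  \<open>h\<close>, which is summable only along a sparse sequence; hence the scales
  \<open>2 ^ k\<close>.

  The almost sure event must serve all geodesics, from every starting point. It is therefore a
  statement about boxes \<open>cube 0 (m * 2 ^ k)\<close> for every \<open>m\<close>, with a cost
  \<open>c * 2 ^ k\<close> whose \<open>c\<close> does not depend on \<open>m\<close>; what follows
  about geodesics is deterministic, and letting \<open>m\<close> grow makes the cost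
  negligible.\<close>

lemma lattice_adj_iff:
  "lattice_adj x y \<longleftrightarrow> (\<exists>i. y = x + axis i 1 \<or> x = y + axis i (1::int))"
proof
  assume "lattice_adj x y"
  then have s: "(\<Sum>i\<in>UNIV. \<bar>x $ i - y $ i\<bar>) = 1" by (simp add: lattice_adj_def)
  then obtain i where i: "\<bar>x $ i - y $ i\<bar> \<noteq> 0"
    by (metis (no_types, lifting) sum.not_neutral_contains_not_neutral zero_neq_one)
  have "(\<Sum>i\<in>UNIV. \<bar>x $ i - y $ i\<bar>) = \<bar>x $ i - y $ i\<bar> + (\<Sum>j\<in>UNIV-{i}. \<bar>x $ j - y $ j\<bar>)"
    by (simp add: sum.remove)
  moreover have nn: "(\<Sum>j\<in>UNIV-{i}. \<bar>x $ j - y $ j\<bar>) \<ge> 0" by (simp add: sum_nonneg)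
  ultimately have "\<bar>x $ i - y $ i\<bar> = 1" "(\<Sum>j\<in>UNIV-{i}. \<bar>x $ j - y $ j\<bar>) = 0" using s i by linarith+
  then have "\<And>j. j \<noteq> i \<Longrightarrow> x $ j = y $ j" "x $ i - y $ i = 1 \<or> x $ i - y $ i = -1"
    by (subst (asm) sum_nonneg_eq_0_iff; auto)+
  then show "\<exists>i. y = x + axis i 1 \<or> x = y + axis i 1"
    by (intro exI[of _ i]) (auto simp: vec_eq_iff axis_def)
next
  assume "\<exists>i. y = x + axis i 1 \<or> x = y + axis i (1::int)"
  then obtain i where "y = x + axis i 1 \<or> x = y + axis i (1::int)" by blast
  then have "\<bar>x $ j - y $ j\<bar> = (if j = i then 1 else 0)" for j
    by (auto simp: axis_def)
  then show "lattice_adj x y" by (simp add: lattice_adj_def)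
qed

lemma lattice_adj_sym: "lattice_adj x y \<longleftrightarrow> lattice_adj y x"
  by (auto simp: lattice_adj_iff)

lemma lattice_adj_coord: "lattice_adj x y \<Longrightarrow> \<bar>x $ i - y $ i\<bar> \<le> 1"
  by (auto simp: lattice_adj_iff axis_def)

lemma lattice_edgesI: "lattice_adj x y \<Longrightarrow> {x, y} \<in> lattice_edges"
  by (auto simp: lattice_edges_def)

lemma lattice_edges_pair: "{x, y} \<in> lattice_edges \<longleftrightarrow> lattice_adj x y"
  by (auto simp: lattice_edges_def doubleton_eq_iff lattice_adj_sym)

lemma lattice_edges_nonempty: "(lattice_edges :: (int ^ 'd::finite) set set) \<noteq> {}"
proof -
  have "lattice_adj (0 :: int ^ 'd) (0 + axis undefined 1)" unfolding lattice_adj_iff by blast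
  then show ?thesis using lattice_edgesI by blast
qed

text \<open>Vertex lists that may revisit vertices: concatenation then needs no care, and
  self-avoidance is restored once, by \<open>loop_erasure\<close>.\<close>

definition lpath :: "(int ^ 'd) list \<Rightarrow> int ^ 'd \<Rightarrow> int ^ 'd \<Rightarrow> bool" where
  "lpath vs x y \<longleftrightarrow> vs \<noteq> [] \<and> hd vs = x \<and> last vs = y \<and> successively lattice_adj vs"

fun wt :: "('v set \<Rightarrow> real) \<Rightarrow> 'v list \<Rightarrow> real" where
  "wt t [] = 0"
| "wt t [x] = 0"
| "wt t (x # y # vs) = t {x, y} + wt t (y # vs)"

lemma wt_passage_time:
  "wt t vs = passage_time t (map2 (\<lambda>u v. {u, v}) (butlast vs) (tl vs))"
  by (induction t vs rule: wt.induct) (auto simp: passage_time_def)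

lemma wt_append: "wt t (xs @ x # ys) = wt t (xs @ [x]) + wt t (x # ys)"
proof (induction xs)
  case (Cons a xs)
  then show ?case by (cases xs) auto
qed simp

lemma wt_nonneg:
  assumes "successively lattice_adj vs" "\<And>e. e \<in> lattice_edges \<Longrightarrow> 0 \<le> t e"
  shows "0 \<le> wt t vs"
  using assms(1)
proof (induction vs rule: induct_list012)
  case (3 x y vs)
  then show ?case using assms(2)[OF lattice_edgesI, of x y] by auto
qed auto

lemma wt_mono:
  assumes "successively lattice_adj vs" "\<And>u v. lattice_adj u v \<Longrightarrow> u \<in> set vs \<Longrightarrow> v \<in> set vs \<Longrightarrow> t {u,v}
      \<le> s {u,v}"
  shows "wt t vs \<le> wt s vs"
  using assms
proof (induction t vs rule: wt.induct)
  case (3 t x y vs)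
  then have "t {x, y} \<le> s {x, y}" "wt t (y # vs) \<le> wt s (y # vs)" by (auto simp: insert_commute)
  then show ?case by simp
qed auto

lemma wt_const: "vs \<noteq> [] \<Longrightarrow> wt (\<lambda>_. c) vs = c * (real (length vs) - 1)"
  by (induction vs rule: induct_list012) (auto simp: algebra_simps)

lemma wt_rev: "wt t (rev vs) = wt t vs"
proof (induction vs rule: induct_list012)
  case (3 x y vs)
  have "wt t (rev (x # y # vs)) = wt t (rev vs @ [y]) + wt t [y, x]"
    using wt_append[of t "rev vs" y "[x]"] by simp
  then show ?case using 3 by (simp add: insert_commute)
qed auto

lemma lpath_single [simp]: "lpath [x] a b \<longleftrightarrow> a = x \<and> b = x"
  by (auto simp: lpath_def)

lemma lpath_Cons: "lattice_adj x y \<Longrightarrow> lpath vs y z \<Longrightarrow> lpath (x # vs) x z"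
  by (cases vs) (auto simp: lpath_def)

lemma lpath_Cons_iff: "lpath (x # y # vs) a b \<longleftrightarrow> x = a \<and> lattice_adj x y \<and> lpath (y # vs) y b"
  by (auto simp: lpath_def)

lemma lpath_rev: "lpath vs x y \<Longrightarrow> lpath (rev vs) y x"
  by (auto simp: lpath_def successively_rev hd_rev last_rev lattice_adj_sym)

lemma lpath_trans:
  assumes "lpath xs x y" "lpath ys y z"
  shows "lpath (xs @ tl ys) x z" "wt t (xs @ tl ys) = wt t xs + wt t ys"
proof -
  obtain ys' where ys: "ys = y # ys'" using assms(2) by (cases ys) (auto simp: lpath_def)
  obtain xs' where xs: "xs = xs' @ [y]" using assms(1) by (cases xs rule: rev_cases) (auto simp:
      lpath_def)
  show "lpath (xs @ tl ys) x z" using assms unfolding xs ys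
    by (auto simp: lpath_def successively_append_iff hd_append split: if_splits)
  show "wt t (xs @ tl ys) = wt t xs + wt t ys"
    unfolding xs ys using wt_append[of t xs' y ys'] by simp
qed

lemma lpath_split:
  assumes "lpath (xs @ v # ys) x y"
  shows "lpath (xs @ [v]) x v" "lpath (v # ys) v y"
  using assms by (auto simp: lpath_def successively_append_iff hd_append split: if_splits)

text \<open>An upper bound on the first-passage time, stated without an infimum so that no question
  of attainment arises.\<close>

definition reach :: "((int ^ 'd) set \<Rightarrow> real) \<Rightarrow> int ^ 'd \<Rightarrow> int ^ 'd \<Rightarrow> real \<Rightarrow> bool" where
  "reach t x y c \<longleftrightarrow> (\<exists>vs. lpath vs x y \<and> wt t vs \<le> c)"

lemma reach_refl: "0 \<le> c \<Longrightarrow> reach t x x c"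
  unfolding reach_def by (rule exI[of _ "[x]"]) simp

lemma reach_trans: "reach t x y a \<Longrightarrow> reach t y z b \<Longrightarrow> reach t x z (a + b)"
proof -
  assume "reach t x y a" "reach t y z b"
  then obtain xs ys where "lpath xs x y" "wt t xs \<le> a" "lpath ys y z" "wt t ys \<le> b" by (auto simp:
      reach_def)
  then show ?thesis unfolding reach_def using lpath_trans[of xs x y ys z] by (intro exI[of _ "xs @
      tl ys"]) auto
qed

lemma reach_mono: "reach t x y a \<Longrightarrow> a \<le> b \<Longrightarrow> reach t x y b"
  unfolding reach_def by force

lemma reach_adj: "lattice_adj x y \<Longrightarrow> t {x, y} \<le> c \<Longrightarrow> reach t x y c"
  unfolding reach_def by (rule exI[of _ "[x, y]"]) (simp add: lpath_def)

text \<open>When a new first vertex already occurs in the loop-free rest, the part before that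
  occurrence is dropped, which is no loss since weights are nonnegative.\<close>

lemma loop_erasure:
  assumes "lpath vs x y" "\<And>e. e \<in> lattice_edges \<Longrightarrow> 0 \<le> t e"
  shows "\<exists>ws. lpath ws x y \<and> distinct ws \<and> wt t ws \<le> wt t vs"
  using assms(1)
proof (induction vs arbitrary: x)
  case Nil
  then show ?case by (simp add: lpath_def)
next
  case (Cons a vs)
  show ?case
  proof (cases vs)
    case Nil
    then show ?thesis using Cons.prems by (intro exI[of _ "[a]"]) (auto simp: lpath_def)
  next
    case (Cons b vs')
    then have h: "a = x" "lattice_adj x b" "lpath vs b y"
      using Cons.prems by (auto simp: lpath_Cons_iff)
    obtain ws where ws: "lpath ws b y" "distinct ws" "wt t ws \<le> wt t vs" using Cons.IH[OF h(3)] by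
        blast
    have le: "wt t ws \<le> wt t (a # vs)" using ws(3) h assms(2)[OF lattice_edgesI[OF h(2)]] Cons by
        simp
    show ?thesis
    proof (cases "x \<in> set ws")
      case True
      then obtain p s where p: "ws = p @ x # s" by (auto simp: in_set_conv_decomp)
      have "wt t ws = wt t (p @ [x]) + wt t (x # s)" unfolding p by (rule wt_append)
      moreover have "wt t (p @ [x]) \<ge> 0"
        using ws(1) p assms(2) by (intro wt_nonneg) (auto simp: lpath_def successively_append_iff)
      ultimately show ?thesis using lpath_split(2)[of p x s] ws p le by (intro exI[of _ "x # s"])
          auto
    next
      case False
      obtain ws' where "ws = b # ws'" using ws(1) by (cases ws) (auto simp: lpath_def)
      then show ?thesis using False ws h Cons lpath_Cons[OF h(2) ws(1)]
        by (intro exI[of _ "x # ws"]) (auto simp:)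
    qed
  qed
qed

text \<open>Geodesics compete only with self-avoiding paths; loop erasure lets every walk
  compete.\<close>

lemma geodesic_reach:
  assumes "finite_geodesic t x y \<gamma>" "reach t x y c" "\<And>e. e \<in> lattice_edges \<Longrightarrow> 0 \<le> t e"
  shows "passage_time t \<gamma> \<le> c"
proof -
  obtain vs where "lpath vs x y" "wt t vs \<le> c" using assms(2) by (auto simp: reach_def)
  then obtain ws where ws: "lpath ws x y" "distinct ws" "wt t ws \<le> c"
    using loop_erasure[of vs x y t] assms(3) by fastforce
  have "self_avoiding_path x y (map2 (\<lambda>u v. {u, v}) (butlast ws) (tl ws))"
    unfolding self_avoiding_path_def using ws by (intro exI[of _ ws]) (auto simp: lpath_def)
  then have "passage_time t \<gamma> \<le> passage_time t (map2 (\<lambda>u v. {u, v}) (butlast ws) (tl ws))"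
    using assms(1) by (auto simp: finite_geodesic_def)
  then show ?thesis using ws(3) by (simp add: wt_passage_time)
qed

subsection \<open>Boxes and monotone paths\<close>

definition cube :: "int ^ 'd \<Rightarrow> nat \<Rightarrow> (int ^ 'd) set" where
  "cube c n = {x. \<forall>i. \<bar>x $ i - c $ i\<bar> \<le> int n}"

definition l1 :: "int ^ 'd \<Rightarrow> int ^ 'd \<Rightarrow> nat" where
  "l1 x y = nat (\<Sum>i\<in>UNIV. \<bar>x $ i - y $ i\<bar>)"

lemma cube_finite_card:
  fixes c :: "int ^ 'd::finite"
  shows "finite (cube c n)" "card (cube c n) \<le> (2 * n + 1) ^ CARD('d)"
proof -
  let ?P = "PiE (UNIV::'d set) (\<lambda>i. {c $ i - int n .. c $ i + int n})"
  have "x $ i \<in> {c $ i - int n .. c $ i + int n}" if "x \<in> cube c n" for x i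
  proof -
    have "\<bar>x $ i - c $ i\<bar> \<le> int n" using that by (auto simp: cube_def)
    then show ?thesis by auto
  qed
  then have sub: "vec_nth ` cube c n \<subseteq> ?P" by blast
  have inj: "inj_on vec_nth (cube c n)" by (auto simp: inj_on_def vec_nth_inject)
  have fin: "finite ?P" by (intro finite_PiE) auto
  show "finite (cube c n)" using finite_imageD[OF finite_subset[OF sub fin] inj] .
  have "card (cube c n) \<le> card ?P" using card_inj_on_le[OF inj sub fin] .
  also have "\<dots> = (2 * n + 1) ^ CARD('d)" by (simp add: card_PiE nat_add_distrib nat_mult_distrib
      algebra_simps)
  finally show "card (cube c n) \<le> (2 * n + 1) ^ CARD('d)" .
qed

lemma cube_self [simp]: "c \<in> cube c n"
  by (simp add: cube_def)

lemma cube_mono: "m \<le> n \<Longrightarrow> cube c m \<subseteq> cube c n"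
  unfolding cube_def by (auto intro: order_trans)

lemma cube_sym: "x \<in> cube c n \<longleftrightarrow> c \<in> cube x n"
  by (simp add: cube_def abs_minus_commute)

lemma cube_trans: "x \<in> cube y m \<Longrightarrow> y \<in> cube z n \<Longrightarrow> x \<in> cube z (m + n)"
proof -
  assume h: "x \<in> cube y m" "y \<in> cube z n"
  have "\<bar>x $ i - z $ i\<bar> \<le> int (m + n)" for i
  proof -
    have "\<bar>x $ i - y $ i\<bar> \<le> int m" "\<bar>y $ i - z $ i\<bar> \<le> int n" using h by (auto simp: cube_def)
    then show ?thesis by linarith
  qed
  then show ?thesis by (simp add: cube_def)
qed

lemma l1_cube: "x \<in> cube y n \<Longrightarrow> l1 x y \<le> CARD('d) * n" for x y :: "int ^ 'd::finite"
  using sum_bounded_above[of "UNIV::'d set" "\<lambda>i. \<bar>x $ i - y $ i\<bar>" "int n"]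
  by (auto simp: l1_def cube_def nat_le_iff)

text \<open>Each step moves one coordinate towards its target. The confinement between the end
  coordinates is what later keeps such walks inside a cube, or in a hyperplane that misses a
  cube.\<close>

lemma mono_path:
  fixes u v :: "int ^ 'd::finite"
  shows "\<exists>vs. lpath vs u v \<and> length vs = l1 u v + 1 \<and>
    (\<forall>z\<in>set vs. \<forall>i. min (u $ i) (v $ i) \<le> z $ i \<and> z $ i \<le> max (u $ i) (v $ i))"
proof (induction "l1 u v" arbitrary: u)
  case 0
  then have "u = v" by (auto simp: l1_def vec_eq_iff sum_nonneg sum_nonneg_eq_0_iff)
      (metis (no_types, lifting) abs_ge_zero abs_le_zero_iff add_0 eq_iff_diff_eq_0 finite_code
          iso_tuple_UNIV_I member_le_sum order_trans)
  then show ?case using 0 by (intro exI[of _ "[u]"]) auto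
next
  case (Suc n)
  then have "u \<noteq> v" by (auto simp: l1_def)
  then obtain i where i: "u $ i \<noteq> v $ i" by (auto simp: vec_eq_iff)
  define s where "s = sgn (v $ i - u $ i)"
  define u' where "u' = u + axis i s"
  have s: "s = 1 \<and> u $ i < v $ i \<or> s = -1 \<and> u $ i > v $ i" using i by (auto simp: s_def sgn_if)
  have u'i: "u' $ i = u $ i + s" "\<And>j. j \<noteq> i \<Longrightarrow> u' $ j = u $ j" by (auto simp: u'_def axis_def)
  have adj: "lattice_adj u u'" using s unfolding lattice_adj_iff
    by (intro exI[of _ i]) (auto simp: u'_def vec_eq_iff axis_def)
  have "(\<Sum>j\<in>UNIV. \<bar>u $ j - v $ j\<bar>) = \<bar>u $ i - v $ i\<bar> + (\<Sum>j\<in>UNIV-{i}. \<bar>u $ j - v $ j\<bar>)"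
    "(\<Sum>j\<in>UNIV. \<bar>u' $ j - v $ j\<bar>) = \<bar>u' $ i - v $ i\<bar> + (\<Sum>j\<in>UNIV-{i}. \<bar>u' $ j - v $ j\<bar>)"
    by (simp_all add: sum.remove)
  moreover have "(\<Sum>j\<in>UNIV-{i}. \<bar>u' $ j - v $ j\<bar>) = (\<Sum>j\<in>UNIV-{i}. \<bar>u $ j - v $ j\<bar>)"
    using u'i by (intro sum.cong) auto
  moreover have "\<bar>u' $ i - v $ i\<bar> = \<bar>u $ i - v $ i\<bar> - 1" using s u'i by auto
  moreover have "(\<Sum>j\<in>UNIV-{i}. \<bar>u $ j - v $ j\<bar>) \<ge> 0" by (simp add: sum_nonneg)
  ultimately have "(\<Sum>j\<in>UNIV. \<bar>u $ j - v $ j\<bar>) = (\<Sum>j\<in>UNIV. \<bar>u' $ j - v $ j\<bar>) + 1" by linarith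
  moreover have "(\<Sum>j\<in>UNIV. \<bar>u' $ j - v $ j\<bar>) \<ge> 0" by (simp add: sum_nonneg)
  ultimately have "l1 u v = Suc (l1 u' v)" unfolding l1_def by linarith
  then obtain vs where vs: "lpath vs u' v" "length vs = n + 1"
    "\<And>z j. z \<in> set vs \<Longrightarrow> min (u' $ j) (v $ j) \<le> z $ j \<and> z $ j \<le> max (u' $ j) (v $ j)"
    using Suc by (metis nat.inject)
  have mm: "min (u $ j) (v $ j) \<le> min (u' $ j) (v $ j) \<and> max (u' $ j) (v $ j) \<le> max (u $ j) (v $
      j)" for j
    using s u'i by (cases "j = i") auto
  have "min (u $ j) (v $ j) \<le> z $ j \<and> z $ j \<le> max (u $ j) (v $ j)" if "z \<in> set (u # vs)" for z j
    using vs(3)[of z j] mm[of j] that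
    by (cases "z = u") (simp_all, linarith)
  then show ?case using vs(2) lpath_Cons[OF adj vs(1)] Suc(2)
    by (intro exI[of _ "u # vs"]) auto
qed

section \<open>Connectivity and outer boundaries\<close>

definition conn :: "(int ^ 'd) set \<Rightarrow> int ^ 'd \<Rightarrow> int ^ 'd \<Rightarrow> bool" where
  "conn X u v \<longleftrightarrow> u \<in> X \<and> (\<lambda>a b. lattice_adj a b \<and> b \<in> X)\<^sup>*\<^sup>* u v"

lemma conn_refl: "u \<in> X \<Longrightarrow> conn X u u"
  by (simp add: conn_def)

lemma conn_in: "conn X u v \<Longrightarrow> u \<in> X \<and> v \<in> X"
  by (auto simp: conn_def elim: rtranclp.cases)

lemma conn_trans: "conn X u v \<Longrightarrow> conn X v w \<Longrightarrow> conn X u w"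
  by (auto simp: conn_def)

lemma conn_adj: "lattice_adj u v \<Longrightarrow> u \<in> X \<Longrightarrow> v \<in> X \<Longrightarrow> conn X u v"
  by (auto simp: conn_def)

lemma conn_induct [consumes 1, case_names refl step]:
  assumes "conn X u v" "u \<in> X \<Longrightarrow> P u"
    "\<And>y z. conn X u y \<Longrightarrow> lattice_adj y z \<Longrightarrow> y \<in> X \<Longrightarrow> z \<in> X \<Longrightarrow> P y \<Longrightarrow> P z"
  shows "P v"
proof -
  have "(\<lambda>a b. lattice_adj a b \<and> b \<in> X)\<^sup>*\<^sup>* u v" "u \<in> X" using assms(1) by (auto simp: conn_def)
  then show ?thesis
  proof (induction rule: rtranclp_induct)
    case (step y z)
    then have "conn X u y" by (simp add: conn_def)
    then show ?case using step assms(3) conn_in by blast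
  qed (use assms in \<open>auto simp: conn_def\<close>)
qed

lemma conn_sym: "conn X u v \<Longrightarrow> conn X v u"
proof (induction rule: conn_induct)
  case (step y z)
  then show ?case using conn_trans conn_adj[of z y X] by (metis lattice_adj_sym)
qed (rule conn_refl)

lemma conn_mono: "conn X u v \<Longrightarrow> X \<subseteq> Y \<Longrightarrow> conn Y u v"
proof (induction rule: conn_induct)
  case (step y z)
  then show ?case using conn_trans conn_adj[of y z Y] by blast
qed (auto intro: conn_refl)

lemma conn_lpath:
  assumes "lpath vs x y" "set vs \<subseteq> X"
  shows "conn X x y"
  using assms
proof (induction vs arbitrary: x)
  case (Cons a vs)
  show ?case
  proof (cases vs)
    case Nil
    then show ?thesis using Cons.prems by (auto simp: conn_refl)
  next
    case (Cons b vs')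
    then have "x = a" "lattice_adj a b" "lpath vs b y" "b \<in> X" "a \<in> X" using Cons.prems by (auto
        simp: lpath_Cons_iff)
    then show ?thesis using Cons.IH Cons.prems conn_trans conn_adj by (metis insert_subset
        list.simps(15))
  qed
qed (simp add: lpath_def)

lemma lpath_conn: "conn X x y \<Longrightarrow> \<exists>vs. lpath vs x y \<and> set vs \<subseteq> X \<and> distinct vs"
proof -
  assume "conn X x y"
  then have "\<exists>vs. lpath vs y x \<and> set vs \<subseteq> X \<and> distinct vs"
  proof (induction rule: conn_induct)
    case refl
    then show ?case by (intro exI[of _ "[x]"]) simp
  next
    case (step y z)
    then obtain vs where vs: "lpath vs y x" "set vs \<subseteq> X" "distinct vs" by blast
    show ?case
    proof (cases "z \<in> set vs")
      case True
      then obtain p s where p: "vs = p @ z # s" by (auto simp: in_set_conv_decomp)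
      show ?thesis using vs lpath_split(2)[of p z s] unfolding p by (intro exI[of _ "z # s"]) auto
    next
      case False
      then show ?thesis using vs step lpath_Cons[of z y vs x]
        by (intro exI[of _ "z # vs"]) (auto simp: lattice_adj_sym)
    qed
  qed
  then show ?thesis by (metis lpath_rev set_rev distinct_rev)
qed

lemma lpath_cube:
  assumes "lpath vs x y"
  shows "y \<in> cube x (length vs - 1)"
  using assms
proof (induction vs arbitrary: x)
  case (Cons a vs)
  show ?case
  proof (cases vs)
    case Nil
    then show ?thesis using Cons.prems by auto
  next
    case (Cons b vs')
    then have h: "x = a" "lattice_adj a b" "lpath vs b y" using Cons.prems by (auto simp:
        lpath_Cons_iff)
    have "y \<in> cube b (length vs - 1)" using Cons.IH h by blast
    moreover have "b \<in> cube a 1" using h lattice_adj_coord[of b a] by (auto simp: cube_def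
        lattice_adj_sym)
    ultimately show ?thesis using cube_trans[of y b "length vs - 1" a 1] h Cons by simp
  qed
qed (simp add: lpath_def)

lemma conn_card_cube:
  assumes "conn X x y" "finite X" "card X \<le> Suc n"
  shows "y \<in> cube x n"
proof -
  obtain vs where vs: "lpath vs x y" "set vs \<subseteq> X" "distinct vs" using lpath_conn assms by blast
  then have "length vs \<le> card X" using assms(2) by (metis card_mono distinct_card)
  then have "length vs - 1 \<le> n" using assms(3) by simp
  then show ?thesis using lpath_cube[OF vs(1)] cube_mono[of "length vs - 1" n x] by blast
qed

text \<open>Otherwise the component of \<open>w\<close> in \<open>X\<close> misses \<open>C\<close>
  entirely, and a walk from \<open>w\<close> back to \<open>x\<close> avoids
  \<open>C\<close>.\<close>

lemma conn_avoid:
  assumes "conn X x w" "\<not> conn (X - C) x w"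
  shows "\<exists>c\<in>C. conn X c w"
proof (rule ccontr)
  assume no: "\<not> (\<exists>c\<in>C. conn X c w)"
  have "conn X x w" by fact
  then have "conn (X - C) w x"
  proof (induction rule: conn_induct[OF conn_sym, consumes 1, case_names refl step])
    case refl
    then show ?case using no assms conn_in[of X x w] conn_refl[of w X] by (auto intro: conn_refl)
  next
    case (step y z)
    then have "conn X w z" using conn_trans[of X w y z] conn_adj[of y z X] by auto
    then have "z \<notin> C" using no conn_sym by blast
    then show ?case using step conn_trans[of "X - C" w y z] conn_adj[of y z "X - C"] conn_in[of "X
        - C" w y] by auto
  qed
  then show False using assms(2) conn_sym by blast
qed

text \<open>A vertex outside the cube has a coordinate that is too large in modulus, and moves
  freely while that coordinate is kept. Changing the protecting coordinate needs a second one, hence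
  \<open>CARD('d) \<ge> 2\<close>.\<close>

lemma cube_complement_connected:
  fixes u v :: "int ^ 'd::finite"
  assumes d: "CARD('d) \<ge> 2" and u: "u \<notin> cube c n" and v: "v \<notin> cube c n"
  shows "conn (- cube c n) u v"
proof -
  have fixco: "conn (- cube c n) x y" if "\<bar>x $ i - c $ i\<bar> > int n" "x $ i = y $ i" for x y i
  proof -
    obtain vs where vs: "lpath vs x y"
      "\<And>z j. z \<in> set vs \<Longrightarrow> min (x $ j) (y $ j) \<le> z $ j \<and> z $ j \<le> max (x $ j) (y $ j)"
      using mono_path[of x y] by blast
    have "z \<notin> cube c n" if "z \<in> set vs" for z
    proof -
      have "z $ i = x $ i" using vs(2)[OF that, of i] \<open>x $ i = y $ i\<close> by simp
      then have "\<bar>z $ i - c $ i\<bar> > int n" using \<open>\<bar>x $ i - c $ i\<bar> > int n\<close> by simp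
      then show ?thesis by (auto simp: cube_def intro!: exI[of _ i])
    qed
    then have "set vs \<subseteq> - cube c n" by blast
    then show ?thesis by (rule conn_lpath[OF vs(1)])
  qed
  have two: "conn (- cube c n) x y" if "\<bar>x $ i - c $ i\<bar> > int n" "\<bar>y $ j - c $ j\<bar> > int n" "i \<noteq> j"
      for x y i j
  proof -
    \<comment> \<open>This vertex shares the large coordinate \<open>i\<close> with \<open>x\<close>
      and the large coordinate \<open>j\<close> with \<open>y\<close>.\<close>
    define w where "w = (\<chi> m. if m = i then x $ i else y $ m)"
    have "conn (- cube c n) x w" by (rule fixco[OF that(1)]) (simp add: w_def)
    moreover have "conn (- cube c n) y w" by (rule fixco[OF that(2)]) (use that(3) in \<open>simp add:
        w_def\<close>)
    ultimately show ?thesis using conn_trans conn_sym by blast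
  qed
  obtain i where i: "\<bar>u $ i - c $ i\<bar> > int n" using u by (auto simp: cube_def not_le)
  obtain j where j: "\<bar>v $ j - c $ j\<bar> > int n" using v by (auto simp: cube_def not_le)
  show ?thesis
  proof (cases "i = j")
    case False
    then show ?thesis using two i j by blast
  next
    case True
    \<comment> \<open>The two vertices may lie on opposite sides of the cube in the same direction,
      so the route leaves through another direction \<open>k\<close>.\<close>
    obtain k where k: "k \<noteq> i" using d by (metis card_2_iff' ex_card iso_tuple_UNIV_I
        numeral_le_one_iff one_add_one subsetD top_greatest)
    define w where "w = (\<chi> m. if m = k then c $ k + int n + 1 else u $ m)"
    have "conn (- cube c n) u w" by (rule fixco[OF i]) (use k in \<open>simp add: w_def\<close>)
    moreover have "conn (- cube c n) w v" by (rule two[of w k v j]) (use k j True in \<open>simp_all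
        add: w_def\<close>)
    ultimately show ?thesis using conn_trans by blast
  qed
qed

subsection \<open>Closed one-forms on the lattice are exact\<close>

text \<open>The antiderivative on the integers that vanishes at 0.\<close>

definition signed_sum :: "(int \<Rightarrow> int) \<Rightarrow> int \<Rightarrow> int" where
  "signed_sum a n = (if 0 \<le> n then sum a {0..<n} else - sum a {n..<0})"

lemma signed_sum_step: "signed_sum a (n + 1) = signed_sum a n + a n"
proof (cases "0 \<le> n")
  case True
  then have "{0..<n + 1} = insert n {0..<n}" by auto
  then show ?thesis using True by (simp add: signed_sum_def)
next
  case False
  then have "{n..<0} = insert n {n + 1..<0}" by auto
  then have "sum a {n..<0} = a n + sum a {n + 1..<0}" by simp
  then show ?thesis using False by (simp add: signed_sum_def)
qed

text \<open>The potential is built one direction at a time. What is left of \<open>g\<close> in a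
  new direction \<open>j\<close> is, by closedness, constant along the directions already treated,
  so summing it along \<open>j\<close> does not disturb them.\<close>

lemma closed_form_exact:
  fixes g :: "'d::finite \<Rightarrow> int ^ 'd \<Rightarrow> int"
  assumes closed: "\<And>i j x. g i x + g j (x + axis i 1) = g j x + g i (x + axis j 1)"
  shows "\<exists>\<phi>. \<forall>i x. g i x = \<phi> (x + axis i 1) - \<phi> x"
proof -
  have "\<exists>\<phi>. \<forall>i\<in>S. \<forall>x. g i x = \<phi> (x + axis i 1) - \<phi> x" if "finite S" for S
    using that
  proof (induction S rule: finite_induct)
    case empty
    then show ?case by simp
  next
    case (insert j S)
    then obtain \<phi> where \<phi>: "\<And>i x. i \<in> S \<Longrightarrow> g i x = \<phi> (x + axis i 1) - \<phi> x" by blast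
    define h where "h x = g j x - (\<phi> (x + axis j 1) - \<phi> x)" for x
    have h_inv: "h (x + axis i 1) = h x" if "i \<in> S" for i x
    proof -
      have "x + axis i 1 + axis j 1 = x + axis j 1 + axis i 1" by (simp add: algebra_simps)
      then show ?thesis using closed[of i x j] \<phi>[OF that, of x] \<phi>[OF that, of "x + axis j 1"]
        unfolding h_def by (simp only: algebra_simps)
    qed
    define up where "up x k = (\<chi> m. if m = j then k else x $ m)" for x :: "int ^ 'd" and k
    define \<psi> where "\<psi> x = signed_sum (\<lambda>k. h (up x k)) (x $ j)" for x
    have "\<psi> (x + axis j 1) = \<psi> x + h x" for x
    proof -
      have "up (x + axis j 1) = up x" by (auto simp: up_def vec_eq_iff axis_def fun_eq_iff)
      moreover have "up x (x $ j) = x" by (auto simp: up_def vec_eq_iff)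
      ultimately show ?thesis using signed_sum_step[of "\<lambda>k. h (up x k)" "x $ j"] by (simp add:
          \<psi>_def)
    qed
    moreover have "\<psi> (x + axis i 1) = \<psi> x" if "i \<in> S" for x i
    proof -
      have "i \<noteq> j" using that insert by auto
      then have "up (x + axis i 1) k = up x k + axis i 1" for k by (auto simp: up_def vec_eq_iff
          axis_def)
      then show ?thesis using h_inv[OF that] \<open>i \<noteq> j\<close> by (simp add: \<psi>_def axis_def)
    qed
    ultimately have "\<forall>i\<in>insert j S. \<forall>x. g i x = (\<lambda>x. \<phi> x + \<psi> x) (x + axis i 1) - (\<lambda>x. \<phi> x + \<psi> x) x"
      using \<phi> by (auto simp: h_def)
    then show ?case by (intro exI[of _ "\<lambda>x. \<phi> x + \<psi> x"]) simp
  qed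
  from this[of UNIV] show ?thesis by simp
qed

definition outer_bd :: "(int ^ 'd) set \<Rightarrow> (int ^ 'd) set" where
  "outer_bd C = {u. u \<notin> C \<and> (\<exists>v\<in>C. lattice_adj u v)}"

definition star :: "int ^ 'd \<Rightarrow> int ^ 'd \<Rightarrow> bool" where
  "star u v \<longleftrightarrow> (\<forall>i. \<bar>u $ i - v $ i\<bar> \<le> 1)"

definition star_rel :: "(int ^ 'd) set \<Rightarrow> ((int ^ 'd) \<times> (int ^ 'd)) set" where
  "star_rel X = {(u, v). u \<in> X \<and> v \<in> X \<and> star u v}"

lemma star_cube: "star u v \<longleftrightarrow> v \<in> cube u 1"
  by (simp add: star_def cube_def abs_minus_commute)

lemma star_sym: "star u v \<longleftrightarrow> star v u"
  by (simp add: star_def abs_minus_commute)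

text \<open>Count the steps from one *-component of the boundary into \<open>C\<close>. On a unit square this one-form
  vanishes or is the gradient of the indicator of \<open>C\<close>, hence it is exact. Its potential is constant
  on \<open>C\<close> and along walks avoiding \<open>C\<close>, so it cannot distinguish \<open>a\<close> from \<open>b\<close>.\<close>

lemma outer_bd_star_connected:
  fixes C :: "(int ^ 'd::finite) set"
  assumes C: "\<And>u v. u \<in> C \<Longrightarrow> v \<in> C \<Longrightarrow> conn C u v"
    and a: "a \<in> outer_bd C" and b: "b \<in> outer_bd C" and ab: "conn (- C) a b"
  shows "(a, b) \<in> (star_rel (outer_bd C))\<^sup>*"
proof -
  define B where "B = {u \<in> outer_bd C. (a, u) \<in> (star_rel (outer_bd C))\<^sup>*}"
  define f :: "int ^ 'd \<Rightarrow> int ^ 'd \<Rightarrow> int" where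
    "f x y = of_bool (x \<in> B \<and> y \<in> C) - of_bool (x \<in> C \<and> y \<in> B)" for x y
  have BC: "x \<notin> C" if "x \<in> B" for x using that by (auto simp: B_def outer_bd_def)
  have Bb: "x \<in> outer_bd C" if "x \<in> B" for x using that by (auto simp: B_def)
  have Bstar: "x \<in> B \<longleftrightarrow> y \<in> B" if "x \<in> outer_bd C" "y \<in> outer_bd C" "star x y" for x y
  proof -
    have "(x, y) \<in> star_rel (outer_bd C)" "(y, x) \<in> star_rel (outer_bd C)"
      using that by (auto simp: star_rel_def star_sym)
    then show ?thesis using that by (auto simp: B_def intro: rtrancl.rtrancl_into_rtrancl)
  qed
  have bd: "x \<in> outer_bd C" if "lattice_adj x y" "x \<notin> C" "y \<in> C" for x y using that by (auto simp:
      outer_bd_def)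
  have sq: "f x0 x1 + f x1 x3 = f x0 x2 + f x2 x3"
    if "lattice_adj x0 x1" "lattice_adj x1 x3" "lattice_adj x0 x2" "lattice_adj x2 x3"
      "star x0 x1" "star x0 x2" "star x0 x3" "star x1 x2" "star x1 x3" "star x2 x3" for x0 x1 x2 x3
  proof -

    let ?Q = "{x0, x1, x2, x3}"
    have st: "star x y" if "x \<in> ?Q" "y \<in> ?Q" for x y
      using that \<open>star x0 x1\<close> \<open>star x0 x2\<close> \<open>star x0 x3\<close> \<open>star x1 x2\<close> \<open>star x1 x3\<close> \<open>star x2 x3\<close>
      by (auto simp: star_def abs_minus_commute)
    show ?thesis
    proof (cases "\<exists>p\<in>?Q. p \<in> B")
      case True
      then obtain p where p: "p \<in> ?Q" "p \<in> B" by blast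
      \<comment> \<open>The vertices of the square are pairwise *-adjacent, so each of them that
        lies in the outer boundary belongs to \<open>B\<close> together with
        \<open>p\<close>.\<close>
      have grad: "f x y = of_bool (y \<in> C) - of_bool (x \<in> C)" if "x \<in> ?Q" "y \<in> ?Q" "lattice_adj x
          y" for x y
      proof -
        have "x \<in> B" if "x \<notin> C" "y \<in> C"
          using that bd[OF \<open>lattice_adj x y\<close>] Bstar[OF Bb[OF p(2)] _ st[OF p(1) \<open>x \<in> ?Q\<close>]] p(2) by
              blast
        moreover have "y \<in> B" if "y \<notin> C" "x \<in> C"
          using that bd[of y x] \<open>lattice_adj x y\<close> lattice_adj_sym[of x y]
            Bstar[OF Bb[OF p(2)] _ st[OF p(1) \<open>y \<in> ?Q\<close>]] p(2) by blast
        ultimately show ?thesis using BC[of x] BC[of y] by (auto simp: f_def)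
      qed
      show ?thesis using grad[of x0 x1] grad[of x1 x3] grad[of x0 x2] grad[of x2 x3] that(1-4) by
          simp
    next
      case False
      then have "f x y = 0" if "x \<in> ?Q" "y \<in> ?Q" for x y using that by (auto simp: f_def)
      then show ?thesis by simp
    qed
  qed
  define g where "g i x = f x (x + axis i 1)" for i x
  have "g i x + g j (x + axis i 1) = g j x + g i (x + axis j 1)" for i j x
  proof (cases "i = j")
    case False
    have eq: "x + axis i 1 + axis j 1 = x + axis j 1 + axis i 1" by (simp add: algebra_simps)
    have adj: "lattice_adj y (y + axis k 1)" for y and k :: 'd by (auto simp: lattice_adj_iff)
    have adj': "lattice_adj (x + axis i 1) (x + axis j 1 + axis i 1)" using adj[of "x + axis i 1"
        j] by (simp add: eq)
    show ?thesis unfolding g_def eq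
      by (rule sq[OF adj adj' adj adj]) (use False in \<open>auto simp: star_def axis_def\<close>)
  qed simp
  then obtain \<phi> where \<phi>: "\<And>i x. g i x = \<phi> (x + axis i 1) - \<phi> x" using closed_form_exact[of g] by
      blast
  have ex: "f x y = \<phi> y - \<phi> x" if xy: "lattice_adj x y" for x y
  proof -
    obtain i where "y = x + axis i 1 \<or> x = y + axis i 1" using xy unfolding lattice_adj_iff by blast
    moreover have "f x y = - f y x" by (simp add: f_def conj_commute)
    ultimately show ?thesis using \<phi>[of i x] \<phi>[of i y] by (auto simp: g_def)
  qed
  have const: "\<phi> u = \<phi> v" if "conn X u v" "X = C \<or> X = - C" for u v X
    using that(1)
  proof (induction rule: conn_induct)
    case (step y z)
    then have "f y z = 0" using that(2) BC by (auto simp: f_def)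
    then show ?case using step ex[of y z] by simp
  qed simp
  obtain a' where a': "a' \<in> C" "lattice_adj a a'" using a by (auto simp: outer_bd_def)
  obtain b' where b': "b' \<in> C" "lattice_adj b b'" using b by (auto simp: outer_bd_def)
  have "a \<in> B" "a \<notin> C" using a by (auto simp: B_def outer_bd_def)
  \<comment> \<open>The potential jumps by 1 from \<open>a\<close> into \<open>C\<close>; being
    constant on \<open>C\<close> and equal at \<open>a\<close> and \<open>b\<close>, it jumps by 1
    at \<open>b\<close> too, which only a vertex of \<open>B\<close> allows.\<close>
  then have "f a a' = 1" using a' by (auto simp: f_def)
  moreover have "\<phi> a' = \<phi> b'" "\<phi> a = \<phi> b" using const C a' b' ab by blast+
  ultimately have "f b b' = 1" using ex a' b' by simp
  then have "b \<in> B" by (simp add: f_def of_bool_def split: if_splits)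
  then show ?thesis by (simp add: B_def)
qed

section \<open>Detours around bad clusters\<close>

text \<open>Badness looks at the whole unit cube, not only at incident edges: a *-step from a good
  vertex can then be realised by nearest-neighbour edges of weight at most \<open>M\<close>.\<close>

definition bad :: "((int ^ 'd) set \<Rightarrow> real) \<Rightarrow> real \<Rightarrow> (int ^ 'd) set" where
  "bad t M = {v. \<exists>e\<in>lattice_edges. e \<subseteq> cube v 1 \<and> t e > M}"

definition cluster :: "(int ^ 'd) set \<Rightarrow> int ^ 'd \<Rightarrow> (int ^ 'd) set" where
  "cluster B v = {u. conn B v u}"

lemma cluster_self: "v \<in> B \<Longrightarrow> v \<in> cluster B v"
  by (simp add: cluster_def conn_refl)

lemma cluster_connected: "u \<in> cluster B v \<Longrightarrow> u' \<in> cluster B v \<Longrightarrow> conn (cluster B v) u u'"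
proof -
  have "conn (cluster B v) v u" if "conn B v u" for u
    using that
  proof (induction rule: conn_induct)
    case (step y z)
    then have "conn B v z" using conn_trans[of B v y z] conn_adj[of y z B] by auto
    then show ?case using step conn_trans[of "cluster B v" v y z] conn_adj[of y z "cluster B v"]
        by (auto simp: cluster_def)
  qed (auto intro: conn_refl cluster_self)
  then show "u \<in> cluster B v \<Longrightarrow> u' \<in> cluster B v \<Longrightarrow> conn (cluster B v) u u'"
    unfolding cluster_def using conn_trans conn_sym by blast
qed

lemma cluster_eq:
  assumes "u \<in> cluster B v" "u' \<in> cluster B v'" "u = u' \<or> lattice_adj u u'"
  shows "cluster B v = cluster B v'"
proof -
  have h: "conn B v u" "conn B v' u'" using assms by (auto simp: cluster_def)
  then have "conn B u u'" using assms(3) conn_in conn_adj conn_refl by metis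
  then have "conn B v v'" using h conn_trans conn_sym by metis
  then show ?thesis unfolding cluster_def using conn_trans conn_sym by blast
qed

text \<open>By maximality of the cluster. Detours along the outer boundary thus run through good
  vertices only.\<close>

lemma cluster_outer_bd: "outer_bd (cluster B v) \<inter> B = {}"
proof -
  have False if u: "u \<in> outer_bd (cluster B v)" "u \<in> B" for u
  proof -
    obtain z where "z \<in> cluster B v" "lattice_adj u z" "u \<notin> cluster B v" using u by (auto simp:
        outer_bd_def)
    moreover have "u \<in> cluster B u" using u by (rule_tac cluster_self)
    ultimately show False using cluster_eq[of u B u z v] by blast
  qed
  then show ?thesis by blast
qed

lemma star_step:
  fixes u v :: "int ^ 'd::finite" and M :: real
  assumes "star u v" "u \<notin> bad t M" "0 \<le> M"
  shows "reach t u v (CARD('d) * M)"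
proof -
  obtain vs where vs: "lpath vs u v" "length vs = l1 u v + 1"
    "\<And>z i. z \<in> set vs \<Longrightarrow> min (u $ i) (v $ i) \<le> z $ i \<and> z $ i \<le> max (u $ i) (v $ i)"
    using mono_path[of u v] by blast
  have sub: "z \<in> cube u 1" if "z \<in> set vs" for z
  proof -
    have "\<bar>z $ i - u $ i\<bar> \<le> 1" for i
      using vs(3)[OF that, of i] assms(1)[unfolded star_def, rule_format, of i] by linarith
    then show ?thesis by (simp add: cube_def)
  qed
  have "wt t vs \<le> wt (\<lambda>_. M) vs"
  proof (rule wt_mono)
    fix a b assume h: "lattice_adj a b" "a \<in> set vs" "b \<in> set vs"
    then have "{a, b} \<in> lattice_edges" "{a, b} \<subseteq> cube u 1" using sub lattice_edgesI by auto
    then show "t {a, b} \<le> M" using assms(2) by (auto simp: bad_def not_less)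
  qed (use vs in \<open>auto simp: lpath_def\<close>)
  also have "\<dots> = M * real (l1 u v)" using vs by (subst wt_const) (auto simp: lpath_def)
  also have "\<dots> \<le> M * real CARD('d)"
    using l1_cube[of u v 1] assms star_cube[of v u] star_sym by (intro mult_left_mono) auto
  finally show ?thesis using vs(1) by (auto simp: reach_def mult.commute)
qed

lemma outer_bd_finite_card:
  fixes C :: "(int ^ 'd::finite) set"
  assumes "finite C"
  shows "finite (outer_bd C)" "card (outer_bd C) \<le> 3 ^ CARD('d) * card C"
proof -
  have sub: "outer_bd C \<subseteq> (\<Union>v\<in>C. cube v 1)"
    using lattice_adj_coord by (fastforce simp: outer_bd_def cube_def)
  show "finite (outer_bd C)" using finite_subset[OF sub] assms cube_finite_card(1) by blast
  have "card (outer_bd C) \<le> card (\<Union>v\<in>C. cube v 1)" using card_mono[OF _ sub] assms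
      cube_finite_card(1) by blast
  also have "\<dots> \<le> (\<Sum>v\<in>C. card (cube v 1))" by (rule card_UN_le[OF assms])
  also have "\<dots> \<le> (\<Sum>v\<in>C. 3 ^ CARD('d))" by (rule sum_mono) (use cube_finite_card(2)[of _ 1] in simp)
  finally show "card (outer_bd C) \<le> 3 ^ CARD('d) * card C" by (simp add: mult.commute)
qed

lemma star_rel_finite_card:
  fixes X :: "(int ^ 'd::finite) set"
  assumes "finite X"
  shows "finite (star_rel X)" "card (star_rel X) \<le> 3 ^ CARD('d) * card X"
proof -
  have sub: "star_rel X \<subseteq> Sigma X (\<lambda>v. cube v 1)" by (auto simp: star_rel_def star_cube)
  have fin: "finite (Sigma X (\<lambda>v. cube v 1))" using assms cube_finite_card(1) by blast
  show "finite (star_rel X)" using finite_subset[OF sub fin] .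
  have "card (star_rel X) \<le> card (Sigma X (\<lambda>v. cube v 1))" using card_mono[OF fin sub] .
  also have "\<dots> = (\<Sum>v\<in>X. card (cube v 1))" using assms cube_finite_card(1) by (subst card_SigmaI)
      auto
  also have "\<dots> \<le> (\<Sum>v\<in>X. 3 ^ CARD('d))" by (rule sum_mono) (use cube_finite_card(2)[of _ 1] in simp)
  finally show "card (star_rel X) \<le> 3 ^ CARD('d) * card X" by (simp add: mult.commute)
qed

lemma star_rel_reach:
  fixes X :: "(int ^ 'd::finite) set" and M :: real
  assumes "finite X" "X \<inter> bad t M = {}" "0 \<le> M" "(a, b) \<in> (star_rel X)\<^sup>*"
  shows "reach t a b (3 ^ CARD('d) * card X * (CARD('d) * M))"
proof -
  have n: "reach t a b (real n * (CARD('d) * M))" if "(a, b) \<in> star_rel X ^^ n" for n b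
    using that
  proof (induction n arbitrary: b)
    case (Suc n)
    then obtain c where c: "(a, c) \<in> star_rel X ^^ n" "(c, b) \<in> star_rel X" by auto
    then have "reach t c b (CARD('d) * M)" using assms star_step[of c b t M] by (auto simp:
        star_rel_def)
    from reach_trans[OF Suc.IH[OF c(1)] this] show ?case by (simp add: algebra_simps)
  qed (auto intro: reach_refl)
  \<comment> \<open>A shortest chain is no longer than the number of related pairs, and this crude
    count is linear in \<open>card X\<close>.\<close>
  obtain n where n': "n \<le> card (star_rel X)" "(a, b) \<in> star_rel X ^^ n"
    using assms(4) rtrancl_finite_eq_relpow[OF star_rel_finite_card(1)[OF assms(1)]] by auto
  then have "real n \<le> real (3 ^ CARD('d) * card X)"
    using star_rel_finite_card(2)[OF assms(1)] of_nat_mono order_trans by blast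
  then have "real n * (CARD('d) * M) \<le> real (3 ^ CARD('d) * card X) * (CARD('d) * M)"
    using assms(3) by (intro mult_right_mono) auto
  then show ?thesis using n[OF n'(2)] by (elim reach_mono) simp
qed

text \<open>One factor \<open>3 ^ CARD('d)\<close> bounds the boundary vertices per vertex of
  \<open>C\<close>, the other the *-neighbours of each; together they give
  \<open>9 ^ CARD('d)\<close>, and each *-step costs at most \<open>CARD('d) * M\<close>.\<close>

lemma detour_reach:
  fixes C :: "(int ^ 'd::finite) set" and M :: real
  assumes "finite C" "\<And>u v. u \<in> C \<Longrightarrow> v \<in> C \<Longrightarrow> conn C u v" "outer_bd C \<inter> bad t M = {}" "0 \<le> M"
    "a \<in> outer_bd C" "b \<in> outer_bd C" "conn (- C) a b"
  shows "reach t a b (9 ^ CARD('d) * CARD('d) * M * card C)"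
proof -
  have "reach t a b (3 ^ CARD('d) * card (outer_bd C) * (CARD('d) * M))"
    using star_rel_reach[OF _ assms(3,4) outer_bd_star_connected[OF assms(2,5-7)]]
        outer_bd_finite_card assms(1) by blast
  moreover have "real (3 ^ CARD('d) * card (outer_bd C)) \<le> real (3 ^ CARD('d) * (3 ^ CARD('d) *
      card C))"
    using outer_bd_finite_card(2)[OF assms(1)] by (intro of_nat_mono mult_left_mono) auto
  then have "3 ^ CARD('d) * card (outer_bd C) * (CARD('d) * M) \<le> 3 ^ CARD('d) * (3 ^ CARD('d) *
      real (card C)) * (CARD('d) * M)"
    using assms(4) by (intro mult_right_mono) auto
  moreover have "3 ^ CARD('d) * (3 ^ CARD('d) * real (card C)) * (CARD('d) * M)
      = 9 ^ CARD('d) * CARD('d) * M * card C"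
  proof -
    have "real (9 ^ CARD('d)) = 3 ^ CARD('d) * 3 ^ CARD('d)" by (simp flip: power_mult_distrib)
    then show ?thesis by simp
  qed
  ultimately show ?thesis by (elim reach_mono) (simp only:)
qed

text \<open>The walk is cut at its last visit to the first cluster it meets, so that every cluster is
  charged only once.\<close>

lemma detour_walk:
  fixes \<C> :: "(int ^ 'd::finite) set set" and M :: real
  assumes fin: "finite \<C>" "\<And>C. C \<in> \<C> \<Longrightarrow> finite C"
    and con: "\<And>C u v. C \<in> \<C> \<Longrightarrow> u \<in> C \<Longrightarrow> v \<in> C \<Longrightarrow> conn C u v"
    and sep: "\<And>C C' u v. C \<in> \<C> \<Longrightarrow> C' \<in> \<C> \<Longrightarrow> u \<in> C \<Longrightarrow> v \<in> C' \<Longrightarrow> u = v \<or> lattice_adj u v \<Longrightarrow> C = C'"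
    and bdry: "\<And>C. C \<in> \<C> \<Longrightarrow> outer_bd C \<inter> bad t M = {}" and M: "0 \<le> M"
    and cl: "\<And>e. e \<in> lattice_edges \<Longrightarrow> 0 \<le> cl e"
    and y: "\<And>C. C \<in> \<C> \<Longrightarrow> conn (- C) y w"
    and vs: "lpath vs a y" "\<And>C. C \<in> \<C> \<Longrightarrow> conn (- C) a w"
      "successively (\<lambda>u v. u \<notin> \<Union>\<C> \<longrightarrow> v \<notin> \<Union>\<C> \<longrightarrow> t {u, v} \<le> M * cl {u, v}) vs"
  shows "reach t a y (M * wt cl vs + 9 ^ CARD('d) * CARD('d) * M * (\<Sum>C | C \<in> \<C> \<and> C \<inter> set vs \<noteq> {}.
      real (card C)))"
  using vs
proof (induction vs arbitrary: a rule: length_induct)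
  case (1 vs)
  define K :: real where "K = 9 ^ CARD('d) * CARD('d) * M"
  have K: "K \<ge> 0" using M by (simp add: K_def)
  have sum_nn: "0 \<le> (\<Sum>C | C \<in> \<C> \<and> C \<inter> X \<noteq> {}. real (card C))" for X by (simp add: sum_nonneg)
  have IH: "reach t b y (M * wt cl ws + K * (\<Sum>C | C \<in> \<C> \<and> C \<inter> set ws \<noteq> {}. real (card C)))"
    if "length ws < length vs" "lpath ws b y" "\<And>C. C \<in> \<C> \<Longrightarrow> conn (- C) b w"
      "successively (\<lambda>u v. u \<notin> \<Union>\<C> \<longrightarrow> v \<notin> \<Union>\<C> \<longrightarrow> t {u, v} \<le> M * cl {u, v}) ws" for ws b
    using "1.IH" that unfolding K_def by blast
  have aU: "a \<notin> \<Union>\<C>" using 1(3) conn_in by fastforce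
  obtain vs' where vs': "vs = a # vs'" using 1(2) by (cases vs) (auto simp: lpath_def)
  show ?case unfolding K_def[symmetric]
  proof (cases vs')
    case Nil
    then have "a = y" using 1(2) vs' by simp
    then show "reach t a y (M * wt cl vs + K * (\<Sum>C | C \<in> \<C> \<and> C \<inter> set vs \<noteq> {}. real (card C)))"
      using Nil vs' K sum_nn[of "set vs"] by (auto intro!: reach_refl)
  next
    case (Cons b rest)
    have h: "lattice_adj a b" "lpath vs' b y" using 1(2) vs' Cons by (auto simp: lpath_Cons_iff)
    show "reach t a y (M * wt cl vs + K * (\<Sum>C | C \<in> \<C> \<and> C \<inter> set vs \<noteq> {}. real (card C)))"
    proof (cases "b \<in> \<Union>\<C>")
      case False
      have "conn (- C) b w" if "C \<in> \<C>" for C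
        using 1(3)[OF that] conn_trans[of "- C" b a w] conn_adj[of b a "- C"] h(1) False that aU
        by (auto simp: lattice_adj_sym)
      moreover have t: "t {a, b} \<le> M * cl {a, b}" using 1(4) aU False vs' Cons by auto
      ultimately have r: "reach t b y (M * wt cl vs' + K * (\<Sum>C | C \<in> \<C> \<and> C \<inter> set vs' \<noteq> {}. real
          (card C)))"
        using 1(4) vs' h(2) Cons by (intro IH) auto
      have "(\<Sum>C | C \<in> \<C> \<and> C \<inter> set vs' \<noteq> {}. real (card C)) \<le> (\<Sum>C | C \<in> \<C> \<and> C \<inter> set vs \<noteq> {}. real
          (card C))"
        using fin vs' by (intro sum_mono2) auto
      then have "K * (\<Sum>C | C \<in> \<C> \<and> C \<inter> set vs' \<noteq> {}. real (card C)) \<le> K * (\<Sum>C | C \<in> \<C> \<and> C \<inter> set vs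
          \<noteq> {}. real (card C))"
        using K by (rule mult_left_mono)
      then show ?thesis using reach_trans[OF reach_adj[of a b t, OF h(1) t] r]
        by (elim reach_mono) (simp add: vs' Cons algebra_simps)
    next
      case True
      then obtain C where C: "b \<in> C" "C \<in> \<C>" by blast
      then have "\<exists>x\<in>set vs. x \<in> C" using vs' Cons by auto
      then obtain ps c qs where split: "vs = ps @ c # qs" "c \<in> C" "\<forall>z\<in>set qs. z \<notin> C"
        using split_list_last_prop[of vs "\<lambda>x. x \<in> C"] by blast
      have yC: "y \<notin> C" using y[OF C(2)] conn_in by fastforce
      have "qs \<noteq> []" using 1(2) split yC by (auto simp: lpath_def)
      then obtain b' qs' where qs: "qs = b' # qs'" by (cases qs) auto
      have adj: "lattice_adj c b'" and lq: "lpath qs b' y"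
        using 1(2) lpath_split(2)[of ps c qs a y] unfolding split qs by (auto simp: lpath_Cons_iff)
      have b'C: "b' \<notin> C" using split qs by auto
      have b'U: "b' \<notin> C'" if "C' \<in> \<C>" for C'
        using sep[OF C(2) that split(2), of b'] adj b'C by blast
      have aC: "a \<notin> C" using aU C(2) by blast
      have ob: "a \<in> outer_bd C" "b' \<in> outer_bd C"
        using h(1) C(1) aC adj split(2) b'C by (auto simp: outer_bd_def lattice_adj_sym)
      \<comment> \<open>The induction needs that \<open>b'\<close> is enclosed by no member. For
        \<open>C\<close> itself the rest of the walk leads out; for another \<open>C'\<close> the
        set \<open>C\<close> is disjoint from it and joins \<open>a\<close> to
        \<open>b'\<close>.\<close>
      have b'w: "conn (- C') b' w" if "C' \<in> \<C>" for C'
      proof (cases "C' = C")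
        case True
        have "conn (- C) b' y" using conn_lpath[OF lq] split(3) by blast
        then show ?thesis using y[OF C(2)] conn_trans True by blast
      next
        case False
        then have "C \<subseteq> - C'" using sep[OF C(2) that] by blast
        then have "conn (- C') b c" using conn_mono[OF con[OF C(2,1) split(2)]] by blast
        moreover have "conn (- C') a b" "conn (- C') c b'"
          using h(1) adj \<open>C \<subseteq> - C'\<close> C(1) split(2) aU b'U[OF that] that by (auto intro!: conn_adj)
        ultimately have "conn (- C') a b'" using conn_trans by blast
        then show ?thesis using 1(3)[OF that] conn_trans conn_sym by blast
      qed
      \<comment> \<open>Both vertices see \<open>C\<close> from the side of \<open>w\<close>, so
        they lie on the same *-connected piece of its outer boundary.\<close>
      have "conn (- C) a b'" using conn_trans[OF 1(3)[OF C(2)] conn_sym[OF b'w[OF C(2)]]] .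
      then have r1: "reach t a b' (K * card C)"
        using detour_reach[OF fin(2)[OF C(2)] con[OF C(2)] bdry[OF C(2)] M ob] unfolding K_def by
            simp
      have "successively (\<lambda>u v. u \<notin> \<Union>\<C> \<longrightarrow> v \<notin> \<Union>\<C> \<longrightarrow> t {u, v} \<le> M * cl {u, v}) qs"
        using 1(4) unfolding split by (auto simp: successively_append_iff successively_Cons)
      then have r2: "reach t b' y (M * wt cl qs + K * (\<Sum>C | C \<in> \<C> \<and> C \<inter> set qs \<noteq> {}. real (card
          C)))"
        using b'w lq split by (intro IH) auto
      have "(\<Sum>C' | C' \<in> \<C> \<and> C' \<inter> set qs \<noteq> {}. real (card C')) + card C =
          (\<Sum>C' \<in> insert C {C'. C' \<in> \<C> \<and> C' \<inter> set qs \<noteq> {}}. real (card C'))"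
        using fin split(3) by (subst sum.insert) auto
      also have "\<dots> \<le> (\<Sum>C | C \<in> \<C> \<and> C \<inter> set vs \<noteq> {}. real (card C))"
        using fin split C by (intro sum_mono2) auto
      finally have "K * ((\<Sum>C' | C' \<in> \<C> \<and> C' \<inter> set qs \<noteq> {}. real (card C')) + card C)
          \<le> K * (\<Sum>C | C \<in> \<C> \<and> C \<inter> set vs \<noteq> {}. real (card C))"
        using K by (rule mult_left_mono)
      moreover have "M * wt cl qs \<le> M * wt cl vs"
      proof -
        have sc: "successively lattice_adj (ps @ [c])"
          using 1(2) unfolding split lpath_def by (auto simp: successively_append_iff)
        have "wt cl vs = wt cl (ps @ [c]) + (cl {c, b'} + wt cl qs)"
          unfolding split qs by (subst wt_append) simp
        then show ?thesis using wt_nonneg[OF sc cl] cl[OF lattice_edgesI[OF adj]] M by (intro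
            mult_left_mono) auto
      qed
      ultimately show ?thesis using reach_trans[OF r1 r2] by (elim reach_mono) (simp add:
          algebra_simps)
    qed
  qed
qed

text \<open>At its exit from the union of the hulls that contain its first vertex, the walk is safe: a
  further member of \<open>\<C>\<close> enclosing the exit vertex would enclose the member just left, and with it
  the first vertex.\<close>

lemma safe_vertex:
  fixes \<C> :: "(int ^ 'd::finite) set set"
  assumes con: "\<And>C u v. C \<in> \<C> \<Longrightarrow> u \<in> C \<Longrightarrow> v \<in> C \<Longrightarrow> conn C u v"
    and sep: "\<And>C C' u v. C \<in> \<C> \<Longrightarrow> C' \<in> \<C> \<Longrightarrow> u \<in> C \<Longrightarrow> v \<in> C' \<Longrightarrow> u = v \<or> lattice_adj u v \<Longrightarrow> C = C'"
    and small: "\<And>C. C \<in> \<C> \<Longrightarrow> \<exists>v. {x. \<not> conn (- C) x w} \<subseteq> cube v r"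
    and vs: "successively lattice_adj vs" "distinct vs" "length vs > (4 * r + 1) ^ CARD('d)"
  shows "\<exists>i<length vs. \<forall>C\<in>\<C>. conn (- C) (vs ! i) w"
proof -
  \<comment> \<open>The vertex \<open>w\<close> stands for infinity, and \<open>enc C\<close> is
    \<open>C\<close> with its holes filled.\<close>
  define enc where "enc C = {x. \<not> conn (- C) x w}" for C
  define K where "K = \<Union>{enc C | C. C \<in> \<C> \<and> vs ! 0 \<in> enc C}"
  \<comment> \<open>All hulls in question share the vertex \<open>vs ! 0\<close>, so their union has
    at most \<open>(4 * r + 1) ^ CARD('d)\<close> vertices and a longer self-avoiding walk must
    leave it.\<close>
  have "enc C \<subseteq> cube (vs ! 0) (2 * r)" if C: "C \<in> \<C>" "vs ! 0 \<in> enc C" for C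
  proof -
    obtain v where "enc C \<subseteq> cube v r" using small[OF C(1)] unfolding enc_def by blast
    then show ?thesis using cube_trans[of _ v r "vs ! 0" r] C(2) cube_sym[of "vs ! 0" v r] by
        (auto simp: mult_2)
  qed
  then have K: "K \<subseteq> cube (vs ! 0) (2 * r)" unfolding K_def by blast
  have "\<exists>i<length vs. vs ! i \<notin> K"
  proof (rule ccontr)
    assume "\<not> ?thesis"
    then have "set vs \<subseteq> K" by (auto simp: in_set_conv_nth)
    then have "set vs \<subseteq> cube (vs ! 0) (2 * r)" using K by blast
    then have "card (set vs) \<le> card (cube (vs ! 0) (2 * r))" using cube_finite_card(1) by
        (rule_tac card_mono)
    then show False using vs cube_finite_card(2)[of "vs ! 0" "2 * r"] by (simp add: distinct_card)
  qed
  then obtain i where i: "i < length vs" "vs ! i \<notin> K" "\<And>j. j < i \<Longrightarrow> vs ! j \<in> K"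
    using exists_least_iff[of "\<lambda>i. i < length vs \<and> vs ! i \<notin> K"] by (metis less_trans)
  have "conn (- C') (vs ! i) w" if C': "C' \<in> \<C>" for C'
  proof (cases i)
    case 0
    then show ?thesis using i(2) C' unfolding K_def enc_def by blast
  next
    case (Suc j)
    then have adj: "lattice_adj (vs ! j) (vs ! i)" using vs(1) i(1) by (auto simp:
        successively_conv_nth)
    obtain C where C: "C \<in> \<C>" "vs ! 0 \<in> enc C" "vs ! j \<in> enc C" using i(3)[of j] Suc unfolding
        K_def by blast
    then have iC: "conn (- C) (vs ! i) w" using i(2) unfolding K_def enc_def by blast
    have jC: "vs ! j \<in> C"
    proof (rule ccontr)
      assume "vs ! j \<notin> C"
      then have "conn (- C) (vs ! j) (vs ! i)" using adj conn_in[OF iC] by (intro conn_adj) auto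
      then show False using iC C(3) conn_trans unfolding enc_def by blast
    qed
    show ?thesis
    proof (rule ccontr)
      assume no: "\<not> conn (- C') (vs ! i) w"
      have ne: "C \<noteq> C'" using no iC by auto
      have iC': "vs ! i \<notin> C'" using sep[OF C(1) C' jC] adj ne by blast
      have sub: "C \<subseteq> - C'" using sep[OF C(1) C'] ne by blast
      have "vs ! 0 \<in> enc C'"
        unfolding enc_def
      proof (clarify)
        assume c0: "conn (- C') (vs ! 0) w"
        \<comment> \<open>Any walk from the first vertex to \<open>w\<close> must meet
          \<open>C\<close>, and \<open>C\<close> is joined to \<open>vs ! i\<close> outside
          \<open>C'\<close>; so freeing the first vertex from \<open>C'\<close> would free
          \<open>vs ! i\<close>.\<close>
        have "\<not> conn (- C' - C) (vs ! 0) w" using C(2) conn_mono[of "- C' - C" "vs ! 0" w "- C"]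
            unfolding enc_def by blast
        then obtain c where c: "c \<in> C" "conn (- C') c w" using conn_avoid[OF c0] by blast
        have "conn (- C') (vs ! j) c" using conn_mono[OF con[OF C(1) jC c(1)] sub] .
        moreover have "conn (- C') (vs ! i) (vs ! j)" using adj iC' sub jC by (intro conn_adj)
            (auto simp: lattice_adj_sym)
        ultimately show False using no c(2) conn_trans by blast
      qed
      then show False using i(2) no C' unfolding K_def enc_def by blast
    qed
  qed
  then show ?thesis using i(1) by blast
qed

text \<open>A connected set with at most \<open>r\<close> vertices lies in the cube of radius
  \<open>r\<close> about any of them, and the complement of that cube is connected and contains
  \<open>w\<close>.\<close>

lemma enclosed_in_cube:
  fixes C :: "(int ^ 'd::finite) set"
  assumes "CARD('d) \<ge> 2" "finite C" "\<And>u v. u \<in> C \<Longrightarrow> v \<in> C \<Longrightarrow> conn C u v" "card C \<le> r"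
    "v \<in> C" "w \<notin> cube v r"
  shows "{x. \<not> conn (- C) x w} \<subseteq> cube v r"
proof -
  have "u \<in> cube v r" if "u \<in> C" for u using conn_card_cube[OF assms(3)[OF assms(5) that]
      assms(2), of r] assms(4) by simp
  then have "conn (- C) x w" if "x \<notin> cube v r" for x
    using conn_mono[OF cube_complement_connected[OF assms(1) that assms(6)]] by blast
  then show ?thesis by blast
qed

section \<open>Finite Bernoulli expectations\<close>

text \<open>Expectation over the random set \<open>A\<close> of open edges of \<open>E\<close>, each
  open with probability \<open>p\<close>. As a finite sum it is a polynomial in \<open>p\<close> and
  raises no measurability question.\<close>

definition bern :: "real \<Rightarrow> 'e set \<Rightarrow> ('e set \<Rightarrow> real) \<Rightarrow> real" where
  "bern p E f = (\<Sum>A\<in>Pow E. p ^ card A * (1 - p) ^ card (E - A) * f A)"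

lemma bern_empty [simp]: "bern p {} f = f {}"
  by (simp add: bern_def)

lemma bern_insert:
  assumes "finite E" "e \<notin> E"
  shows "bern p (insert e E) f = p * bern p E (\<lambda>A. f (insert e A)) + (1 - p) * bern p E f"
proof -
  have inj: "inj_on (insert e) (Pow E)" using assms(2) unfolding inj_on_def by (metis PowD
      insert_ident subset_iff)
  have "bern p (insert e E) f = (\<Sum>A\<in>Pow E. p ^ card A * (1 - p) ^ card (insert e E - A) * f A) +
      (\<Sum>A\<in>insert e ` Pow E. p ^ card A * (1 - p) ^ card (insert e E - A) * f A)"
    unfolding bern_def Pow_insert using assms by (intro sum.union_disjoint) auto
  also have "(\<Sum>A\<in>insert e ` Pow E. p ^ card A * (1 - p) ^ card (insert e E - A) * f A) =
      (\<Sum>A\<in>Pow E. p ^ card (insert e A) * (1 - p) ^ card (insert e E - insert e A) * f (insert e A))"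
    by (subst sum.reindex[OF inj]) simp
  also have "\<dots> = p * bern p E (\<lambda>A. f (insert e A))"
    unfolding bern_def sum_distrib_left
  proof (rule sum.cong)
    fix A assume "A \<in> Pow E"
    then have "e \<notin> A" "finite A" "insert e E - insert e A = E - A" using assms finite_subset by auto
    then show "p ^ card (insert e A) * (1 - p) ^ card (insert e E - insert e A) * f (insert e A) =
       p * (p ^ card A * (1 - p) ^ card (E - A) * f (insert e A))" by simp
  qed simp
  also have "(\<Sum>A\<in>Pow E. p ^ card A * (1 - p) ^ card (insert e E - A) * f A) = (1 - p) * bern p E f"
    unfolding bern_def sum_distrib_left
  proof (rule sum.cong)
    fix A assume "A \<in> Pow E"
    then have "insert e E - A = insert e (E - A)" "e \<notin> E - A" "finite (E - A)" using assms
        finite_subset by auto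
    then show "p ^ card A * (1 - p) ^ card (insert e E - A) * f A =
       (1 - p) * (p ^ card A * (1 - p) ^ card (E - A) * f A)" by simp
  qed simp
  finally show ?thesis by simp
qed

lemma bern_cong: "(\<And>A. A \<subseteq> E \<Longrightarrow> f A = g A) \<Longrightarrow> bern p E f = bern p E g"
  unfolding bern_def by (rule sum.cong) auto

lemma bern_add: "bern p E (\<lambda>A. f A + g A) = bern p E f + bern p E g"
  by (simp add: bern_def algebra_simps sum.distrib)

lemma bern_diff: "bern p E (\<lambda>A. f A - g A) = bern p E f - bern p E g"
  by (simp add: bern_def algebra_simps sum_subtractf)

lemma bern_cmult: "bern p E (\<lambda>A. c * f A) = c * bern p E f"
  by (simp add: bern_def sum_distrib_left mult_ac)

lemma bern_sum: "bern p E (\<lambda>A. \<Sum>i\<in>I. f i A) = (\<Sum>i\<in>I. bern p E (f i))"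
  unfolding bern_def sum_distrib_left by (rule sum.swap)

lemma bern_const: "finite E \<Longrightarrow> bern p E (\<lambda>_. c) = c"
  by (induction E rule: finite_induct) (auto simp: bern_insert algebra_simps)

lemma bern_mono:
  "0 \<le> p \<Longrightarrow> p \<le> 1 \<Longrightarrow> (\<And>A. A \<subseteq> E \<Longrightarrow> f A \<le> g A) \<Longrightarrow> bern p E f \<le> bern p E g"
  unfolding bern_def by (intro sum_mono mult_left_mono) auto

text \<open>Independence of disjoint edge sets, obtained by revealing the edges of \<open>E1\<close>
  one at a time.\<close>

lemma bern_indep:
  assumes "finite E1" "finite E2" "E1 \<inter> E2 = {}"
  shows "bern p (E1 \<union> E2) (\<lambda>A. f (A \<inter> E1) * g (A \<inter> E2)) = bern p E1 f * bern p E2 g"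
  using assms(1,3)
proof (induction E1 arbitrary: f rule: finite_induct)
  case empty
  have "bern p E2 (\<lambda>A. f {} * g (A \<inter> E2)) = bern p E2 (\<lambda>A. f {} * g A)"
    by (rule bern_cong) (simp add: Int_absorb2)
  then show ?case by (simp add: bern_cmult)
next
  case (insert e E)
  have e: "e \<notin> E2" "E \<inter> E2 = {}" using insert by auto
  have "bern p (insert e E \<union> E2) (\<lambda>A. f (A \<inter> insert e E) * g (A \<inter> E2)) =
     p * bern p (E \<union> E2) (\<lambda>A. f (insert e A \<inter> insert e E) * g (insert e A \<inter> E2)) +
     (1 - p) * bern p (E \<union> E2) (\<lambda>A. f (A \<inter> insert e E) * g (A \<inter> E2))"
    using insert e assms(2) by (simp add: bern_insert)
  also have "bern p (E \<union> E2) (\<lambda>A. f (insert e A \<inter> insert e E) * g (insert e A \<inter> E2)) =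
     bern p (E \<union> E2) (\<lambda>A. (\<lambda>B. f (insert e B)) (A \<inter> E) * g (A \<inter> E2))"
    by (rule bern_cong) (use e in \<open>simp add: Int_insert_left Int_insert_right\<close>, (simp add:
        insert_commute)?)
  also have "\<dots> = bern p E (\<lambda>B. f (insert e B)) * bern p E2 g" by (rule insert.IH[OF e(2)])
  also have "bern p (E \<union> E2) (\<lambda>A. f (A \<inter> insert e E) * g (A \<inter> E2)) = bern p (E \<union> E2) (\<lambda>A. f (A \<inter>
      E) * g (A \<inter> E2))"
  proof (rule bern_cong)
    fix A assume "A \<subseteq> E \<union> E2"
    then have "A \<inter> insert e E = A \<inter> E" using e insert by auto
    then show "f (A \<inter> insert e E) * g (A \<inter> E2) = f (A \<inter> E) * g (A \<inter> E2)" by simp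
  qed
  also have "\<dots> = bern p E f * bern p E2 g" by (rule insert.IH[OF e(2)])
  finally show ?case using insert by (simp add: bern_insert algebra_simps)
qed

lemma bern_restrict:
  assumes "finite E" "E1 \<subseteq> E"
  shows "bern p E (\<lambda>A. f (A \<inter> E1)) = bern p E1 f"
proof -
  have "bern p (E1 \<union> (E - E1)) (\<lambda>A. f (A \<inter> E1) * 1) = bern p E1 f * bern p (E - E1) (\<lambda>_. 1)"
    using assms finite_subset by (intro bern_indep) auto
  moreover have "E1 \<union> (E - E1) = E" using assms by auto
  ultimately show ?thesis using assms(1) by (simp add: bern_const)
qed

lemma bern_indep_sub:
  assumes "finite E" "E1 \<subseteq> E" "E2 \<subseteq> E" "E1 \<inter> E2 = {}"
  shows "bern p E (\<lambda>A. f (A \<inter> E1) * g (A \<inter> E2)) = bern p E1 f * bern p E2 g"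
proof -
  have fin: "finite E1" "finite E2" using finite_subset[OF assms(2,1)] finite_subset[OF
      assms(3,1)] by auto
  have "bern p E (\<lambda>A. f (A \<inter> E1) * g (A \<inter> E2)) =
      bern p E (\<lambda>A. f ((A \<inter> (E1 \<union> E2)) \<inter> E1) * g ((A \<inter> (E1 \<union> E2)) \<inter> E2))"
    by (rule bern_cong) (simp add: Int_assoc Int_absorb1 Int_absorb2)
  also have "\<dots> = bern p (E1 \<union> E2) (\<lambda>A. f (A \<inter> E1) * g (A \<inter> E2))"
    by (rule bern_restrict[of E "E1 \<union> E2" p "\<lambda>A. f (A \<inter> E1) * g (A \<inter> E2)"]) (use assms in auto)
  finally show ?thesis using bern_indep[OF fin assms(4)] by simp
qed

lemma bern_image:
  assumes "inj_on h E"
  shows "bern p (h ` E) f = bern p E (\<lambda>A. f (h ` A))"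
proof -
  have P: "Pow (h ` E) = (`) h ` Pow E" by (simp add: image_Pow_surj)
  have inj: "inj_on ((`) h) (Pow E)" using assms by (simp add: inj_on_image_Pow)
  have "card (h ` A) = card A" "card (h ` E - h ` A) = card (E - A)" if "A \<subseteq> E" for A
  proof -
    show "card (h ` A) = card A" using card_image inj_on_subset[OF assms that] by blast
    have "h ` E - h ` A = h ` (E - A)" using inj_on_image_set_diff[OF assms, of E A] that by auto
    then show "card (h ` E - h ` A) = card (E - A)" using card_image inj_on_subset[OF assms] by
        (metis Diff_subset)
  qed
  then show ?thesis unfolding bern_def P by (subst sum.reindex[OF inj]) (auto intro!: sum.cong)
qed

lemma bern_isCont: "isCont (\<lambda>p. bern p E f) q"
  unfolding bern_def by (intro continuous_intros)

lemma bern_one: "finite E \<Longrightarrow> bern 1 E f = f E"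
  by (induction E arbitrary: f rule: finite_induct) (auto simp: bern_insert)

section \<open>From independent random variables to finite Bernoulli sums\<close>

lemma (in prob_space) indep_pattern:
  assumes "indep_vars (\<lambda>_. N) X I" "E \<subseteq> I" "finite E" "\<And>e. e \<in> E \<Longrightarrow> S e \<in> sets N"
  shows "prob {\<omega> \<in> space M. \<forall>e\<in>E. X e \<omega> \<in> S e} = (\<Prod>e\<in>E. prob {\<omega> \<in> space M. X e \<omega> \<in> S e})"
    and "{\<omega> \<in> space M. \<forall>e\<in>E. X e \<omega> \<in> S e} \<in> events"
proof -
  have m: "X e \<in> measurable M N" if "e \<in> E" for e
    using assms(1,2) that by (auto simp: indep_vars_def)
  have s: "X e -` S e \<inter> space M \<in> events" if "e \<in> E" for e
    using measurable_sets[OF m[OF that] assms(4)[OF that]] .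
  show "{\<omega> \<in> space M. \<forall>e\<in>E. X e \<omega> \<in> S e} \<in> events"
    using s by (intro sets.sets_Collect_finite_All assms(3)) (auto simp: vimage_def Int_def
        conj_commute)
  show "prob {\<omega> \<in> space M. \<forall>e\<in>E. X e \<omega> \<in> S e} = (\<Prod>e\<in>E. prob {\<omega> \<in> space M. X e \<omega> \<in> S e})"
  proof (cases "E = {}")
    case True
    then show ?thesis by (simp add: prob_space)
  next
    case False
    have "prob (\<Inter>e\<in>E. X e -` S e \<inter> space M) = (\<Prod>e\<in>E. prob (X e -` S e \<inter> space M))"
      by (rule indep_varsD[OF assms(1) False assms(3,2)]) (use assms(4) in auto)
    moreover have "(\<Inter>e\<in>E. X e -` S e \<inter> space M) = {\<omega> \<in> space M. \<forall>e\<in>E. X e \<omega> \<in> S e}" using False by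
        auto
    moreover have "X e -` S e \<inter> space M = {\<omega> \<in> space M. X e \<omega> \<in> S e}" for e by auto
    ultimately show ?thesis by simp
  qed
qed

text \<open>The bridge to the actual probability spaces, used with \<open>S = {True}\<close> for
  bond percolation and with \<open>S = {..0}\<close> for the weights.\<close>

lemma (in prob_space) prob_bern:
  assumes "indep_vars (\<lambda>_. N) X I" "E \<subseteq> I" "finite E" "S \<in> sets N"
    "\<And>e. e \<in> E \<Longrightarrow> prob {\<omega> \<in> space M. X e \<omega> \<in> S} = p"
  shows "prob {\<omega> \<in> space M. Q {e \<in> E. X e \<omega> \<in> S}} = bern p E (\<lambda>A. of_bool (Q A))"
    and "{\<omega> \<in> space M. Q {e \<in> E. X e \<omega> \<in> S}} \<in> events"
proof -
  define R where "R A = {\<omega> \<in> space M. \<forall>e\<in>E. X e \<omega> \<in> (if e \<in> A then S else space N - S)}" for A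
  have m: "X e \<in> measurable M N" if "e \<in> E" for e
    using assms(1,2) that by (auto simp: indep_vars_def)
  have R: "R A = {\<omega> \<in> space M. {e \<in> E. X e \<omega> \<in> S} = A}" if "A \<subseteq> E" for A
    using that measurable_space[OF m] by (auto simp: R_def split: if_splits)
  have U: "{\<omega> \<in> space M. Q {e \<in> E. X e \<omega> \<in> S}} = (\<Union>A\<in>{A. A \<subseteq> E \<and> Q A}. R A)"
    using R by auto
  have ev: "R A \<in> events" for A unfolding R_def using assms(4) by (intro indep_pattern(2)[OF
      assms(1-3)]) auto
  have fin: "finite {A. A \<subseteq> E \<and> Q A}" using assms(3) by (rule_tac finite_subset[of _ "Pow E"]) auto
  show "{\<omega> \<in> space M. Q {e \<in> E. X e \<omega> \<in> S}} \<in> events" unfolding U using fin ev by blast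
  have pR: "prob (R A) = p ^ card A * (1 - p) ^ card (E - A)" if "A \<subseteq> E" for A
  proof -
    have "prob (R A) = (\<Prod>e\<in>E. prob {\<omega> \<in> space M. X e \<omega> \<in> (if e \<in> A then S else space N - S)})"
      unfolding R_def using assms(4) by (intro indep_pattern(1)[OF assms(1-3)]) auto
    also have "\<dots> = (\<Prod>e\<in>E. if e \<in> A then p else 1 - p)"
    proof (rule prod.cong)
      fix e assume e: "e \<in> E"
      have sE: "{\<omega> \<in> space M. X e \<omega> \<in> S} \<in> events"
        using measurable_sets[OF m[OF e] assms(4)] by (simp add: vimage_def Int_def conj_commute)
      have "{\<omega> \<in> space M. X e \<omega> \<in> space N - S} = space M - {\<omega> \<in> space M. X e \<omega> \<in> S}"
        using measurable_space[OF m[OF e]] by auto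
      then have "prob {\<omega> \<in> space M. X e \<omega> \<in> space N - S} = 1 - p" using prob_compl[OF sE]
          assms(5)[OF e] by simp
      then show "prob {\<omega> \<in> space M. X e \<omega> \<in> (if e \<in> A then S else space N - S)} = (if e \<in> A then p
          else 1 - p)"
        using assms(5)[OF e] by simp
    qed simp
    also have "\<dots> = p ^ card A * (1 - p) ^ card (E - A)"
    proof -
      have "{x \<in> E. x \<in> A} = A" "{x \<in> E. x \<notin> A} = E - A" using that by auto
      then show ?thesis using assms(3) by (subst prod.If_cases) (auto simp: Int_def Diff_eq
          conj_commute)
    qed
    finally show ?thesis .
  qed
  have "disjoint_family_on R {A. A \<subseteq> E \<and> Q A}" using R by (auto simp: disjoint_family_on_def)
  then have "prob {\<omega> \<in> space M. Q {e \<in> E. X e \<omega> \<in> S}} = (\<Sum>A | A \<subseteq> E \<and> Q A. prob (R A))"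
    unfolding U using fin ev by (intro finite_measure_finite_Union) auto
  also have "\<dots> = (\<Sum>A | A \<subseteq> E \<and> Q A. p ^ card A * (1 - p) ^ card (E - A))" using pR by (intro
      sum.cong) auto
  also have "\<dots> = bern p E (\<lambda>A. of_bool (Q A))" unfolding bern_def
    by (rule sum.mono_neutral_cong_left) (use assms(3) in auto)
  finally show "prob {\<omega> \<in> space M. Q {e \<in> E. X e \<omega> \<in> S}} = bern p E (\<lambda>A. of_bool (Q A))" .
qed

section \<open>The distance counting closed edges\<close>

definition closed_ind :: "'e set \<Rightarrow> 'e \<Rightarrow> real" where
  "closed_ind A e = of_bool (e \<notin> A)"

text \<open>Walks are not confined to a box: for finite \<open>A\<close> almost all edges count as closed.\<close>

definition cdist :: "(int ^ 'd) set set \<Rightarrow> int ^ 'd \<Rightarrow> int ^ 'd \<Rightarrow> nat" where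
  "cdist A x y = (LEAST n. \<exists>vs. lpath vs x y \<and> wt (closed_ind A) vs = real n)"

lemma wt_closed_ind_nat: "\<exists>n. wt (closed_ind A) vs = real n"
proof (induction vs rule: induct_list012)
  case (3 x y vs)
  then obtain n where "wt (closed_ind A) (y # vs) = real n" by blast
  then have "wt (closed_ind A) (x # y # vs) = real (of_bool ({x, y} \<notin> A) + n)" by (simp add:
      closed_ind_def)
  then show ?case by blast
qed (auto intro: exI[of _ 0])

lemma cdist_path: "\<exists>vs. lpath vs x y \<and> wt (closed_ind A) vs = real (cdist A x y)" for x y :: "int
    ^ 'd::finite"
proof -
  obtain vs where "lpath vs x y" using mono_path by blast
  then have "\<exists>n vs. lpath vs x y \<and> wt (closed_ind A) vs = real n" using wt_closed_ind_nat by blast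
  from LeastI_ex[OF this] show ?thesis by (simp add: cdist_def)
qed

lemma cdist_le: "lpath vs x y \<Longrightarrow> real (cdist A x y) \<le> wt (closed_ind A) vs"
  using wt_closed_ind_nat[of A vs] unfolding cdist_def by (metis (mono_tags, lifting) Least_le
      of_nat_le_iff)

lemma closed_ind_le_1: "closed_ind A e \<le> 1" and closed_ind_nonneg: "0 \<le> closed_ind A e"
  by (simp_all add: closed_ind_def)

lemma cdist_le_l1: "cdist A x y \<le> l1 x y" for x y :: "int ^ 'd::finite"
proof -
  obtain vs where vs: "lpath vs x y" "length vs = l1 x y + 1" using mono_path by blast
  have "real (cdist A x y) \<le> wt (closed_ind A) vs" by (rule cdist_le[OF vs(1)])
  also have "\<dots> \<le> wt (\<lambda>_. 1) vs" using vs(1) by (intro wt_mono) (auto simp: lpath_def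
      closed_ind_le_1)
  also have "\<dots> = real (l1 x y)" using vs by (subst wt_const) (auto simp: lpath_def)
  finally show ?thesis by simp
qed

lemma cdist_shiftiangle: "cdist A x z \<le> cdist A x y + cdist A y z" for x y z :: "int ^ 'd::finite"
proof -
  obtain xs ys where "lpath xs x y" "wt (closed_ind A) xs = cdist A x y" "lpath ys y z" "wt
      (closed_ind A) ys = cdist A y z"
    using cdist_path by metis
  then have "real (cdist A x z) \<le> real (cdist A x y) + real (cdist A y z)"
    using lpath_trans[of xs x y ys z] cdist_le by metis
  then show ?thesis by linarith
qed

lemma cdist_sym_le: "cdist A x y \<le> cdist A y x" for x y :: "int ^ 'd::finite"
  using cdist_path[of y x A] cdist_le lpath_rev wt_rev by (metis of_nat_le_iff)

lemma cdist_sym: "cdist A x y = cdist A y x" for x y :: "int ^ 'd::finite"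
  by (intro antisym cdist_sym_le)

lemma cdist_refl [simp]: "cdist A x x = 0" for x :: "int ^ 'd::finite"
  using cdist_le_l1[of A x x] by (simp add: l1_def)

lemma cdist_antimono: "A \<subseteq> A' \<Longrightarrow> cdist A' x y \<le> cdist A x y" for x y :: "int ^ 'd::finite"
proof -
  assume "A \<subseteq> A'"
  obtain vs where vs: "lpath vs x y" "wt (closed_ind A) vs = cdist A x y" using cdist_path by metis
  have "real (cdist A' x y) \<le> wt (closed_ind A') vs" by (rule cdist_le[OF vs(1)])
  also have "\<dots> \<le> wt (closed_ind A) vs" using vs(1) \<open>A \<subseteq> A'\<close> by (intro wt_mono) (auto simp:
      lpath_def closed_ind_def)
  finally show ?thesis using vs by simp
qed

section \<open>Symmetries of the lattice: translations, permutations and reflections of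
  coordinates\<close>

definition lattice_aut :: "(int ^ 'd \<Rightarrow> int ^ 'd) \<Rightarrow> bool" where
  "lattice_aut \<phi> \<longleftrightarrow> bij \<phi> \<and> (\<forall>x y. lattice_adj (\<phi> x) (\<phi> y) \<longleftrightarrow> lattice_adj x y)"

lemma lattice_aut_inv: "lattice_aut \<phi> \<Longrightarrow> lattice_aut (inv \<phi>)"
  unfolding lattice_aut_def by (metis bij_imp_bij_inv bij_inv_eq_iff)

lemma lattice_aut_edges: "lattice_aut \<phi> \<Longrightarrow> E \<subseteq> lattice_edges \<Longrightarrow> (`) \<phi> ` E \<subseteq> lattice_edges"
proof
  fix e assume \<phi>: "lattice_aut \<phi>" "E \<subseteq> lattice_edges" and "e \<in> (`) \<phi> ` E"
  then obtain e' where e': "e = \<phi> ` e'" "e' \<in> lattice_edges" by blast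
  then obtain x y where "e' = {x, y}" "lattice_adj x y" unfolding lattice_edges_def by blast
  then show "e \<in> lattice_edges" using \<phi>(1) e'(1) lattice_edgesI[of "\<phi> x" "\<phi> y"] by (simp add:
      lattice_aut_def)
qed

lemma inj_image_edges: "lattice_aut \<phi> \<Longrightarrow> inj_on ((`) \<phi>) E"
  by (auto simp: lattice_aut_def bij_is_inj inj_image_eq_iff intro!: inj_onI)

lemma cdist_aut_le:
  fixes x y :: "int ^ 'd::finite"
  assumes "lattice_aut \<phi>"
  shows "cdist ((`) \<phi> ` A) (\<phi> x) (\<phi> y) \<le> cdist A x y"
proof -
  obtain vs where vs: "lpath vs x y" "wt (closed_ind A) vs = cdist A x y" using cdist_path by metis
  have "lpath (map \<phi> vs) (\<phi> x) (\<phi> y)" using vs(1) assms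
    by (auto simp: lpath_def hd_map last_map successively_map lattice_aut_def)
  moreover have "wt (closed_ind ((`) \<phi> ` A)) (map \<phi> vs) = wt (closed_ind A) vs"
  proof -
    have mem: "{\<phi> u, \<phi> v} \<in> (`) \<phi> ` A \<longleftrightarrow> {u, v} \<in> A" for u v
      using inj_image_mem_iff[OF inj_image_edges[OF assms, of UNIV], of "{u, v}" A] by simp
    show ?thesis by (induction vs rule: induct_list012) (auto simp: closed_ind_def mem)
  qed
  ultimately show ?thesis using cdist_le vs(2) by (metis of_nat_le_iff)
qed

lemma cdist_aut:
  fixes x y :: "int ^ 'd::finite"
  assumes "lattice_aut \<phi>"
  shows "cdist ((`) \<phi> ` A) (\<phi> x) (\<phi> y) = cdist A x y"
proof (rule antisym[OF cdist_aut_le[OF assms]])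
  have "bij \<phi>" using assms by (simp add: lattice_aut_def)
  then have i: "inv \<phi> (\<phi> z) = z" for z by (simp add: bij_is_inj)
  then have "(`) (inv \<phi>) ` ((`) \<phi> ` A) = A" by (simp add: image_image)
  then show "cdist A x y \<le> cdist ((`) \<phi> ` A) (\<phi> x) (\<phi> y)"
    using cdist_aut_le[OF lattice_aut_inv[OF assms], of "(`) \<phi> ` A" "\<phi> x" "\<phi> y"] i by simp
qed

lemma lattice_aut_translate: "lattice_aut (\<lambda>x. x + c)"
  by (auto simp: lattice_aut_def lattice_adj_def intro!: bij_plus_right)

lemma lattice_aut_permute: "bij \<pi> \<Longrightarrow> lattice_aut (\<lambda>x. \<chi> i. x $ (\<pi> i))"
proof -
  assume \<pi>: "bij \<pi>"
  have "bij (\<lambda>x :: int ^ 'a. \<chi> i. x $ (\<pi> i))"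
    by (rule o_bij[of "\<lambda>x. \<chi> i. x $ (inv \<pi> i)"]) (use \<pi> in \<open>auto simp: fun_eq_iff vec_eq_iff
        bij_is_inj bij_is_surj surj_f_inv_f\<close>)
  moreover have "(\<Sum>i\<in>UNIV. \<bar>x $ \<pi> i - y $ \<pi> i\<bar>) = (\<Sum>i\<in>UNIV. \<bar>x $ i - y $ i\<bar>)" for x y :: "int ^ 'a"
    using sum.reindex_bij_betw[of \<pi> UNIV UNIV "\<lambda>i. \<bar>x $ i - y $ i\<bar>"] \<pi> by simp
  ultimately show ?thesis by (simp add: lattice_aut_def lattice_adj_def)
qed

lemma lattice_aut_reflect: "lattice_aut (\<lambda>x. \<chi> j. if j = i then - x $ j else x $ j)"
proof -
  have "bij (\<lambda>x :: int ^ 'a. \<chi> j. if j = i then - x $ j else x $ j)"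
    by (rule o_bij[of "\<lambda>x. \<chi> j. if j = i then - x $ j else x $ j"]) (auto simp: fun_eq_iff
        vec_eq_iff)
  moreover have "\<bar>(if j = i then - x $ j else x $ j) - (if j = i then - y $ j else y $ j)\<bar> = \<bar>x $
      j - y $ j\<bar>"
    for j and x y :: "int ^ 'a" by auto
  ultimately show ?thesis by (simp add: lattice_aut_def lattice_adj_def)
qed

text \<open>The mean distance if all edges outside \<open>E\<close> are closed. It decreases as
  \<open>E\<close> grows, so infima over finite \<open>E\<close> replace the mean on the whole
  lattice.\<close>

definition mdist :: "real \<Rightarrow> (int ^ 'd) set set \<Rightarrow> int ^ 'd \<Rightarrow> int ^ 'd \<Rightarrow> real" where
  "mdist p E x y = bern p E (\<lambda>A. real (cdist A x y))"

lemma mdist_aut: "lattice_aut \<phi> \<Longrightarrow> mdist p ((`) \<phi> ` E) (\<phi> x) (\<phi> y) = mdist p E x y" for x y :: "int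
    ^ 'd::finite"
  unfolding mdist_def by (subst bern_image[OF inj_image_edges]) (simp_all add: cdist_aut)

lemma mdist_antimono:
  fixes x y :: "int ^ 'd::finite"
  assumes "0 \<le> p" "p \<le> 1" "finite E'" "E \<subseteq> E'"
  shows "mdist p E' x y \<le> mdist p E x y"
proof -
  have "mdist p E' x y \<le> bern p E' (\<lambda>A. real (cdist (A \<inter> E) x y))"
    unfolding mdist_def by (rule bern_mono[OF assms(1,2)]) (simp add: cdist_antimono)
  also have "\<dots> = mdist p E x y" unfolding mdist_def by (rule bern_restrict[OF assms(3,4)])
  finally show ?thesis .
qed

lemma mdist_triangle:
  fixes x y z :: "int ^ 'd::finite"
  assumes "0 \<le> p" "p \<le> 1"
  shows "mdist p E x z \<le> mdist p E x y + mdist p E y z"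
proof -
  have "real (cdist A x z) \<le> real (cdist A x y) + real (cdist A y z)" for A using
      cdist_shiftiangle[of A x z y] by linarith
  then show ?thesis unfolding mdist_def bern_add[symmetric] by (intro bern_mono[OF assms])
qed

lemma mdist_sym: "mdist p E x y = mdist p E y x" for x y :: "int ^ 'd::finite"
  unfolding mdist_def by (subst cdist_sym) simp

section \<open>Subadditivity\<close>

definition shift :: "int ^ 'd \<Rightarrow> (int ^ 'd) set set \<Rightarrow> (int ^ 'd) set set" where
  "shift c E = (`) (\<lambda>x. x + c) ` E"

lemma shift_edges: "E \<subseteq> lattice_edges \<Longrightarrow> shift c E \<subseteq> lattice_edges"
  unfolding shift_def by (rule lattice_aut_edges[OF lattice_aut_translate])

lemma shift_finite: "finite E \<Longrightarrow> finite (shift c E)"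
  by (simp add: shift_def)

lemma shift_mono: "E \<subseteq> E' \<Longrightarrow> shift c E \<subseteq> shift c E'"
  by (auto simp: shift_def)

lemma shift_tr: "shift c (shift b E) = shift (b + c) E"
  by (auto simp: shift_def image_image add.assoc)

lemma shift_0 [simp]: "shift 0 E = E"
  by (simp add: shift_def)

lemma cdist_shift: "cdist (shift c A) (x + c) (y + c) = cdist A x y" for x y :: "int ^ 'd::finite"
  unfolding shift_def by (rule cdist_aut[OF lattice_aut_translate])

lemma bern_shift: "bern p (shift c E) f = bern p E (\<lambda>A. f (shift c A))"
  unfolding shift_def by (rule bern_image[OF inj_image_edges[OF lattice_aut_translate]])

lemma mdist_tr: "mdist p (shift c E) (x + c) (y + c) = mdist p E x y" for x y :: "int ^ 'd::finite"
  unfolding shift_def by (rule mdist_aut[OF lattice_aut_translate])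

lemma bern_dist_translate:
  fixes y :: "int ^ 'd::finite"
  shows "bern p E (\<lambda>A. h (cdist A c (c + y))) = bern p (shift (- c) E) (\<lambda>A. h (cdist A 0 y))"
proof -
  have "cdist (shift (- c) A) 0 y = cdist A c (c + y)" for A
    using cdist_shift[of "- c" A c "c + y"] by simp
  then show ?thesis by (simp add: bern_shift)
qed

lemma lattice_edges_finite: "e \<in> lattice_edges \<Longrightarrow> finite e \<and> e \<noteq> {}"
  by (auto simp: lattice_edges_def)

text \<open>In a coordinate where \<open>z\<close> does not vanish, \<open>E\<close> has bounded
  extent, while the two translates are displaced by at least
  \<open>\<bar>i - j\<bar>\<close>.\<close>

lemma shift_disjoint:
  fixes z :: "int ^ 'd::finite"
  assumes "finite E" "E \<subseteq> lattice_edges" "z \<noteq> 0"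
  obtains s :: nat where "\<And>i j. s \<le> nat \<bar>int i - int j\<bar> \<Longrightarrow> shift (int i *s z) E \<inter> shift (int j *s
      z) E = {}"
proof -
  obtain m where m: "z $ m \<noteq> 0" using assms(3) by (auto simp: vec_eq_iff)
  have fin: "finite (\<Union>E)" using assms(1,2) lattice_edges_finite by blast
  define b where "b = (\<Sum>v\<in>\<Union>E. \<bar>v $ m\<bar>)"
  have b: "\<bar>v $ m\<bar> \<le> b" if "v \<in> \<Union>E" for v
    unfolding b_def by (rule member_le_sum[OF that]) (use fin in auto)
  have "shift (int i *s z) E \<inter> shift (int j *s z) E = {}" if h: "nat (2 * b + 1) \<le> nat \<bar>int i -
      int j\<bar>" for i j
  proof (rule ccontr)
    assume "\<not> ?thesis"
    then obtain e e' where e: "e \<in> E" "e' \<in> E" "(\<lambda>x. x + int i *s z) ` e = (\<lambda>x. x + int j *s z) `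
        e'"
      by (auto simp: shift_def)
    then obtain v where v: "v \<in> e" using assms(2) lattice_edges_finite by blast
    then obtain v' where v': "v' \<in> e'" "v + int i *s z = v' + int j *s z" using e(3) by blast
    then have "v $ m + int i * z $ m = v' $ m + int j * z $ m"
      by (metis vector_add_component vector_smult_component)
    then have eq: "(int i - int j) * z $ m = v' $ m - v $ m" by (simp add: algebra_simps)
    have "\<bar>int i - int j\<bar> * 1 \<le> \<bar>int i - int j\<bar> * \<bar>z $ m\<bar>" using m by (intro mult_left_mono) auto
    also have "\<dots> = \<bar>v' $ m - v $ m\<bar>" using eq by (simp flip: abs_mult)
    also have "\<dots> \<le> 2 * b" using b[of v] b[of v'] v v' e by force
    finally have "\<bar>int i - int j\<bar> < 2 * b + 1" by simp
    then show False using h nat_less_eq_zless[of "\<bar>int i - int j\<bar>" "2 * b + 1"] by simp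
  qed
  then show ?thesis using that by blast
qed

lemma mdist_bounds:
  fixes x y :: "int ^ 'd::finite"
  assumes "0 \<le> p" "p \<le> 1" "finite E"
  shows "0 \<le> mdist p E x y" "mdist p E x y \<le> l1 x y"
proof -
  have "bern p E (\<lambda>_. 0) \<le> mdist p E x y" unfolding mdist_def by (rule bern_mono[OF assms(1,2)])
      simp
  then show "0 \<le> mdist p E x y" using assms(3) by (simp add: bern_const)
  have "mdist p E x y \<le> bern p E (\<lambda>_. l1 x y)" unfolding mdist_def by (rule bern_mono[OF
      assms(1,2)]) (simp add: cdist_le_l1)
  then show "mdist p E x y \<le> l1 x y" using assms(3) by (simp add: bern_const)
qed

lemma card_near: "card {j. j < n \<and> nat \<bar>int i - int j\<bar> < s} \<le> 2 * s"
proof -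
  have "{j. j < n \<and> nat \<bar>int i - int j\<bar> < s} \<subseteq> {i + 1 - s..<i + s}" by auto
  then have "card {j. j < n \<and> nat \<bar>int i - int j\<bar> < s} \<le> card {i + 1 - s..<i + s}" by (intro
      card_mono) auto
  then show ?thesis by simp
qed

text \<open>The \<open>i\<close>-th block distance sees only the translate of \<open>E\<close> by
  \<open>int i *s z\<close>. The summands have equal means, are bounded by \<open>l1 0 z\<close> and
  have a finite range of dependence, so the variance grows linearly.\<close>

lemma block_variance:
  fixes z :: "int ^ 'd::finite"
  assumes p: "0 \<le> p" "p \<le> 1" and E: "finite E" "E \<subseteq> lattice_edges" and z: "z \<noteq> 0"
  defines "Y \<equiv> \<lambda>(i::nat) A. real (cdist (A \<inter> shift (int i *s z) E) (int i *s z) (int (Suc i) *s z))"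
  defines "F \<equiv> \<lambda>n::nat. \<Union>i<n. shift (int i *s z) E"
  shows "\<exists>C::real. C \<ge> 0 \<and> (\<forall>n::nat. bern p (F n) (\<lambda>A. ((\<Sum>i<n. Y i A) - n * mdist p E 0 z)\<^sup>2) \<le> C
      * n)"
proof -
  define m where "m = mdist p E 0 z"
  define b where "b = real (l1 0 z)"
  define W where "W i A = Y i A - m" for i A
  have Suc_z: "int (Suc i) *s z = z + int i *s z" for i by (simp add: vec_eq_iff algebra_simps)
  have m: "0 \<le> m" "m \<le> b" using mdist_bounds[OF p E(1)] by (auto simp: m_def b_def)
  have "0 \<le> Y i A \<and> Y i A \<le> b" for i A
  proof -
    have "l1 (int i *s z) (int (Suc i) *s z) = l1 0 z" unfolding Suc_z l1_def by simp
    then show ?thesis using cdist_le_l1[of "A \<inter> shift (int i *s z) E" "int i *s z" "int (Suc i) *s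
        z"]
      unfolding Y_def b_def by simp
  qed
  then have W: "\<bar>W i A\<bar> \<le> b" for i A using m by (auto simp: W_def abs_le_iff) (smt (verit))+
  have finF: "finite (F n)" for n using shift_finite[OF E(1)] by (auto simp: F_def)
  have sub: "shift (int i *s z) E \<subseteq> F n" if "i < n" for i n using that by (auto simp: F_def)
  have EW: "bern p (shift (int i *s z) E) (W i) = 0" for i
  proof -
    have "bern p (shift (int i *s z) E) (Y i) = mdist p (shift (int i *s z) E) (int i *s z) (int
        (Suc i) *s z)"
      unfolding mdist_def Y_def by (rule bern_cong) (simp add: Int_absorb2)
    also have "\<dots> = m" unfolding m_def Suc_z using mdist_tr[of p "int i *s z" E 0 z] by simp
    finally show ?thesis unfolding W_def using shift_finite[OF E(1)] by (simp add: bern_diff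
        bern_const)
  qed
  have Wloc: "W i (A \<inter> shift (int i *s z) E) = W i A" for i A by (simp add: W_def Y_def Int_assoc)
  obtain s where s: "\<And>i j. s \<le> nat \<bar>int i - int j\<bar> \<Longrightarrow> shift (int i *s z) E \<inter> shift (int j *s z) E =
      {}"
    using shift_disjoint[OF E z] by metis
  \<comment> \<open>Beyond range \<open>s\<close> the factors depend on disjoint edges and are
    centred; each \<open>i\<close> has at most \<open>2 * s\<close> partners within range,
    contributing at most \<open>b\<^sup>2\<close> each.\<close>
  have cov: "bern p (F n) (\<lambda>A. W i A * W j A) \<le> (if nat \<bar>int i - int j\<bar> < s then b\<^sup>2 else 0)"
    if "i < n" "j < n" for i j n
  proof (cases "nat \<bar>int i - int j\<bar> < s")
    case True
    have "W i A * W j A \<le> b\<^sup>2" for A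
    proof -
      have "\<bar>W i A\<bar> * \<bar>W j A\<bar> \<le> b * b" using W m by (intro mult_mono) auto
      moreover have "W i A * W j A \<le> \<bar>W i A\<bar> * \<bar>W j A\<bar>" by (simp flip: abs_mult)
      ultimately show ?thesis by (simp add: power2_eq_square)
    qed
    then have "bern p (F n) (\<lambda>A. W i A * W j A) \<le> bern p (F n) (\<lambda>_. b\<^sup>2)" by (intro bern_mono[OF p])
    then show ?thesis using True finF by (simp add: bern_const)
  next
    case False
    have "bern p (F n) (\<lambda>A. W i (A \<inter> shift (int i *s z) E) * W j (A \<inter> shift (int j *s z) E)) = 0"
      using False s[of i j] sub[OF that(1)] sub[OF that(2)] by (subst bern_indep_sub[OF finF])
          (auto simp: EW)
    then show ?thesis using False by (simp add: Wloc)
  qed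
  have "bern p (F n) (\<lambda>A. ((\<Sum>i<n. Y i A) - n * m)\<^sup>2) \<le> (2 * s * b\<^sup>2) * n" for n
  proof -
    have "((\<Sum>i<n. Y i A) - n * m)\<^sup>2 = (\<Sum>i<n. \<Sum>j<n. W i A * W j A)" for A
    proof -
      have "(\<Sum>i<n. Y i A) - n * m = (\<Sum>i<n. W i A)" by (simp add: W_def sum_subtractf)
      then show ?thesis by (simp add: power2_eq_square sum_product)
    qed
    then have "bern p (F n) (\<lambda>A. ((\<Sum>i<n. Y i A) - n * m)\<^sup>2) = (\<Sum>i<n. \<Sum>j<n. bern p (F n) (\<lambda>A. W i A
        * W j A))"
      by (simp add: bern_sum)
    also have "\<dots> \<le> (\<Sum>i<n. \<Sum>j<n. (if nat \<bar>int i - int j\<bar> < s then b\<^sup>2 else 0))"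
      using cov by (intro sum_mono) auto
    also have "\<dots> = (\<Sum>i<n. card {j. j < n \<and> nat \<bar>int i - int j\<bar> < s} * b\<^sup>2)"
    proof (rule sum.cong)
      fix i assume "i \<in> {..<n}"
      have "(\<Sum>j<n. (if nat \<bar>int i - int j\<bar> < s then b\<^sup>2 else 0)) = (\<Sum>j | j < n \<and> nat \<bar>int i - int
          j\<bar> < s. b\<^sup>2)"
        by (rule sum.mono_neutral_cong_right) auto
      then show "(\<Sum>j<n. (if nat \<bar>int i - int j\<bar> < s then b\<^sup>2 else 0)) = card {j. j < n \<and> nat \<bar>int
          i - int j\<bar> < s} * b\<^sup>2" by simp
    qed simp
    also have "\<dots> \<le> (\<Sum>i<n. (2 * s) * b\<^sup>2)"
    proof (intro sum_mono mult_right_mono)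
      show "real (card {j. j < n \<and> nat \<bar>int i - int j\<bar> < s}) \<le> real (2 * s)" for i
        using card_near[of n i s] by (simp only: of_nat_le_iff)
    qed simp
    finally show ?thesis by (simp add: mult_ac)
  qed
  then show ?thesis unfolding m_def by (intro exI[of _ "2 * s * b\<^sup>2"]) auto
qed

text \<open>The way to \<open>int k *s x\<close> is cut into \<open>k div k0\<close> blocks and a
  remainder of fewer than \<open>k0\<close> steps, which is bounded deterministically.
  \<open>W\<close> is the centred block sum. That \<open>C\<close> is chosen before \<open>k\<close>
  matters: both tail estimates rest on it.\<close>

lemma cdist_upper:
  fixes x :: "int ^ 'd::finite"
  assumes p: "0 \<le> p" "p \<le> 1" and E: "finite E" "E \<subseteq> lattice_edges" and x: "x \<noteq> 0" and k0: "k0 \<ge> 1"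
  shows "\<exists>C::real. C \<ge> 0 \<and> (\<forall>k::nat. \<exists>F W. finite F \<and> F \<subseteq> lattice_edges \<and> bern p F (\<lambda>A. (W A)\<^sup>2) \<le>
      C * real k \<and>
    (\<forall>A. real (cdist A 0 (int k *s x)) \<le> real (k div k0) * mdist p E 0 (int k0 *s x) + k0 * l1 0 x
        + W (A \<inter> F)))"
proof -
  define z where "z = int k0 *s x"
  have z: "z \<noteq> 0" using x k0 by (auto simp: z_def vec_eq_iff)
  define Y where "Y i A = real (cdist (A \<inter> shift (int i *s z) E) (int i *s z) (int (Suc i) *s z))"
      for i A
  define F where "F n = (\<Union>i<n. shift (int i *s z) E)" for n
  have "\<exists>C::real. C \<ge> 0 \<and> (\<forall>n. bern p (F n) (\<lambda>A. ((\<Sum>i<n. Y i A) - n * mdist p E 0 z)\<^sup>2) \<le> C * n)"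
    unfolding Y_def F_def by (rule block_variance[OF p E z])
  then obtain C where C: "C \<ge> 0" and C2: "\<forall>n. bern p (F n) (\<lambda>A. ((\<Sum>i<n. Y i A) - n * mdist p E 0
      z)\<^sup>2) \<le> C * n"
    by (elim exE conjE) (rule that)
  have "\<exists>F W. finite F \<and> F \<subseteq> lattice_edges \<and> bern p F (\<lambda>A. (W A)\<^sup>2) \<le> C * real k \<and>
    (\<forall>A. real (cdist A 0 (int k *s x)) \<le> real (k div k0) * mdist p E 0 (int k0 *s x) + k0 * l1 0 x
        + W (A \<inter> F))" for k
  proof -
    define n where "n = k div k0"
    define W where "W A = (\<Sum>i<n. Y i A) - n * mdist p E 0 z" for A
    have Dn: "real (cdist A 0 (int n *s z)) \<le> (\<Sum>i<n. Y i A)" for n A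
    proof (induction n)
      case (Suc n)
      have "cdist A 0 (int (Suc n) *s z) \<le> cdist A 0 (int n *s z) + cdist A (int n *s z) (int (Suc
          n) *s z)" by (rule cdist_shiftiangle)
      moreover have "cdist A (int n *s z) (int (Suc n) *s z) \<le> cdist (A \<inter> shift (int n *s z) E)
          (int n *s z) (int (Suc n) *s z)"
        by (rule cdist_antimono) auto
      ultimately have "real (cdist A 0 (int (Suc n) *s z)) \<le> real (cdist A 0 (int n *s z)) + Y n
          A" unfolding Y_def by linarith
      then show ?case using Suc by simp
    qed simp
    have rest: "real (cdist A (int n *s z) (int k *s x)) \<le> k0 * l1 0 x" for A
    proof -
      have kk: "int k = int n * int k0 + int (k mod k0)" unfolding n_def by (metis div_mult_mod_eq
          of_nat_add of_nat_mult)
      have "\<bar>(int n *s z) $ i - (int k *s x) $ i\<bar> = int (k mod k0) * \<bar>x $ i\<bar>" for i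
        unfolding z_def kk by (simp add: algebra_simps abs_mult)
      then have "l1 (int n *s z) (int k *s x) = nat (int (k mod k0) * (\<Sum>i\<in>UNIV. \<bar>x $ i\<bar>))"
        by (simp add: l1_def sum_distrib_left)
      also have "\<dots> = (k mod k0) * l1 0 x" by (simp add: l1_def nat_mult_distrib)
      also have "\<dots> \<le> k0 * l1 0 x" using k0 by (intro mult_right_mono) (auto intro: less_imp_le)
      finally show ?thesis using cdist_le_l1[of A "int n *s z" "int k *s x"] by (metis
          of_nat_le_iff of_nat_mult order_trans)
    qed
    have "real (cdist A 0 (int k *s x)) \<le> real n * mdist p E 0 z + k0 * l1 0 x + W (A \<inter> F n)" for A
    proof -
      have "Y i (A \<inter> F n) = Y i A" if "i < n" for i
      proof -
        have "F n \<inter> shift (int i *s z) E = shift (int i *s z) E" using that by (auto simp: F_def)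
        then show ?thesis by (simp add: Y_def Int_assoc)
      qed
      then have "W (A \<inter> F n) = (\<Sum>i<n. Y i A) - n * mdist p E 0 z" by (simp add: W_def)
      moreover have "real (cdist A 0 (int k *s x)) \<le> real (cdist A 0 (int n *s z)) + real (cdist A
          (int n *s z) (int k *s x))"
        using cdist_shiftiangle[of A 0 "int k *s x" "int n *s z"] by linarith
      ultimately show ?thesis using Dn[of A n] rest[of A] by linarith
    qed
    moreover have "bern p (F n) (\<lambda>A. (W A)\<^sup>2) \<le> C * real k"
    proof -
      have "C * real n \<le> C * real k" using C by (intro mult_left_mono) (auto simp: n_def)
      then show ?thesis using C2[rule_format, of n] unfolding W_def by linarith
    qed
    moreover have "finite (F n)" "F n \<subseteq> lattice_edges" using shift_finite[OF E(1)] shift_edges[OF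
        E(2)] by (auto simp: F_def)
    ultimately show ?thesis unfolding z_def n_def by blast
  qed
  then show ?thesis using C by blast
qed

lemma cdist_upper_tail:
  fixes x :: "int ^ 'd::finite" and \<eta> :: real
  assumes p: "0 \<le> p" "p \<le> 1" and E: "finite E" "E \<subseteq> lattice_edges" and x: "x \<noteq> 0" and k0: "k0 \<ge> 1"
    and \<eta>: "\<eta> > 0" "mdist p E 0 (int k0 *s x) < \<eta> * k0"
  shows "\<exists>C k1. \<forall>k\<ge>k1. \<exists>F. finite F \<and> F \<subseteq> lattice_edges \<and>
    bern p F (\<lambda>A. of_bool (real (cdist A 0 (int k *s x)) > 2 * \<eta> * k)) \<le> C / real k"
proof -
  obtain C where C: "C \<ge> 0" and C2: "\<forall>k. \<exists>F W. finite F \<and> F \<subseteq> lattice_edges \<and> bern p F (\<lambda>A. (W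
      A)\<^sup>2) \<le> C * real k \<and>
    (\<forall>A. real (cdist A 0 (int k *s x)) \<le> real (k div k0) * mdist p E 0 (int k0 *s x) + k0 * l1 0 x
        + W (A \<inter> F))"
    using cdist_upper[OF p E x k0] by (elim exE conjE) (rule that)
  \<comment> \<open>From here on the remainder is at most \<open>\<eta> * k / 2\<close>; the mean
    takes \<open>\<eta> * k\<close>, so exceeding \<open>2 * \<eta> * k\<close> forces
    \<open>W\<close> to be at least \<open>\<eta> * k / 2\<close>, and Chebyshev applies.\<close>
  define k1 where "k1 = Suc (nat \<lceil>2 * (k0 * l1 0 x) / \<eta>\<rceil>)"
  have "\<exists>F. finite F \<and> F \<subseteq> lattice_edges \<and>
    bern p F (\<lambda>A. of_bool (real (cdist A 0 (int k *s x)) > 2 * \<eta> * k)) \<le> (4 * C / \<eta>\<^sup>2) / real k"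
        if k: "k \<ge> k1" for k
  proof -
    obtain F W where F: "finite F" "F \<subseteq> lattice_edges" "bern p F (\<lambda>A. (W A)\<^sup>2) \<le> C * real k"
      "\<And>A. real (cdist A 0 (int k *s x)) \<le> real (k div k0) * mdist p E 0 (int k0 *s x) + k0 * l1 0
          x + W (A \<inter> F)"
      using C2[rule_format, of k] by (elim exE conjE) (rule that, auto)
    have kpos: "k > 0" using k by (simp add: k1_def)
    have "2 * (k0 * l1 0 x) / \<eta> \<le> real k" using k unfolding k1_def by linarith
    then have kl: "real (k0 * l1 0 x) \<le> \<eta> * k / 2" using \<eta>(1) by (simp add: field_simps)
    have "real (k div k0) * mdist p E 0 (int k0 *s x) \<le> real (k div k0) * (\<eta> * k0)"
      using \<eta>(2) by (intro mult_left_mono) auto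
    also have "\<dots> = \<eta> * real (k div k0 * k0)" by simp
    also have "\<dots> \<le> \<eta> * k" using \<eta>(1) by (intro mult_left_mono) (auto simp: of_nat_le_iff simp del:
        of_nat_mult)
    finally have km: "real (k div k0) * mdist p E 0 (int k0 *s x) \<le> \<eta> * k" .
    have "of_bool (real (cdist A 0 (int k *s x)) > 2 * \<eta> * k) \<le> (4 / (\<eta> * k)\<^sup>2) * (W A)\<^sup>2" if "A \<subseteq>
        F" for A
    proof (cases "real (cdist A 0 (int k *s x)) > 2 * \<eta> * k")
      case True
      have "A \<inter> F = A" using that by auto
      then have "W A \<ge> \<eta> * k / 2" using F(4)[of A] True km kl by simp
      then have "(\<eta> * k / 2)\<^sup>2 \<le> (W A)\<^sup>2" using \<eta>(1) by (intro power_mono) auto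
      moreover have "(\<eta> * k)\<^sup>2 > 0" using \<eta> kpos by simp
      ultimately show ?thesis using True by (simp add: field_simps power_divide)
    qed simp
    then have "bern p F (\<lambda>A. of_bool (real (cdist A 0 (int k *s x)) > 2 * \<eta> * k)) \<le> bern p F (\<lambda>A.
        (4 / (\<eta> * k)\<^sup>2) * (W A)\<^sup>2)"
      by (intro bern_mono[OF p])
    also have "\<dots> \<le> (4 / (\<eta> * k)\<^sup>2) * (C * k)" unfolding bern_cmult using F(3) by (intro
        mult_left_mono) auto
    also have "\<dots> = (4 * C / \<eta>\<^sup>2) / real k" using \<eta>(1) kpos by (simp add: field_simps
        power2_eq_square)
    finally show ?thesis using F(1,2) by blast
  qed
  then show ?thesis by blast
qed

text \<open>If \<open>Z\<close> is the deviation of \<open>cdist / k\<close> from the infimum of its normalised means, then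
  \<open>E Z \<ge> 0\<close>, hence \<open>E Z\<^sup>- \<le> E Z\<^sup>+\<close>: the lower deviations are controlled by the upper ones.\<close>

lemma cdist_lower_tail:
  fixes x :: "int ^ 'd::finite"
  assumes p: "0 \<le> p" "p \<le> 1" and x: "x \<noteq> 0"
    and low: "\<And>E k. finite E \<Longrightarrow> E \<subseteq> lattice_edges \<Longrightarrow> k \<ge> 1 \<Longrightarrow> mdist p E 0 (int k *s x) \<ge> c * real k"
    and \<beta>: "\<beta> > 0"
  shows "\<exists>k1. \<forall>k\<ge>k1. \<exists>F. finite F \<and> F \<subseteq> lattice_edges \<and>
    (\<forall>E. finite E \<longrightarrow> E \<subseteq> lattice_edges \<longrightarrow> F \<subseteq> E \<longrightarrow>
      bern p E (\<lambda>A. of_bool (real (cdist A 0 (int k *s x)) < (c - 1) * k)) \<le> \<beta>)"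
proof -
  \<comment> \<open>The normalised means over all finite edge sets and all \<open>k\<close>; their
    infimum \<open>g\<close> is the time constant in direction \<open>x\<close>.\<close>
  define R where "R = {mdist p E 0 (int k *s x) / k | E k. finite E \<and> E \<subseteq> lattice_edges \<and> k \<ge>
      (1::nat)}"
  define g where "g = Inf R"
  have Rlow: "c \<le> r" if "r \<in> R" for r using that low by (auto simp: R_def field_simps)
  have bdd: "bdd_below R" using Rlow by (auto simp: bdd_below_def)
  have "mdist p {} 0 (int 1 *s x) / real 1 \<in> R" unfolding R_def by fastforce
  then have ne: "R \<noteq> {}" by blast
  have gc: "c \<le> g" unfolding g_def using cInf_greatest[OF ne] Rlow by blast
  have glow: "g * k \<le> mdist p E 0 (int k *s x)" if "finite E" "E \<subseteq> lattice_edges" "k \<ge> 1" for E k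
  proof -
    have "g \<le> mdist p E 0 (int k *s x) / k" unfolding g_def using that by (intro cInf_lower[OF _
        bdd]) (auto simp: R_def)
    then show ?thesis using that by (simp add: field_simps)
  qed
  define \<epsilon> where "\<epsilon> = \<beta> / 4"
  have \<epsilon>: "\<epsilon> > 0" using \<beta> by (simp add: \<epsilon>_def)
  have "\<exists>r\<in>R. r < g + \<epsilon>" unfolding g_def using cInf_lessD[OF ne, of "Inf R + \<epsilon>"] \<epsilon> by auto
  then obtain E0 k0 where E0: "finite E0" "E0 \<subseteq> lattice_edges" "k0 \<ge> 1" "mdist p E0 0 (int k0 *s
      x) / k0 < g + \<epsilon>"
    unfolding R_def by blast
  then have m: "mdist p E0 0 (int k0 *s x) \<le> (g + \<epsilon>) * k0" by (simp add: field_simps)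
  have g\<epsilon>: "0 \<le> g + \<epsilon>" using E0(3,4) mdist_bounds(1)[OF p E0(1), of 0 "int k0 *s x"] by (smt
      (verit) divide_nonneg_nonneg of_nat_0_le_iff)
  obtain C where C: "C \<ge> 0" and C2: "\<forall>k. \<exists>F W. finite F \<and> F \<subseteq> lattice_edges \<and> bern p F (\<lambda>A. (W
      A)\<^sup>2) \<le> C * real k \<and>
    (\<forall>A. real (cdist A 0 (int k *s x)) \<le> real (k div k0) * mdist p E0 0 (int k0 *s x) + k0 * l1 0
        x + W (A \<inter> F))"
    using cdist_upper[OF p E0(1,2) x E0(3)] by (elim exE conjE) (rule that)
  \<comment> \<open>This makes the remainder and the variance term together contribute at most
    \<open>\<epsilon>\<close> to the mean of \<open>V\<close> below.\<close>
  define k1 where "k1 = Suc (nat \<lceil>(k0 * l1 0 x + C / \<epsilon>) / \<epsilon>\<rceil>)"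
  have "\<exists>F. finite F \<and> F \<subseteq> lattice_edges \<and>
    (\<forall>E. finite E \<longrightarrow> E \<subseteq> lattice_edges \<longrightarrow> F \<subseteq> E \<longrightarrow>
      bern p E (\<lambda>A. of_bool (real (cdist A 0 (int k *s x)) < (c - 1) * k)) \<le> \<beta>)" if k: "k \<ge> k1"
          for k
  proof -
    obtain F W where F: "finite F" "F \<subseteq> lattice_edges" "bern p F (\<lambda>A. (W A)\<^sup>2) \<le> C * real k"
      "\<And>A. real (cdist A 0 (int k *s x)) \<le> real (k div k0) * mdist p E0 0 (int k0 *s x) + k0 * l1
          0 x + W (A \<inter> F)"
      using C2[rule_format, of k] by (elim exE conjE) (rule that, auto)
    have kpos: "k > 0" using k by (simp add: k1_def)
    have kk: "(k0 * l1 0 x + C / \<epsilon>) / \<epsilon> \<le> real k" using k unfolding k1_def by linarith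
    have km: "real (k div k0) * mdist p E0 0 (int k0 *s x) \<le> (g + \<epsilon>) * k"
    proof -
      have "real (k div k0) * mdist p E0 0 (int k0 *s x) \<le> real (k div k0) * ((g + \<epsilon>) * k0)"
        using m by (intro mult_left_mono) auto
      also have "\<dots> = (g + \<epsilon>) * real (k div k0 * k0)" by simp
      also have "\<dots> \<le> (g + \<epsilon>) * k" using g\<epsilon> by (intro mult_left_mono) (auto simp: of_nat_le_iff
          simp del: of_nat_mult)
      finally show ?thesis .
    qed
    have "bern p E (\<lambda>A. of_bool (real (cdist A 0 (int k *s x)) < (c - 1) * k)) \<le> \<beta>"
      if E: "finite E" "E \<subseteq> lattice_edges" "F \<subseteq> E" for E
    proof -
      define Z where "Z A = real (cdist A 0 (int k *s x)) / k - g" for A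
      define K where "K = 1 / (\<epsilon> * (real k)\<^sup>2)"
      \<comment> \<open>A nonnegative majorant of \<open>Z\<close>: the linear term
        \<open>W / k\<close> is traded for its square divided by \<open>\<epsilon>\<close>, plus
        \<open>\<epsilon>\<close>, because only the second moment of \<open>W\<close> is
        controlled.\<close>
      define V where "V A = 2 * \<epsilon> + k0 * l1 0 x / k + K * (W (A \<inter> F))\<^sup>2" for A
      have K0: "K \<ge> 0" using \<epsilon> by (simp add: K_def)
      have ZV: "Z A \<le> V A" for A
      proof -
        have "Z A \<le> ((g + \<epsilon>) * k + k0 * l1 0 x + W (A \<inter> F)) / k - g"
          unfolding Z_def using F(4)[of A] km kpos by (intro diff_right_mono divide_right_mono) auto
        also have "\<dots> = \<epsilon> + k0 * l1 0 x / k + W (A \<inter> F) / k" using kpos by (simp add: field_simps)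
        finally have 1: "Z A \<le> \<epsilon> + k0 * l1 0 x / k + W (A \<inter> F) / k" .
        have "2 * q \<le> q\<^sup>2 / \<epsilon> + \<epsilon>" for q
        proof -
          have "0 \<le> (q - \<epsilon>)\<^sup>2 / \<epsilon>" using \<epsilon> by simp
          also have "\<dots> = q\<^sup>2 / \<epsilon> - 2 * q + \<epsilon>" using \<epsilon> by (simp add: power2_eq_square field_simps)
          finally show ?thesis by simp
        qed
        then have "2 * (W (A \<inter> F) / k) \<le> (W (A \<inter> F) / k)\<^sup>2 / \<epsilon> + \<epsilon>" .
        moreover have "(W (A \<inter> F) / k)\<^sup>2 / \<epsilon> = K * (W (A \<inter> F))\<^sup>2"
          by (simp add: power_divide K_def)
        moreover have "0 \<le> (W (A \<inter> F) / k)\<^sup>2 / \<epsilon>" using \<epsilon> by simp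
        ultimately have "W (A \<inter> F) / k \<le> K * (W (A \<inter> F))\<^sup>2 + \<epsilon>" using \<epsilon> by linarith
        then show ?thesis using 1 unfolding V_def by linarith
      qed
      have V0: "0 \<le> V A" for A using \<epsilon> K0 unfolding V_def by (intro add_nonneg_nonneg
          mult_nonneg_nonneg) auto
      \<comment> \<open>A lower deviation means \<open>Z A < - 1\<close>, since
        \<open>c \<le> g\<close>. Taking means bounds its probability by the mean of
        \<open>V\<close>, as \<open>Z\<close> has nonnegative mean.\<close>
      have "of_bool (real (cdist A 0 (int k *s x)) < (c - 1) * k) \<le> V A - Z A" for A
      proof (cases "real (cdist A 0 (int k *s x)) < (c - 1) * k")
        case True
        then have "real (cdist A 0 (int k *s x)) / k < c - 1" using kpos by (simp add: field_simps)
        then have "Z A < - 1" using gc unfolding Z_def by linarith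
        then show ?thesis using V0[of A] True by simp
      qed (use ZV[of A] in simp)
      then have "bern p E (\<lambda>A. of_bool (real (cdist A 0 (int k *s x)) < (c - 1) * k)) \<le> bern p E V
          - bern p E Z"
        unfolding bern_diff[symmetric] by (intro bern_mono[OF p])
      moreover have "bern p E Z \<ge> 0"
      proof -
        have "bern p E Z = mdist p E 0 (int k *s x) / k - g" unfolding Z_def mdist_def
          using bern_cmult[of p E "1 / k" "\<lambda>A. real (cdist A 0 (int k *s x))"] E(1) by (simp add:
              bern_diff bern_const)
        moreover have "g \<le> mdist p E 0 (int k *s x) / k" using glow[OF E(1,2), of k] kpos by (simp
            add: field_simps)
        ultimately show ?thesis by simp
      qed
      moreover have "bern p E V \<le> 4 * \<epsilon>"
      proof -
        have "bern p E V = 2 * \<epsilon> + k0 * l1 0 x / k + K * bern p F (\<lambda>A. (W A)\<^sup>2)"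
          unfolding V_def using bern_restrict[OF E(1,3), of p "\<lambda>A. (W A)\<^sup>2"]
          by (simp add: bern_add bern_const[OF E(1)] bern_cmult)
        also have "\<dots> \<le> 2 * \<epsilon> + k0 * l1 0 x / k + K * (C * k)"
          using F(3) K0 by (intro add_left_mono mult_left_mono) auto
        also have "\<dots> = 2 * \<epsilon> + (k0 * l1 0 x + C / \<epsilon>) / k" using kpos \<epsilon> by (simp add: K_def
            field_simps power2_eq_square)
        also have "\<dots> \<le> 2 * \<epsilon> + \<epsilon>" using kk kpos \<epsilon> by (simp add: field_simps)
        finally show ?thesis using \<epsilon> by simp
      qed
      ultimately show ?thesis unfolding \<epsilon>_def by linarith
    qed
    then show ?thesis using F(1,2) by blast
  qed
  then show ?thesis by blast
qed

text \<open>The mirror image of \<open>x\<close> in coordinate \<open>i\<close> is as far from 0 as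
  \<open>x\<close>, and differs from \<open>x\<close> by an axis vector of length
  \<open>2 * \<bar>x $ i\<bar>\<close>. The triangle inequality then transfers the bound on the axis
  to every direction.\<close>

lemma mdist_norm:
  fixes x :: "int ^ 'd::finite"
  assumes p: "0 \<le> p" "p \<le> 1"
    and low: "\<And>E n. finite E \<Longrightarrow> E \<subseteq> lattice_edges \<Longrightarrow> n \<ge> 1 \<Longrightarrow> \<eta> * real n \<le> mdist p E 0 (int n *s axis
        i 1)"
    and E: "finite E" "E \<subseteq> lattice_edges"
  shows "\<eta> * \<bar>x $ i\<bar> \<le> mdist p E 0 x"
proof (cases "x $ i = 0")
  case True
  then show ?thesis using mdist_bounds(1)[OF p E(1)] by simp
next
  case False
  define \<phi> :: "int ^ 'd \<Rightarrow> int ^ 'd" where "\<phi> = (\<lambda>x. \<chi> j. if j = i then - x $ j else x $ j)"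
  have aut: "lattice_aut \<phi>" unfolding \<phi>_def by (rule lattice_aut_reflect)
  \<comment> \<open>Adding the mirror image of \<open>E\<close> makes both mean distances to 0 at
    most \<open>mdist p E 0 x\<close>.\<close>
  define E' where "E' = E \<union> (`) \<phi> ` E"
  have E': "finite E'" "E' \<subseteq> lattice_edges" using E lattice_aut_edges[OF aut E(2)] by (auto simp:
      E'_def)
  have \<phi>0: "\<phi> 0 = 0" by (simp add: \<phi>_def vec_eq_iff)
  have "mdist p E' 0 x \<le> mdist p E 0 x" by (rule mdist_antimono[OF p E'(1)]) (simp add: E'_def)
  moreover have "mdist p E' 0 (\<phi> x) \<le> mdist p E 0 x"
    using mdist_antimono[OF p E'(1), of "(`) \<phi> ` E" 0 "\<phi> x"] mdist_aut[OF aut, of p E 0 x] \<phi>0 by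
        (simp add: E'_def)
  ultimately have two: "mdist p E' x (\<phi> x) \<le> 2 * mdist p E 0 x" "mdist p E' (\<phi> x) x \<le> 2 * mdist p
      E 0 x"
    using mdist_triangle[OF p, of E' x "\<phi> x" 0] mdist_sym[of p E' x 0] mdist_sym[of p E' x "\<phi> x"]
        by linarith+
  define n where "n = nat (2 * \<bar>x $ i\<bar>)"
  have n: "n \<ge> 1" "real n = 2 * \<bar>real_of_int (x $ i)\<bar>" using False by (auto simp: n_def)
  have gen: "\<eta> * real n \<le> mdist p E' a (a + int n *s axis i 1)" for a
    using low[OF shift_finite[OF E'(1)] shift_edges[OF E'(2)] n(1), of "- a"] mdist_tr[of p "- a"
        E' a "a + int n *s axis i 1"] by simp
  show ?thesis
  proof (cases "x $ i > 0")
    case True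
    have "\<phi> x + int n *s axis i 1 = x" using True by (auto simp: \<phi>_def n_def vec_eq_iff axis_def)
    then show ?thesis using gen[of "\<phi> x"] two n by simp
  next
    case neg: False
    have "x + int n *s axis i 1 = \<phi> x" using neg False by (auto simp: \<phi>_def n_def vec_eq_iff
        axis_def)
    then show ?thesis using gen[of x] two n by simp
  qed
qed

section \<open>Rounding to a coarse grid, and crossings of annuli\<close>

lemma round_cube:
  fixes u :: "int ^ 'd::finite"
  assumes "k \<ge> (1::nat)"
  defines "a \<equiv> (\<chi> i. u $ i div int k) :: int ^ 'd"
  shows "u \<in> cube (int k *s a) k"
proof -
  have "u $ i - int k * (u $ i div int k) = u $ i mod int k" for i by (simp add:
      minus_mult_div_eq_mod)
  moreover have "0 \<le> u $ i mod int k" "u $ i mod int k < int k" for i using assms(1) by auto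
  ultimately show ?thesis unfolding a_def cube_def by (auto simp: less_imp_le)
qed

lemma div_bounds:
  fixes t :: int
  assumes "k \<ge> (1::nat)" "\<bar>t\<bar> \<le> int (m * k)"
  shows "\<bar>t div int k\<bar> \<le> int m"
proof -
  have "t \<le> int m * int k" "- int m * int k \<le> t" using assms(2) by auto
  then have "t div int k \<le> (int m * int k) div int k" "(- int m * int k) div int k \<le> t div int k"
    using assms(1) by (intro zdiv_mono1; simp)+
  moreover have "(int m * int k) div int k = int m" "(- int m * int k) div int k = - int m"
    using assms(1) by (subst nonzero_mult_div_cancel_right; simp)+
  ultimately show ?thesis by linarith
qed

text \<open>Distance zero means joined by edges of \<open>A\<close>. The far end is held in a single
  shell so that, after rounding to a grid of mesh proportional to \<open>n\<close>, the pairs of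
  ends range over a set that does not depend on the scale.\<close>

definition crossing :: "int ^ 'd \<Rightarrow> nat \<Rightarrow> (int ^ 'd) set set \<Rightarrow> bool" where
  "crossing c n A \<longleftrightarrow> (\<exists>u\<in>cube c n. \<exists>v\<in>cube c (3 * n + 1) - cube c (3 * n). cdist A u v = 0)"

lemma crossing_mono: "A \<subseteq> A' \<Longrightarrow> crossing c n A \<Longrightarrow> crossing c n A'" for c :: "int ^ 'd::finite"
  unfolding crossing_def using cdist_antimono by (metis le_zero_eq)

text \<open>Were the time constant positive, then so would be, with high probability, the distances
  between the points of a coarse grid in the two sides of an annulus, and the annulus could not
  be crossed at zero cost.\<close>

lemma crossing_imp_zero_time_constant:
  assumes p: "0 \<le> p" "p \<le> 1" and \<delta>: "\<delta> > 0" and \<eta>: "\<eta> > 0"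
    and cross: "\<And>n. n \<ge> 1 \<Longrightarrow> \<exists>E::(int ^ 'd::finite) set set. finite E \<and> E \<subseteq> lattice_edges \<and>
      \<delta> \<le> bern p E (\<lambda>A. of_bool (crossing 0 n A))"
  shows "\<exists>(i::'d) n E. n \<ge> 1 \<and> finite E \<and> E \<subseteq> lattice_edges \<and> mdist p E 0 (int n *s axis i 1) < \<eta>
      * real n"
proof (rule ccontr)
  assume neg: "\<not> ?thesis"
  have norm: "\<eta> * \<bar>x $ i\<bar> \<le> mdist p E 0 x" if "finite E" "E \<subseteq> lattice_edges" for E i and x :: "int
      ^ 'd"
  proof (rule mdist_norm[OF p _ that])
    fix E' :: "(int ^ 'd) set set" and n assume "finite E'" "E' \<subseteq> lattice_edges" "n \<ge> (1::nat)"
    then show "\<eta> * real n \<le> mdist p E' 0 (int n *s axis i 1)" using neg not_less by blast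
  qed
  \<comment> \<open>With mesh \<open>k\<close> and inner radius \<open>m * k\<close>, the grid
    points are at least \<open>2 * m * k\<close> apart in some coordinate. The bound
    \<open>2 * m * \<eta>\<close> per unit of \<open>k\<close> must exceed the rounding cost
    \<open>2 * CARD('d)\<close> plus the 1 lost in \<open>cdist_lower_tail\<close>.\<close>
  define m where "m = Suc (nat \<lceil>(2 * CARD('d) + 1) / (2 * \<eta>)\<rceil>)"
  have "(2 * CARD('d) + 1) / (2 * \<eta>) < m" unfolding m_def by linarith
  then have m: "2 * CARD('d) + 1 < 2 * m * \<eta>" using \<eta> by (simp add: field_simps)
  define P where "P = {(a, b). a \<in> cube (0::int ^ 'd) m \<and> b \<in> cube 0 (3 * m + 1) \<and> (\<exists>i. \<bar>b $ i - a
      $ i\<bar> \<ge> int (2 * m))}"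
  have "P \<subseteq> cube 0 m \<times> cube 0 (3 * m + 1)" by (auto simp: P_def)
  then have finP: "finite P" using finite_subset cube_finite_card(1) by blast
  \<comment> \<open>Summed over all pairs in \<open>P\<close>, the failure probabilities stay below
    \<open>\<delta>\<close>.\<close>
  define \<beta> where "\<beta> = \<delta> / (2 * (real (card P) + 1))"
  have \<beta>: "\<beta> > 0" using \<delta> by (simp add: \<beta>_def add_nonneg_pos)
  have "\<exists>k1. \<forall>k\<ge>k1. \<exists>F. finite F \<and> F \<subseteq> lattice_edges \<and>
    (\<forall>E. finite E \<longrightarrow> E \<subseteq> lattice_edges \<longrightarrow> F \<subseteq> E \<longrightarrow>
      bern p E (\<lambda>A. of_bool (real (cdist A 0 (int k *s (snd ab - fst ab))) < (2 * m * \<eta> - 1) * k))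
          \<le> \<beta>)"
    if "ab \<in> P" for ab :: "(int ^ 'd) \<times> (int ^ 'd)"
  proof -
    obtain i where i: "\<bar>(snd ab - fst ab) $ i\<bar> \<ge> int (2 * m)" using \<open>ab \<in> P\<close> by (auto simp: P_def)
    have "m \<ge> 1" by (simp add: m_def)
    then have ne: "snd ab - fst ab \<noteq> 0" using i by auto
    define w where "w = snd ab - fst ab"
    show ?thesis
    proof (rule cdist_lower_tail[OF p ne _ \<beta>])
      fix E :: "(int ^ 'd) set set" and k assume E: "finite E" "E \<subseteq> lattice_edges" "k \<ge> (1::nat)"
      have "real (2 * m) \<le> real_of_int \<bar>(snd ab - fst ab) $ i\<bar>" using i by linarith
      then have "\<eta> * (real k * (2 * m)) \<le> \<eta> * (real k * real_of_int \<bar>(snd ab - fst ab) $ i\<bar>)"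
        using \<eta> by (intro mult_left_mono) auto
      also have "\<dots> = \<eta> * \<bar>(int k *s (snd ab - fst ab)) $ i\<bar>" unfolding w_def[symmetric] by (simp
          add: abs_mult)
      also have "\<dots> \<le> mdist p E 0 (int k *s (snd ab - fst ab))" by (rule norm[OF E(1,2)])
      finally show "2 * m * \<eta> * real k \<le> mdist p E 0 (int k *s (snd ab - fst ab))" by (simp add:
          mult_ac)
    qed
  qed
  then obtain k1 where k1: "\<And>ab k. ab \<in> P \<Longrightarrow> k \<ge> k1 ab \<Longrightarrow> \<exists>F. finite F \<and> F \<subseteq> lattice_edges \<and>
    (\<forall>E. finite E \<longrightarrow> E \<subseteq> lattice_edges \<longrightarrow> F \<subseteq> E \<longrightarrow>
      bern p E (\<lambda>A. of_bool (real (cdist A 0 (int k *s (snd ab - fst ab))) < (2 * m * \<eta> - 1) * k))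
          \<le> \<beta>)"
    by metis
  define k where "k = Suc (\<Sum>ab\<in>P. k1 ab)"
  have k: "k \<ge> 1" by (simp add: k_def)
  have "k1 ab \<le> k" if "ab \<in> P" for ab using member_le_sum[OF that _ finP, of k1] by (simp add:
      k_def)
  then obtain F where F: "\<And>ab. ab \<in> P \<Longrightarrow> finite (F ab)" "\<And>ab. ab \<in> P \<Longrightarrow> F ab \<subseteq> lattice_edges"
    "\<And>ab E. ab \<in> P \<Longrightarrow> finite E \<Longrightarrow> E \<subseteq> lattice_edges \<Longrightarrow> F ab \<subseteq> E \<Longrightarrow>
      bern p E (\<lambda>A. of_bool (real (cdist A 0 (int k *s (snd ab - fst ab))) < (2 * m * \<eta> - 1) * k))
          \<le> \<beta>"
    using k1[of _ k] by metis
  have mk: "m * k \<ge> 1" using k by (simp add: m_def)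
  obtain Ec :: "(int ^ 'd) set set" where Ec: "finite Ec" "Ec \<subseteq> lattice_edges"
      "\<delta> \<le> bern p Ec (\<lambda>A. of_bool (crossing 0 (m * k) A))"
    using cross[OF mk] by (elim exE conjE) (rule that)
  \<comment> \<open>One finite edge set on which the crossing and all lower tails can be compared;
    this is why \<open>cdist_lower_tail\<close> allows any \<open>E\<close> containing
    \<open>F\<close>.\<close>
  define E where "E = Ec \<union> (\<Union>ab\<in>P. shift (int k *s fst ab) (F ab))"
  have E: "finite E" "E \<subseteq> lattice_edges" using Ec F(1) finP shift_finite shift_edges[OF F(2)]
      unfolding E_def by blast+
  have pair: "bern p E (\<lambda>A. of_bool (real (cdist A (int k *s fst ab) (int k *s snd ab)) < (2 * m *
      \<eta> - 1) * k)) \<le> \<beta>"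
    if ab: "ab \<in> P" for ab
  proof -
    let ?c = "int k *s fst ab"
    have eq: "int k *s snd ab = ?c + int k *s (snd ab - fst ab)" by (simp add: vec_eq_iff
        algebra_simps)
    have sub: "F ab \<subseteq> shift (- ?c) E"
    proof -
      have "shift (- ?c) (shift ?c (F ab)) \<subseteq> shift (- ?c) E" using ab by (intro shift_mono) (auto
          simp: E_def)
      then show ?thesis by (simp add: shift_tr)
    qed
    have "bern p E (\<lambda>A. of_bool (real (cdist A ?c (int k *s snd ab)) < (2 * m * \<eta> - 1) * k)) =
       bern p (shift (- ?c) E) (\<lambda>A. of_bool (real (cdist A 0 (int k *s (snd ab - fst ab))) < (2 *
           m * \<eta> - 1) * k))"
      unfolding eq by (rule bern_dist_translate[of p E "\<lambda>n. of_bool (real n < (2 * m * \<eta> - 1) *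
          k)"])
    also have "\<dots> \<le> \<beta>" by (rule F(3)[OF ab shift_finite[OF E(1)] shift_edges[OF E(2)] sub])
    finally show ?thesis .
  qed
  have incl: "of_bool (crossing 0 (m * k) A) \<le>
    (\<Sum>ab\<in>P. of_bool (real (cdist A (int k *s fst ab) (int k *s snd ab)) < (2 * m * \<eta> - 1) * k) ::
        real)" for A
  proof (cases "crossing 0 (m * k) A")
    case True
    then obtain u v where uv: "u \<in> cube 0 (m * k)" "v \<in> cube 0 (3 * (m * k) + 1)" "v \<notin> cube 0 (3 *
        (m * k))" "cdist A u v = 0"
      unfolding crossing_def by blast
    define a :: "int ^ 'd" where "a = (\<chi> i. u $ i div int k)"
    define b :: "int ^ 'd" where "b = (\<chi> i. v $ i div int k)"
    have ua: "u \<in> cube (int k *s a) k" and vb: "v \<in> cube (int k *s b) k"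
      unfolding a_def b_def by (rule round_cube[OF k])+
    have a: "\<bar>a $ i\<bar> \<le> int m" for i using uv(1) div_bounds[OF k, of "u $ i" m] by (simp add:
        cube_def a_def)
    have "\<bar>v $ i\<bar> \<le> int ((3 * m + 1) * k)" for i
    proof -
      have "\<bar>v $ i\<bar> \<le> int (3 * (m * k) + 1)" using uv(2) by (simp add: cube_def)
      also have "\<dots> \<le> int ((3 * m + 1) * k)" using k by (simp add: algebra_simps)
      finally show ?thesis .
    qed
    then have b: "\<bar>b $ i\<bar> \<le> int (3 * m + 1)" for i using div_bounds[OF k, of "v $ i" "3 * m + 1"]
        by (simp add: b_def)
    obtain i where i: "\<bar>v $ i\<bar> > int (3 * (m * k))" using uv(3) by (auto simp: cube_def not_le)
    have "\<bar>b $ i\<bar> \<ge> int (3 * m)"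
    proof (cases "v $ i > 0")
      case True
      then have "(int (3 * m) * int k) div int k \<le> v $ i div int k" using i k by (intro
          zdiv_mono1) auto
      then show ?thesis using k by (simp add: b_def)
    next
      case False
      then have "v $ i div int k \<le> (- int (3 * m) * int k) div int k" using i k by (intro
          zdiv_mono1) auto
      moreover have "(- int (3 * m) * int k) div int k = - int (3 * m)"
        using k by (subst nonzero_mult_div_cancel_right; simp)
      ultimately show ?thesis by (simp add: b_def)
    qed
    then have "\<bar>b $ i - a $ i\<bar> \<ge> int (2 * m)" using a[of i] by linarith
    then have abP: "(a, b) \<in> P" using a b by (auto simp: P_def cube_def)
    \<comment> \<open>An open crossing costs nothing; only the two roundings are paid, at most
      \<open>CARD('d) * k\<close> each.\<close>
    have "cdist A (int k *s a) (int k *s b) \<le> cdist A (int k *s a) u + (cdist A u v + cdist A v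
        (int k *s b))"
      by (meson cdist_shiftiangle add_left_mono order_trans)
    also have "\<dots> \<le> CARD('d) * k + (0 + CARD('d) * k)"
      using cdist_le_l1[of A u "int k *s a"] cdist_le_l1[of A v "int k *s b"] l1_cube[OF ua]
          l1_cube[OF vb] uv(4) cdist_sym[of A u "int k *s a"]
      by (intro add_mono) auto
    finally have "real (cdist A (int k *s a) (int k *s b)) \<le> real (2 * CARD('d) * k)" by (simp
        only: of_nat_le_iff)
    also have "\<dots> < (2 * m * \<eta> - 1) * k" using m k by simp
    finally have "real (cdist A (int k *s fst (a, b)) (int k *s snd (a, b))) < (2 * m * \<eta> - 1) *
        k" by simp
    then have "1 \<le> (of_bool (real (cdist A (int k *s fst (a, b)) (int k *s snd (a, b))) < (2 * m *
        \<eta> - 1) * k) :: real)" by simp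
    also have "\<dots> \<le> (\<Sum>ab\<in>P. of_bool (real (cdist A (int k *s fst ab) (int k *s snd ab)) < (2 * m *
        \<eta> - 1) * k))"
      by (rule member_le_sum[OF abP _ finP]) simp
    finally show ?thesis using True by simp
  qed (simp add: sum_nonneg)
  have "\<delta> \<le> bern p E (\<lambda>A. of_bool (crossing 0 (m * k) (A \<inter> Ec)))"
    using Ec(3) bern_restrict[OF E(1), of Ec p "\<lambda>A. of_bool (crossing 0 (m * k) A)"] by (simp add:
        E_def)
  also have "\<dots> \<le> bern p E (\<lambda>A. \<Sum>ab\<in>P. of_bool (real (cdist A (int k *s fst ab) (int k *s snd ab))
      < (2 * m * \<eta> - 1) * k))"
  proof (rule bern_mono[OF p])
    fix A
    have "of_bool (crossing 0 (m * k) (A \<inter> Ec)) \<le> (of_bool (crossing 0 (m * k) A) :: real)"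
      using crossing_mono[of "A \<inter> Ec" A 0 "m * k"] by auto
    then show "of_bool (crossing 0 (m * k) (A \<inter> Ec)) \<le> (\<Sum>ab\<in>P. of_bool (real (cdist A (int k *s
        fst ab) (int k *s snd ab)) < (2 * m * \<eta> - 1) * k) :: real)"
      using incl[of A] by linarith
  qed
  also have "\<dots> \<le> (\<Sum>ab\<in>P. \<beta>)" unfolding bern_sum by (rule sum_mono) (rule pair)
  also have "\<dots> < \<delta>" using \<delta> by (simp add: \<beta>_def field_simps add_nonneg_pos)
  finally show False by simp
qed

lemma mdist_axis_swap:
  fixes i j :: "'d::finite"
  shows "\<exists>E'. (finite E \<longrightarrow> finite E') \<and> (E \<subseteq> lattice_edges \<longrightarrow> E' \<subseteq> lattice_edges) \<and>
    mdist p E' 0 (c *s axis j 1) = mdist p E 0 (c *s axis i 1)"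
proof -
  define \<pi> where "\<pi> = Transposition.transpose i j"
  define \<phi> :: "int ^ 'd \<Rightarrow> int ^ 'd" where "\<phi> = (\<lambda>x. \<chi> l. x $ (\<pi> l))"
  have aut: "lattice_aut \<phi>" unfolding \<phi>_def \<pi>_def by (rule lattice_aut_permute) simp
  have "\<phi> 0 = 0" "\<phi> (c *s axis i 1) = c *s axis j 1"
    by (auto simp: \<phi>_def \<pi>_def vec_eq_iff axis_def Transposition.transpose_def)
  then show ?thesis using mdist_aut[OF aut, of p E 0 "c *s axis i 1"] lattice_aut_edges[OF aut, of
      E]
    by (intro exI[of _ "(`) \<phi> ` E"]) auto
qed

text \<open>Neighbouring points of a grid of mesh \<open>h\<close> are with high probability at
  distance at most \<open>h / m\<close>. A grid walk has at most \<open>2 * m * CARD('d)\<close>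
  steps and costs \<open>2 * CARD('d) * h\<close>; the two roundings cost as much again. The bound
  does not grow with \<open>m\<close>, which expresses \<open>o(n)\<close>.\<close>

lemma uniform_distance_bound:
  fixes m :: nat
  assumes p: "0 \<le> p" "p \<le> 1" and m: "m \<ge> 1"
    and small: "\<And>i::'d::finite. \<And>\<eta>. \<eta> > 0 \<Longrightarrow> \<exists>n E. n \<ge> 1 \<and> finite E \<and> E \<subseteq> lattice_edges \<and>
      mdist p E 0 (int n *s axis i 1) < \<eta> * real n"
  shows "\<exists>C h1. \<forall>h\<ge>h1. \<exists>F::(int ^ 'd) set set. finite F \<and> F \<subseteq> lattice_edges \<and>
    bern p F (\<lambda>A. of_bool (\<exists>x\<in>cube 0 (m * h). \<exists>y\<in>cube 0 (m * h). cdist A x y > 4 * CARD('d) * h))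
        \<le> C / real h"
proof -
  \<comment> \<open>The upper tail is stated at level \<open>2 * \<eta>\<close>, which is thus
    \<open>1 / m\<close>.\<close>
  define \<eta> where "\<eta> = 1 / (2 * real m)"
  have \<eta>: "\<eta> > 0" "2 * \<eta> = 1 / m" using m by (auto simp: \<eta>_def)
  have "\<exists>C k1. \<forall>k\<ge>k1. \<exists>F. finite F \<and> F \<subseteq> lattice_edges \<and>
    bern p F (\<lambda>A. of_bool (real (cdist A 0 (int k *s axis i 1)) > 2 * \<eta> * k)) \<le> C / real k" for i
        :: 'd
  proof -
    obtain n E where nE: "n \<ge> 1" "finite E" "E \<subseteq> lattice_edges" "mdist p E 0 (int n *s axis i 1) <
        \<eta> * real n"
      using small[OF \<eta>(1), of i] by blast
    show ?thesis by (rule cdist_upper_tail[OF p nE(2,3) _ nE(1) \<eta>(1) nE(4)]) (simp add: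
        axis_eq_0_iff)
  qed
  then obtain C k1 where "\<forall>i::'d. \<forall>k\<ge>k1 i. \<exists>F. finite F \<and> F \<subseteq> lattice_edges \<and>
    bern p F (\<lambda>A. of_bool (real (cdist A 0 (int k *s axis i 1)) > 2 * \<eta> * k)) \<le> C i / real k"
    by metis
  note Ck = this[rule_format]
  define h1 where "h1 = Suc (\<Sum>i\<in>UNIV. k1 i)"
  have kh: "k1 i \<le> h" if "h \<ge> h1" for i h using member_le_sum[of i UNIV k1] that by (simp add:
      h1_def)
  define C' where "C' = (\<Sum>a\<in>cube (0::int ^ 'd) m. \<Sum>i\<in>UNIV. C i)"
  have "\<exists>F::(int ^ 'd) set set. finite F \<and> F \<subseteq> lattice_edges \<and>
    bern p F (\<lambda>A. of_bool (\<exists>x\<in>cube 0 (m * h). \<exists>y\<in>cube 0 (m * h). cdist A x y > 4 * CARD('d) * h))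
        \<le> C' / real h"
    if h: "h \<ge> h1" for h
  proof -
    have h0: "h \<ge> 1" using h by (simp add: h1_def)
    have "\<exists>F. \<forall>i. finite (F i) \<and> F i \<subseteq> lattice_edges \<and>
      bern p (F i) (\<lambda>A. of_bool (real (cdist A 0 (int h *s axis i 1)) > 2 * \<eta> * h)) \<le> C i / real h"
      by (rule choice) (intro allI Ck kh[OF h])
    then obtain F where F': "\<forall>i. finite (F i) \<and> F i \<subseteq> lattice_edges \<and>
      bern p (F i) (\<lambda>A. of_bool (real (cdist A 0 (int h *s axis i 1)) > 2 * \<eta> * h)) \<le> C i / real
          h" ..
    have F: "finite (F i)" "F i \<subseteq> lattice_edges"
      "bern p (F i) (\<lambda>A. of_bool (real (cdist A 0 (int h *s axis i 1)) > 2 * \<eta> * h)) \<le> C i / real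
          h" for i
      using F' by auto
    define E where "E = (\<Union>a\<in>cube (0::int ^ 'd) m. \<Union>i. shift (int h *s a) (F i))"
    have E: "finite E" "E \<subseteq> lattice_edges"
      unfolding E_def by (intro finite_UN_I cube_finite_card(1) finite shift_finite F(1) UN_least
          shift_edges F(2))+
    have tail: "bern p E (\<lambda>A. of_bool (real (cdist A (int h *s a) (int h *s a + int h *s axis i
        1)) > 2 * \<eta> * h)) \<le> C i / h"
      if a: "a \<in> cube 0 m" for a i
    proof -
      let ?c = "int h *s a"
      have "shift (- ?c) (shift ?c (F i)) \<subseteq> shift (- ?c) E" using a by (intro shift_mono) (auto
          simp: E_def)
      then have sub: "F i \<subseteq> shift (- ?c) E" by (simp add: shift_tr)
      have "bern p E (\<lambda>A. of_bool (real (cdist A ?c (?c + int h *s axis i 1)) > 2 * \<eta> * h)) =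
         bern p (shift (- ?c) E) (\<lambda>A. of_bool (real (cdist A 0 (int h *s axis i 1)) > 2 * \<eta> * h))"
        by (rule bern_dist_translate[of p E "\<lambda>n. of_bool (real n > 2 * \<eta> * h)"])
      also have "\<dots> \<le> bern p (shift (- ?c) E) (\<lambda>A. of_bool (real (cdist (A \<inter> F i) 0 (int h *s axis
          i 1)) > 2 * \<eta> * h))"
      proof (rule bern_mono[OF p])
        fix A
        have "cdist A 0 (int h *s axis i 1) \<le> cdist (A \<inter> F i) 0 (int h *s axis i 1)" by (rule
            cdist_antimono) auto
        then have "real (cdist A 0 (int h *s axis i 1)) \<le> real (cdist (A \<inter> F i) 0 (int h *s axis i
            1))" by simp
        then show "of_bool (real (cdist A 0 (int h *s axis i 1)) > 2 * \<eta> * h) \<le>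
          (of_bool (real (cdist (A \<inter> F i) 0 (int h *s axis i 1)) > 2 * \<eta> * h) :: real)"
          by (auto simp del: of_nat_le_iff)
      qed
      also have "\<dots> = bern p (F i) (\<lambda>A. of_bool (real (cdist A 0 (int h *s axis i 1)) > 2 * \<eta> * h))"
        by (rule bern_restrict[OF shift_finite[OF E(1)] sub])
      also have "\<dots> \<le> C i / h" by (rule F(3))
      finally show ?thesis .
    qed
    have incl: "of_bool (\<exists>x\<in>cube 0 (m * h). \<exists>y\<in>cube 0 (m * h). cdist A x y > 4 * CARD('d) * h) \<le>
      (\<Sum>a\<in>cube (0::int ^ 'd) m. \<Sum>i\<in>UNIV. of_bool (real (cdist A (int h *s a) (int h *s a + int h
          *s axis i 1)) > 2 * \<eta> * h) :: real)"
      (is "_ \<le> (\<Sum>a\<in>_. \<Sum>i\<in>_. ?T a i)") for A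
    proof (cases "\<exists>a\<in>cube (0::int ^ 'd) m. \<exists>i. real (cdist A (int h *s a) (int h *s a + int h *s
        axis i 1)) > 2 * \<eta> * h")
      case True
      then obtain a i where ai: "a \<in> cube (0::int ^ 'd) m" "real (cdist A (int h *s a) (int h *s a
          + int h *s axis i 1)) > 2 * \<eta> * h" by blast
      have "1 \<le> ?T a i" using ai(2) by simp
      also have "\<dots> \<le> (\<Sum>i\<in>UNIV. ?T a i)" by (rule member_le_sum) auto
      also have "\<dots> \<le> (\<Sum>a\<in>cube (0::int ^ 'd) m. \<Sum>i\<in>UNIV. ?T a i)"
        by (rule member_le_sum[OF ai(1)]) (auto simp: sum_nonneg cube_finite_card(1))
      finally have "1 \<le> (\<Sum>a\<in>cube (0::int ^ 'd) m. \<Sum>i\<in>UNIV. ?T a i)" .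
      moreover have "of_bool b \<le> (1::real)" for b by simp
      ultimately show ?thesis using order_trans by blast
    next
      case False
      have step: "real (cdist A (int h *s u) (int h *s v)) \<le> h / m"
        if uv: "u \<in> cube 0 m" "v \<in> cube 0 m" "lattice_adj u v" for u v
      proof -
        obtain i where i: "v = u + axis i 1 \<or> u = v + axis i 1" using uv(3) unfolding
            lattice_adj_iff by blast
        have "real (cdist A (int h *s w) (int h *s (w + axis i 1))) \<le> h / m" if "w \<in> cube 0 m" for w
        proof -
          have "int h *s (w + axis i 1) = int h *s w + int h *s axis i 1" by (simp add: vec_eq_iff
              algebra_simps)
          then show ?thesis using False that \<eta>(2) by (auto simp: not_less)
        qed
        then show ?thesis using i uv cdist_sym[of A "int h *s u" "int h *s v"] by metis
      qed
      have walk: "real (cdist A (int h *s u) (int h *s v)) \<le> (real (length vs) - 1) * (h / m)"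
        if "lpath vs u v" "set vs \<subseteq> cube 0 m" for vs u v
        using that
      proof (induction vs arbitrary: u)
        case (Cons a vs)
        show ?case
        proof (cases vs)
          case (Cons b vs')
          then have hh: "u = a" "lattice_adj a b" "lpath vs b v" using Cons.prems by (auto simp:
              lpath_Cons_iff)
          have "real (cdist A (int h *s b) (int h *s v)) \<le> (real (length vs) - 1) * (h / m)" using
              Cons.IH hh Cons.prems by auto
          moreover have "real (cdist A (int h *s a) (int h *s b)) \<le> h / m" using step hh Cons
              Cons.prems by auto
          moreover have "real (cdist A (int h *s a) (int h *s v)) \<le> real (cdist A (int h *s a)
              (int h *s b)) + real (cdist A (int h *s b) (int h *s v))"
            using cdist_shiftiangle[of A "int h *s a" "int h *s v" "int h *s b"] by linarith
          ultimately have "real (cdist A (int h *s a) (int h *s v)) \<le> h / m + (real (length vs) -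
              1) * (h / m)" by linarith
          also have "\<dots> = (real (length (a # vs)) - 1) * (h / m)" by (simp add: diff_divide_distrib
              left_diff_distrib)
          finally show ?thesis using hh by simp
        qed (use Cons.prems in simp)
      qed (simp add: lpath_def)
      have "cdist A x y \<le> 4 * CARD('d) * h" if xy: "x \<in> cube 0 (m * h)" "y \<in> cube 0 (m * h)" for x y
      proof -
        define a :: "int ^ 'd" where "a = (\<chi> i. x $ i div int h)"
        define b :: "int ^ 'd" where "b = (\<chi> i. y $ i div int h)"
        have xa: "x \<in> cube (int h *s a) h" and yb: "y \<in> cube (int h *s b) h"
          unfolding a_def b_def by (rule round_cube[OF h0])+
        have a: "\<bar>a $ i\<bar> \<le> int m" and b: "\<bar>b $ i\<bar> \<le> int m" for i
          using xy div_bounds[OF h0, of _ m] by (simp_all add: cube_def a_def b_def)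
        obtain vs where vs: "lpath vs a b" "length vs = l1 a b + 1"
          "\<And>z i. z \<in> set vs \<Longrightarrow> min (a $ i) (b $ i) \<le> z $ i \<and> z $ i \<le> max (a $ i) (b $ i)"
          using mono_path[of a b] by blast
        have "z \<in> cube 0 m" if "z \<in> set vs" for z
        proof -
          have "\<bar>z $ i\<bar> \<le> int m" for i using vs(3)[OF that, of i] a[of i] b[of i] by linarith
          then show ?thesis by (simp add: cube_def)
        qed
        then have "real (cdist A (int h *s a) (int h *s b)) \<le> l1 a b * (h / m)" using walk[OF
            vs(1)] vs(2) by auto
        also have "\<dots> \<le> (CARD('d) * (2 * m)) * (h / m)"
        proof (rule mult_right_mono)
          have "\<bar>a $ i - b $ i\<bar> \<le> int (2 * m)" for i using a[of i] b[of i] by linarith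
          then have "a \<in> cube b (2 * m)" by (simp add: cube_def)
          then show "real (l1 a b) \<le> CARD('d) * (2 * m)" using l1_cube by (metis of_nat_le_iff
              of_nat_mult)
        qed simp
        also have "\<dots> = real (2 * CARD('d) * h)" using m by simp
        finally have ab: "cdist A (int h *s a) (int h *s b) \<le> 2 * CARD('d) * h" by (simp only:
            of_nat_le_iff)
        have "cdist A x y \<le> cdist A x (int h *s a) + (cdist A (int h *s a) (int h *s b) + cdist A
            (int h *s b) y)"
          by (meson cdist_shiftiangle add_left_mono order_trans)
        also have "\<dots> \<le> CARD('d) * h + (2 * CARD('d) * h + CARD('d) * h)"
          using cdist_le_l1[of A x "int h *s a"] cdist_le_l1[of A y "int h *s b"] l1_cube[OF xa]
              l1_cube[OF yb] ab cdist_sym[of A y "int h *s b"]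
          by (intro add_mono) auto
        finally show ?thesis by (simp add: algebra_simps)
      qed
      then have "\<not> (\<exists>x\<in>cube 0 (m * h). \<exists>y\<in>cube 0 (m * h). cdist A x y > 4 * CARD('d) * h)" by
          (meson not_less)
      then have "of_bool (\<exists>x\<in>cube 0 (m * h). \<exists>y\<in>cube 0 (m * h). cdist A x y > 4 * CARD('d) * h) =
          (0::real)" by (simp only: of_bool_eq)
      also have "0 \<le> (\<Sum>a\<in>cube (0::int ^ 'd) m. \<Sum>i\<in>UNIV. ?T a i)" by (intro sum_nonneg) simp
      finally show ?thesis .
    qed
    have "bern p E (\<lambda>A. of_bool (\<exists>x\<in>cube 0 (m * h). \<exists>y\<in>cube 0 (m * h). cdist A x y > 4 * CARD('d)
        * h)) \<le>
      bern p E (\<lambda>A. \<Sum>a\<in>cube (0::int ^ 'd) m. \<Sum>i\<in>UNIV. of_bool (real (cdist A (int h *s a) (int h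
          *s a + int h *s axis i 1)) > 2 * \<eta> * h))"
      by (rule bern_mono[OF p]) (rule incl)
    also have "\<dots> \<le> (\<Sum>a\<in>cube (0::int ^ 'd) m. \<Sum>i\<in>UNIV. C i / h)"
      unfolding bern_sum by (intro sum_mono tail)
    also have "\<dots> = C' / h" unfolding C'_def sum_divide_distrib by (rule refl)
    finally show ?thesis using E by blast
  qed
  then show ?thesis by blast
qed

section \<open>A finite-size criterion for percolation\<close>

definition inner_edges :: "int ^ 'd \<Rightarrow> nat \<Rightarrow> (int ^ 'd) set set" where
  "inner_edges c n = {e \<in> lattice_edges. e \<subseteq> cube c n}"

lemma inner_edges_finite: "finite (inner_edges c n)" for c :: "int ^ 'd::finite"
  by (rule finite_subset[of _ "Pow (cube c n)"]) (auto simp: inner_edges_def cube_finite_card(1))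

lemma inner_edges_sub: "inner_edges c n \<subseteq> lattice_edges"
  by (auto simp: inner_edges_def)

lemma wt_open_walk: "successively (\<lambda>u v. {u, v} \<in> A) vs \<Longrightarrow> wt (closed_ind A) vs = 0"
  by (induction vs rule: induct_list012) (auto simp: closed_ind_def)

lemma crossing_translate:
  fixes c :: "int ^ 'd::finite"
  shows "crossing c n (shift c A) \<longleftrightarrow> crossing 0 n A"
proof -
  have "crossing (b + a) n (shift a A)" if cr: "crossing b n A" for a b :: "int ^ 'd" and A
  proof -
    obtain u v where uv: "u \<in> cube b n" "v \<in> cube b (3 * n + 1) - cube b (3 * n)" "cdist A u v = 0"
      using cr unfolding crossing_def by blast
    then have "u + a \<in> cube (b + a) n" "v + a \<in> cube (b + a) (3 * n + 1) - cube (b + a) (3 * n)"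
      by (auto simp: cube_def)
    then show ?thesis using cdist_shift[of a A u v] uv(3) unfolding crossing_def by metis
  qed
  from this[of 0 A c] this[of c "shift c A" "- c"] show ?thesis by (auto simp: shift_tr)
qed

lemma shift_inner_edges: "shift c (inner_edges 0 n) = inner_edges c n" for c :: "int ^ 'd::finite"
proof -
  have "shift a (inner_edges b n) \<subseteq> inner_edges (b + a) n" for a b :: "int ^ 'd"
  proof
    fix e assume "e \<in> shift a (inner_edges b n)"
    then obtain e' where e': "e = (\<lambda>x. x + a) ` e'" "e' \<in> lattice_edges" "e' \<subseteq> cube b n"
      by (auto simp: shift_def inner_edges_def)
    have "e \<in> lattice_edges" using shift_edges[of "{e'}" a] e' by (simp add: shift_def)
    moreover have "e \<subseteq> cube (b + a) n" using e' by (auto simp: cube_def)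
    ultimately show "e \<in> inner_edges (b + a) n" by (simp add: inner_edges_def)
  qed
  from this[of c 0] this[of "- c" c] show ?thesis
    using shift_mono[of "shift (- c) (inner_edges c n)" "inner_edges 0 n" c] by (auto simp:
        shift_tr)
qed

text \<open>Stopped at its first exit from \<open>cube c (3 * n)\<close>, the path stays in
  \<open>cube c (3 * n + 1)\<close>. The crossing therefore depends on finitely many edges near
  \<open>c\<close>, as independence requires.\<close>

lemma open_path_crossing:
  fixes c :: "int ^ 'd::finite"
  assumes "lpath vs y y'" "successively (\<lambda>u v. {u, v} \<in> Op) vs" "y \<in> cube c n" "y' \<notin> cube c (3 * n)"
  shows "crossing c n (Op \<inter> inner_edges c (3 * n + 1))"
proof -
  have "y' \<in> set vs" using assms(1) by (auto simp: lpath_def)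
  then obtain ps v qs where split: "vs = ps @ v # qs" "v \<notin> cube c (3 * n)" "\<forall>z\<in>set ps. z \<in> cube c
      (3 * n)"
    using split_list_first_prop[of vs "\<lambda>x. x \<notin> cube c (3 * n)"] assms(4) by blast
  have y3: "y \<in> cube c (3 * n)" using assms(3) cube_mono[of n "3 * n" c] by auto
  have "ps \<noteq> []" using split assms(1) y3 by (auto simp: lpath_def)
  then obtain ps' w where ps: "ps = ps' @ [w]" by (cases ps rule: rev_cases) auto
  have path: "lpath (ps @ [v]) y v" using lpath_split(1) assms(1) split(1) by blast
  have wv: "lattice_adj w v" "w \<in> cube c (3 * n)"
    using path split(3) unfolding ps by (auto simp: lpath_def successively_append_iff)
  have "v \<in> cube w 1" using lattice_adj_coord[OF wv(1)] by (auto simp: cube_def abs_minus_commute)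
  then have v: "v \<in> cube c (3 * n + 1)" using cube_trans[OF _ wv(2), of v 1] by simp
  have sub: "set (ps @ [v]) \<subseteq> cube c (3 * n + 1)" using split(3) v cube_mono[of "3 * n" "3 * n +
      1" c] by auto
  have "successively (\<lambda>a b. {a, b} \<in> Op) (ps @ [v])"
    using assms(2) unfolding split by (auto simp: successively_append_iff)
  moreover have "successively lattice_adj (ps @ [v])" using path by (simp add: lpath_def)
  ultimately have "successively (\<lambda>a b. {a, b} \<in> Op \<inter> inner_edges c (3 * n + 1)) (ps @ [v])"
  proof -
    assume h: "successively (\<lambda>a b. {a, b} \<in> Op) (ps @ [v])" "successively lattice_adj (ps @ [v])"
    have "successively (\<lambda>a b. {a, b} \<in> Op \<and> lattice_adj a b) (ps @ [v])"
      using h unfolding successively_conv_nth by blast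
    then show ?thesis
      by (rule successively_mono) (use sub in \<open>auto simp: inner_edges_def lattice_edgesI\<close>)
  qed
  then have "wt (closed_ind (Op \<inter> inner_edges c (3 * n + 1))) (ps @ [v]) = 0" by (rule wt_open_walk)
  then have "cdist (Op \<inter> inner_edges c (3 * n + 1)) y v = 0" using cdist_le[OF path] by (metis
      of_nat_0_eq_iff of_nat_0_le_iff order_antisym)
  then show ?thesis using assms(3) v split(2) unfolding crossing_def by blast
qed

text \<open>The radius is twice that of the boxes on which crossings depend.\<close>

definition far :: "nat \<Rightarrow> int ^ 'd \<Rightarrow> int ^ 'd \<Rightarrow> bool" where
  "far n z z' \<longleftrightarrow> int n *s z' \<notin> cube (int n *s z) (6 * n + 2)"

lemma far_disjoint: "far n z z' \<Longrightarrow> inner_edges (int n *s z) (3 * n + 1) \<inter> inner_edges (int n *s z')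
    (3 * n + 1) = {}"
  for z :: "int ^ 'd::finite"
proof (rule ccontr)
  assume "far n z z'" "inner_edges (int n *s z) (3 * n + 1) \<inter> inner_edges (int n *s z') (3 * n +
      1) \<noteq> {}"
  then obtain e where "e \<in> lattice_edges" "e \<subseteq> cube (int n *s z) (3 * n + 1)" "e \<subseteq> cube (int n *s
      z') (3 * n + 1)"
    by (auto simp: inner_edges_def)
  then obtain u where u: "u \<in> cube (int n *s z) (3 * n + 1)" "u \<in> cube (int n *s z') (3 * n + 1)"
    using lattice_edges_finite by blast
  then have "int n *s z' \<in> cube (int n *s z) ((3 * n + 1) + (3 * n + 1))"
    using cube_trans[of "int n *s z'" u "3 * n + 1" "int n *s z" "3 * n + 1"] cube_sym by blast
  then show False using \<open>far n z z'\<close> by (simp add: far_def mult_2[symmetric])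
qed

text \<open>The site \<open>z\<close> stands for the centre \<open>n z\<close>. Centres that are far apart have annuli without
    common
  edges. A step leads to the grid point next to the exit from \<open>cube (n z) (7 n + 2)\<close>, which lies
  within \<open>8 n + 3 \<le> 11 n\<close>.\<close>

definition coarse_walks :: "nat \<Rightarrow> nat \<Rightarrow> int ^ 'd \<Rightarrow> (int ^ 'd) list set" where
  "coarse_walks n K z = {zs. length zs = K \<and> (K > 0 \<longrightarrow> hd zs = z) \<and>
     successively (\<lambda>a b. b \<in> cube a 11) zs \<and> sorted_wrt (far n) zs}"

text \<open>Each step has at most \<open>23 = 2 * 11 + 1\<close> choices per coordinate.\<close>

lemma coarse_walks_card:
  fixes z :: "int ^ 'd::finite"
  shows "finite (coarse_walks n K z) \<and> card (coarse_walks n K z) \<le> (23 ^ CARD('d)) ^ K"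
proof (induction K arbitrary: z)
  case 0
  have "coarse_walks n 0 z = {[]}" by (auto simp: coarse_walks_def)
  then show ?case by simp
next
  case (Suc K)
  let ?U = "\<Union>b\<in>cube z 11. (#) z ` coarse_walks n K b"
  have sub: "coarse_walks n (Suc K) z \<subseteq> ?U"
  proof
    fix zs assume zs: "zs \<in> coarse_walks n (Suc K) z"
    then obtain zs' where zs': "zs = z # zs'" by (cases zs) (auto simp: coarse_walks_def)
    show "zs \<in> ?U"
    proof (cases zs')
      case Nil
      then have "K = 0" using zs zs' by (auto simp: coarse_walks_def)
      then have "zs \<in> (#) z ` coarse_walks n K z" using zs zs' Nil by (auto simp: coarse_walks_def)
      then show ?thesis using cube_self[of z 11] by blast
    next
      case (Cons b zs'')
      then have "b \<in> cube z 11" "zs' \<in> coarse_walks n K b" using zs zs' by (auto simp: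
          coarse_walks_def)
      then show ?thesis using zs' by blast
    qed
  qed
  have fin: "finite ?U" using Suc.IH cube_finite_card(1) by blast
  have "card (coarse_walks n (Suc K) z) \<le> card ?U" using sub fin by (rule_tac card_mono)
  also have "\<dots> \<le> (\<Sum>b\<in>cube z 11. card ((#) z ` coarse_walks n K b))" by (rule card_UN_le[OF
      cube_finite_card(1)])
  also have "\<dots> \<le> (\<Sum>b\<in>cube z 11. (23 ^ CARD('d)) ^ K)"
    using Suc.IH card_image_le order_trans by (intro sum_mono) blast
  also have "\<dots> \<le> 23 ^ CARD('d) * (23 ^ CARD('d)) ^ K"
    using cube_finite_card(2)[of z 11] by simp
  finally show ?case using finite_subset[OF sub fin] by simp
qed

text \<open>The path is cut at its last visit to \<open>cube (n z) (7 n + 2)\<close>. Everything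
  later stays outside, and every later centre is within \<open>n\<close> of a later path vertex,
  hence farther than \<open>6 n + 2\<close>. The last conjunct carries this through the induction;
  \<open>20 * n\<close> generously covers one step.\<close>

lemma open_path_coarse_walk:
  fixes z :: "int ^ 'd::finite"
  assumes n: "n \<ge> 1"
  shows "K \<ge> 1 \<Longrightarrow> lpath vs y y' \<Longrightarrow> successively (\<lambda>u v. {u, v} \<in> Op) vs \<Longrightarrow> y \<in> cube (int n *s z) n \<Longrightarrow>
     y' \<notin> cube (int n *s z) (K * (20 * n)) \<Longrightarrow>
     \<exists>zs\<in>coarse_walks n K z. \<forall>z\<in>set zs. crossing (int n *s z) n (Op \<inter> inner_edges (int n *s z) (3
         * n + 1)) \<and>
        (\<exists>u\<in>set vs. u \<in> cube (int n *s z) n)"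
proof (induction K arbitrary: vs y z)
  case (Suc K)
  let ?c = "int n *s z"
  have far3: "y' \<notin> cube ?c (3 * n)" "y' \<notin> cube ?c (7 * n + 2)"
    using Suc.prems(5) cube_mono[of "3 * n" "Suc K * (20 * n)" ?c] cube_mono[of "7 * n + 2" "Suc K
        * (20 * n)" ?c] n by auto
  have cr: "crossing ?c n (Op \<inter> inner_edges ?c (3 * n + 1))"
    by (rule open_path_crossing[OF Suc.prems(2,3,4) far3(1)])
  have yvs: "y \<in> set vs" using Suc.prems(2) by (auto simp: lpath_def)
  show ?case
  proof (cases "K = 0")
    case True
    have "[z] \<in> coarse_walks n (Suc K) z" using True by (simp add: coarse_walks_def)
    then show ?thesis using cr yvs Suc.prems(4) by (intro bexI[of _ "[z]"]) auto
  next
    case False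
    have "y \<in> cube ?c (7 * n + 2)" using Suc.prems(4) cube_mono[of n "7 * n + 2" ?c] by auto
    then obtain ps c qs where split: "vs = ps @ c # qs" "c \<in> cube ?c (7 * n + 2)" "\<forall>x\<in>set qs. x \<notin>
        cube ?c (7 * n + 2)"
      using split_list_last_prop[of vs "\<lambda>x. x \<in> cube ?c (7 * n + 2)"] yvs by blast
    have "qs \<noteq> []" using split far3(2) Suc.prems(2) by (auto simp: lpath_def)
    then obtain y1 qs' where qs: "qs = y1 # qs'" by (cases qs) auto
    have adj: "lattice_adj c y1" and lq: "lpath qs y1 y'"
      using Suc.prems(2) lpath_split(2)[of ps c qs y y'] unfolding split qs by (auto simp:
          lpath_Cons_iff)
    have oq: "successively (\<lambda>u v. {u, v} \<in> Op) qs"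
      using Suc.prems(3) unfolding split by (auto simp: successively_append_iff successively_Cons)
    define z1 :: "int ^ 'd" where "z1 = (\<chi> i. y1 $ i div int n)"
    let ?c1 = "int n *s z1"
    have y1c: "y1 \<in> cube ?c1 n" unfolding z1_def by (rule round_cube[OF n])
    have "y1 \<in> cube c 1" using lattice_adj_coord[OF adj] by (auto simp: cube_def abs_minus_commute)
    then have "y1 \<in> cube ?c (1 + (7 * n + 2))" using cube_trans split(2) by blast
    then have c1c: "?c1 \<in> cube ?c (n + (1 + (7 * n + 2)))" using cube_trans y1c cube_sym by blast
    have z1z: "z1 \<in> cube z 11"
    proof -
      have "\<bar>z1 $ i - z $ i\<bar> \<le> 11" for i
      proof -
        have "int n * \<bar>z1 $ i - z $ i\<bar> = \<bar>?c1 $ i - ?c $ i\<bar>" by (simp add: abs_mult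
            right_diff_distrib[symmetric])
        also have "\<dots> \<le> int (n + (1 + (7 * n + 2)))" using c1c unfolding cube_def by blast
        also have "\<dots> \<le> int n * 11" using n by simp
        finally show ?thesis using n by (simp add: mult_le_cancel_left)
      qed
      then show ?thesis by (simp add: cube_def)
    qed
    have y'1: "y' \<notin> cube ?c1 (K * (20 * n))"
    proof
      assume "y' \<in> cube ?c1 (K * (20 * n))"
      then have "y' \<in> cube ?c (K * (20 * n) + (n + (1 + (7 * n + 2))))" using cube_trans c1c by
          blast
      moreover have "K * (20 * n) + (n + (1 + (7 * n + 2))) \<le> Suc K * (20 * n)" using n by simp
      ultimately show False using Suc.prems(5) cube_mono by blast
    qed
    have "K \<ge> 1" using False by simp
    then obtain zs where zs: "zs \<in> coarse_walks n K z1"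
      "\<And>z. z \<in> set zs \<Longrightarrow> crossing (int n *s z) n (Op \<inter> inner_edges (int n *s z) (3 * n + 1))"
      "\<And>z. z \<in> set zs \<Longrightarrow> \<exists>u\<in>set qs. u \<in> cube (int n *s z) n"
      using Suc.IH[OF _ lq oq y1c y'1] by blast
    have "far n z z'" if z': "z' \<in> set zs" for z'
    proof -
      obtain u where u: "u \<in> set qs" "u \<in> cube (int n *s z') n" using zs(3)[OF z'] by blast
      have "u \<in> cube ?c (n + (6 * n + 2))" if "int n *s z' \<in> cube ?c (6 * n + 2)" using
          cube_trans[OF u(2) that] .
      moreover have "n + (6 * n + 2) = 7 * n + 2" by simp
      ultimately show ?thesis using split(3) u(1) unfolding far_def by auto
    qed
    then have "z # zs \<in> coarse_walks n (Suc K) z" using zs(1) z1z False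
      by (cases zs) (auto simp: coarse_walks_def)
    moreover have "\<exists>u\<in>set vs. u \<in> cube (int n *s z') n" if "z' \<in> set (z # zs)" for z'
      using that zs(3)[of z'] yvs Suc.prems(4) split(1) by auto
    ultimately show ?thesis using cr zs(2) by (intro bexI[of _ "z # zs"]) auto
  qed
qed simp

text \<open>Pairwise far centres have edge-disjoint boxes, so the crossings are independent, and by
  translation they have equal probability.\<close>

lemma bern_crossing_walk:
  fixes zs :: "(int ^ 'd::finite) list"
  assumes "sorted_wrt (far n) zs" "finite E" "(\<Union>z\<in>set zs. inner_edges (int n *s z) (3 * n + 1)) \<subseteq> E"
  shows "bern p E (\<lambda>A. of_bool (\<forall>z\<in>set zs. crossing (int n *s z) n (A \<inter> inner_edges (int n *s z)
      (3 * n + 1)))) =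
    bern p (inner_edges 0 (3 * n + 1)) (\<lambda>A. of_bool (crossing (0::int ^ 'd) n A)) ^ length zs"
  using assms(1,3)
proof (induction zs)
  case Nil
  then show ?case using assms(2) by (simp add: bern_const)
next
  case (Cons z zs)
  define I where "I z = inner_edges (int n *s z) (3 * n + 1)" for z :: "int ^ 'd"
  define J where "J = (\<Union>z\<in>set zs. I z)"
  have disj: "I z \<inter> J = {}" using Cons.prems(1) far_disjoint unfolding J_def I_def by fastforce
  have sub: "I z \<subseteq> E" "J \<subseteq> E" using Cons.prems(2) by (auto simp: J_def I_def)
  have fJ: "(\<forall>z\<in>set zs. crossing (int n *s z) n (A \<inter> J \<inter> I z)) = (\<forall>z\<in>set zs. crossing (int n *s z)
      n (A \<inter> I z))" for A
  proof (rule ball_cong[OF refl])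
    fix z' assume "z' \<in> set zs"
    then have "A \<inter> J \<inter> I z' = A \<inter> I z'" by (auto simp: J_def)
    then show "crossing (int n *s z') n (A \<inter> J \<inter> I z') = crossing (int n *s z') n (A \<inter> I z')" by
        simp
  qed
  have IH: "bern p E (\<lambda>A. of_bool (\<forall>z\<in>set zs. crossing (int n *s z) n (A \<inter> I z))) =
    bern p (inner_edges 0 (3 * n + 1)) (\<lambda>A. of_bool (crossing (0::int ^ 'd) n A)) ^ length zs"
    using Cons unfolding I_def by auto
  have "bern p E (\<lambda>A. of_bool (\<forall>z\<in>set (z # zs). crossing (int n *s z) n (A \<inter> I z))) =
     bern p E (\<lambda>A. of_bool (crossing (int n *s z) n (A \<inter> I z)) *
       (\<lambda>B. of_bool (\<forall>z\<in>set zs. crossing (int n *s z) n (B \<inter> I z))) (A \<inter> J))"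
    by (rule bern_cong) (simp add: fJ of_bool_conj)
  also have "\<dots> = bern p (I z) (\<lambda>A. of_bool (crossing (int n *s z) n A)) *
       bern p J (\<lambda>B. of_bool (\<forall>z\<in>set zs. crossing (int n *s z) n (B \<inter> I z)))"
    using sub disj by (intro bern_indep_sub[OF assms(2)]) auto
  also have "bern p J (\<lambda>B. of_bool (\<forall>z\<in>set zs. crossing (int n *s z) n (B \<inter> I z))) =
      bern p E (\<lambda>A. of_bool (\<forall>z\<in>set zs. crossing (int n *s z) n (A \<inter> J \<inter> I z)))"
    by (rule bern_restrict[OF assms(2) sub(2), symmetric])
  also have "\<dots> = bern p E (\<lambda>A. of_bool (\<forall>z\<in>set zs. crossing (int n *s z) n (A \<inter> I z)))"
    by (rule bern_cong) (simp add: fJ)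
  also have "bern p (I z) (\<lambda>A. of_bool (crossing (int n *s z) n A)) =
      bern p (inner_edges 0 (3 * n + 1)) (\<lambda>A. of_bool (crossing (0::int ^ 'd) n A))"
    unfolding I_def shift_inner_edges[of "int n *s z", symmetric] bern_shift crossing_translate ..
  finally show ?case unfolding IH I_def[symmetric] by simp
qed

text \<open>An infinite cluster leaves every box and so produces a coarse walk of every length
  \<open>K\<close> with all annuli crossed. The union bound over such walks decays
  geometrically.\<close>

lemma finite_size_criterion:
  fixes q :: real
  assumes q: "0 \<le> q" "q \<le> 1" and n: "n \<ge> 1"
    and s: "23 ^ CARD('d) * bern q (inner_edges 0 (3 * n + 1)) (\<lambda>A. of_bool (crossing (0::int ^
        'd::finite) n A)) < 1"
  shows "percolation_prob TYPE('d) q = 0"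
proof -
  define \<sigma> where "\<sigma> = bern q (inner_edges 0 (3 * n + 1)) (\<lambda>A. of_bool (crossing (0::int ^ 'd) n A))"
  have \<sigma>0: "\<sigma> \<ge> 0" unfolding \<sigma>_def
    using bern_mono[OF q, of "inner_edges 0 (3 * n + 1)" "\<lambda>_. 0" "\<lambda>A. of_bool (crossing (0::int ^
        'd) n A)"]
    by (simp add: bern_const[OF inner_edges_finite])
  define N where "N = (bond_percolation q :: ((int ^ 'd) set \<Rightarrow> bool) measure)"
  interpret N: prob_space N unfolding N_def bond_percolation_def
    by (intro prob_space_PiM prob_space_measure_pmf)
  \<comment> \<open>The joint law of the coordinates is \<open>N\<close> itself, the product of
    their marginals.\<close>
  have indep: "N.indep_vars (\<lambda>_. count_space UNIV) (\<lambda>e \<omega>. \<omega> e) lattice_edges"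
  proof -
    have "distr N (\<Pi>\<^sub>M e\<in>lattice_edges. measure_pmf (bernoulli_pmf q)) (\<lambda>x. \<lambda>e\<in>lattice_edges. x e)
        =
      distr N N (\<lambda>x. x)"
      unfolding N_def bond_percolation_def
      by (rule distr_cong) (auto simp: space_PiM PiE_def extensional_restrict)
    also have "\<dots> = (\<Pi>\<^sub>M e\<in>lattice_edges. distr N (measure_pmf (bernoulli_pmf q)) (\<lambda>\<omega>. \<omega> e))"
      unfolding N_def bond_percolation_def
      by (subst distr_id2, simp, rule PiM_cong[OF refl], rule distr_PiM_component[symmetric])
        (auto simp: prob_space_measure_pmf)
    finally have "N.indep_vars (\<lambda>_. measure_pmf (bernoulli_pmf q)) (\<lambda>e \<omega>. \<omega> e) lattice_edges"
      by (subst N.indep_vars_iff_distr_eq_PiM'[OF lattice_edges_nonempty]) (auto simp: N_def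
          bond_percolation_def)
    then show ?thesis by (simp add: N.indep_vars_def cong: measurable_cong_sets)
  qed
  have marg: "N.prob {\<omega> \<in> space N. \<omega> e \<in> {True}} = q" if e: "e \<in> lattice_edges" for e
  proof -
    have "measure (distr N (measure_pmf (bernoulli_pmf q)) (\<lambda>\<omega>. \<omega> e)) {True} = q"
      unfolding N_def bond_percolation_def
      by (subst distr_PiM_component[OF _ e]) (use q in \<open>auto simp: prob_space_measure_pmf
          measure_pmf_single\<close>)
    moreover have "(\<lambda>\<omega>. \<omega> e) \<in> measurable N (measure_pmf (bernoulli_pmf q))"
      unfolding N_def bond_percolation_def by (rule measurable_component_singleton[OF e])
    ultimately show ?thesis by (subst (asm) measure_distr) (auto simp: vimage_def Int_def
        conj_commute)
  qed
  define op where "op \<omega> = {e \<in> lattice_edges. \<omega> e}" for \<omega> :: "(int ^ 'd) set \<Rightarrow> bool"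
  let ?inf = "{\<omega> \<in> space N. infinite (open_cluster \<omega> (0 :: int ^ 'd))}"
  have bound: "measure N ?inf \<le> (23 ^ CARD('d) * \<sigma>) ^ K" if K: "K \<ge> 1" for K
  proof -
    define L where "L = coarse_walks n K (0::int ^ 'd)"
    define I where "I z = inner_edges (int n *s z) (3 * n + 1)" for z :: "int ^ 'd"
    define E where "E = (\<Union>zs\<in>L. \<Union>z\<in>set zs. I z)"
    define Q where "Q zs A = (\<forall>z\<in>set zs. crossing (int n *s z) n (A \<inter> I z))" for zs A
    have L: "finite L" "card L \<le> (23 ^ CARD('d)) ^ K" unfolding L_def using coarse_walks_card by
        blast+
    have E: "finite E" "E \<subseteq> lattice_edges" unfolding E_def I_def using L(1) inner_edges_finite
        inner_edges_sub by blast+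
    define V where "V zs = {\<omega> \<in> space N. Q zs {e \<in> E. \<omega> e \<in> {True}}}" for zs
    have V: "V zs \<in> sets N" "measure N (V zs) = bern q E (\<lambda>A. of_bool (Q zs A))" for zs
      unfolding V_def using N.prob_bern[OF indep E(2,1), of "{True}" q "Q zs"] marg E(2) by auto
    have "?inf \<subseteq> (\<Union>zs\<in>L. V zs)"
    proof
      fix \<omega> assume w: "\<omega> \<in> ?inf"
      then have "\<not> open_cluster \<omega> 0 \<subseteq> cube 0 (K * (20 * n))" using finite_subset
          cube_finite_card(1) by blast
      then obtain y' where y': "y' \<in> open_cluster \<omega> 0" "y' \<notin> cube 0 (K * (20 * n))" by blast
      have "\<exists>vs. lpath vs 0 y' \<and> successively (\<lambda>u v. {u, v} \<in> op \<omega>) vs"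
      proof -
        have "(0, y') \<in> {(u, v). lattice_adj u v \<and> \<omega> {u, v}}\<^sup>*" using y'(1) by (simp add:
            open_cluster_def)
        then show ?thesis
        proof (induction rule: converse_rtrancl_induct)
          case base
          then show ?case by (intro exI[of _ "[y']"]) simp
        next
          case (step a b)
          then obtain vs where vs: "lpath vs b y'" "successively (\<lambda>u v. {u, v} \<in> op \<omega>) vs" by blast
          then have "lpath (a # vs) a y'" using step by (intro lpath_Cons) auto
          moreover have "{a, b} \<in> op \<omega>" using step by (auto simp: op_def lattice_edgesI)
          then have "successively (\<lambda>u v. {u, v} \<in> op \<omega>) (a # vs)" using vs by (auto simp:
              successively_Cons lpath_def)
          ultimately show ?case by blast
        qed
      qed
      then obtain vs where vs: "lpath vs 0 y'" "successively (\<lambda>u v. {u, v} \<in> op \<omega>) vs" by blast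
      obtain zs where zs: "zs \<in> L" "\<forall>z\<in>set zs. crossing (int n *s z) n (op \<omega> \<inter> I z)"
        using open_path_coarse_walk[OF n K vs, of 0] y'(2) unfolding L_def I_def by auto
      have "Q zs {e \<in> E. \<omega> e \<in> {True}}"
        unfolding Q_def
      proof
        fix z assume z: "z \<in> set zs"
        have "op \<omega> \<inter> I z \<subseteq> {e \<in> E. \<omega> e \<in> {True}} \<inter> I z" using z zs(1) by (auto simp: op_def E_def)
        then show "crossing (int n *s z) n ({e \<in> E. \<omega> e \<in> {True}} \<inter> I z)" using zs(2) z
            crossing_mono by blast
      qed
      then show "\<omega> \<in> (\<Union>zs\<in>L. V zs)" using zs(1) w by (auto simp: V_def)
    qed
    then have "measure N ?inf \<le> measure N (\<Union>zs\<in>L. V zs)" using V(1) L(1) by (intro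
        N.finite_measure_mono) auto
    also have "\<dots> \<le> (\<Sum>zs\<in>L. measure N (V zs))" using V(1) L(1) by (intro
        N.finite_measure_subadditive_finite) auto
    also have "\<dots> = (\<Sum>zs\<in>L. \<sigma> ^ K)"
    proof (rule sum.cong)
      fix zs assume zs: "zs \<in> L"
      then have "sorted_wrt (far n) zs" "length zs = K" by (auto simp: L_def coarse_walks_def)
      then show "measure N (V zs) = \<sigma> ^ K" unfolding V(2) Q_def I_def \<sigma>_def
        using bern_crossing_walk[OF _ E(1), of n zs q] zs by (auto simp: E_def I_def)
    qed simp
    also have "\<dots> \<le> (23 ^ CARD('d)) ^ K * \<sigma> ^ K"
      using of_nat_mono[OF L(2), where 'a = real] \<sigma>0 by (simp add: mult_right_mono)
    finally show ?thesis by (simp add: power_mult_distrib)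
  qed
  have "(\<lambda>K. (23 ^ CARD('d) * \<sigma>) ^ K) \<longlonglongrightarrow> 0"
    using s \<sigma>0 unfolding \<sigma>_def[symmetric] by (intro LIMSEQ_realpow_zero) auto
  then have "measure N ?inf \<le> 0"
    by (rule LIMSEQ_le_const) (use bound in auto)
  then show ?thesis unfolding percolation_prob_def N_def by (simp add: measure_le_0_iff)
qed

text \<open>A crossing probability below the threshold stays below it at some \<open>q > p\<close>,
  by continuity of a polynomial. There the criterion excludes percolation, so \<open>q\<close> is at
  most the supremum defining \<open>critical_prob\<close>, against
  \<open>critical_prob \<le> p < q\<close>.\<close>

lemma crossing_at_critical:
  assumes p: "0 \<le> p" "p \<le> 1" "critical_prob TYPE('d::finite) \<le> p" and n: "n \<ge> 1"
  shows "1 / 23 ^ CARD('d) \<le> bern p (inner_edges 0 (3 * n + 1)) (\<lambda>A. of_bool (crossing (0::int ^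
      'd) n A))"
proof (rule ccontr)
  let ?f = "\<lambda>q. 23 ^ CARD('d) * bern q (inner_edges 0 (3 * n + 1)) (\<lambda>A. of_bool (crossing (0::int
      ^ 'd) n A))"
  assume "\<not> ?thesis"
  then have lt: "?f p < 1" by (simp add: field_simps)
  show False
  proof (cases "p = 1")
    \<comment> \<open>There is no admissible \<open>q\<close> above 1, but with all edges open a
      crossing is certain.\<close>
    case True
    have "crossing (0::int ^ 'd) n (inner_edges 0 (3 * n + 1))"
    proof -
      define y :: "int ^ 'd" where "y = (\<chi> i. int (3 * n + 1))"
      obtain vs where vs: "lpath vs 0 y" using mono_path by blast
      then have sc: "successively (\<lambda>u v. {u, v} \<in> lattice_edges) vs"
        unfolding lpath_def by (simp add: lattice_edges_pair)
      have "crossing (0::int ^ 'd) n (lattice_edges \<inter> inner_edges 0 (3 * n + 1))"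
        by (rule open_path_crossing[OF vs sc]) (auto simp: y_def cube_def)
      then show ?thesis using crossing_mono by blast
    qed
    then have "?f p = 23 ^ CARD('d)" using True by (simp add: bern_one[OF inner_edges_finite])
    moreover have "(1::real) \<le> 23 ^ CARD('d)" by simp
    ultimately show False using lt by linarith
  next
    case False
    have "isCont ?f p" by (intro continuous_intros bern_isCont)
    then have "(?f \<longlongrightarrow> ?f p) (at_right p)" unfolding isCont_def by (rule filterlim_mono[OF _
        order_refl at_le]) simp
    then have "\<forall>\<^sub>F q in at_right p. ?f q < 1" using lt by (rule order_tendstoD(2))
    moreover have "\<forall>\<^sub>F q in at_right p. q < 1 \<and> p < q" using False p
      by (subst eventually_at_right[of p 1]) (auto intro!: exI[of _ 1])
    ultimately have "\<forall>\<^sub>F q in at_right p. ?f q < 1 \<and> q < 1 \<and> p < q" by eventually_elim auto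
    then obtain q where q: "?f q < 1" "q < 1" "p < q" using eventually_happens by fastforce
    then have "percolation_prob TYPE('d) q = 0" using p by (intro finite_size_criterion[OF _ _ n])
        auto
    then have "q \<le> critical_prob TYPE('d)" unfolding critical_prob_def using q p
      by (intro cSup_upper) (auto intro!: bdd_aboveI[of _ 1])
    then show False using q p by simp
  qed
qed

text \<open>The crossing argument gives a vanishing time constant along some axis; a permutation of
  coordinates carries it to every axis.\<close>

lemma zero_time_constant:
  fixes p \<eta> :: real and i :: "'d::finite"
  assumes p: "0 \<le> p" "p \<le> 1" "critical_prob TYPE('d) \<le> p" and \<eta>: "\<eta> > 0"
  shows "\<exists>n E. n \<ge> 1 \<and> finite E \<and> E \<subseteq> lattice_edges \<and> mdist p E 0 (int n *s axis i 1) < \<eta> * real n"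
proof -
  have "\<exists>E::(int ^ 'd) set set. finite E \<and> E \<subseteq> lattice_edges \<and>
      1 / 23 ^ CARD('d) \<le> bern p E (\<lambda>A. of_bool (crossing 0 n A))" if "n \<ge> 1" for n
    by (intro exI[of _ "inner_edges 0 (3 * n + 1)"] conjI inner_edges_finite inner_edges_sub
        crossing_at_critical[OF p that])
  then have "\<exists>(j::'d) n E. n \<ge> 1 \<and> finite E \<and> E \<subseteq> lattice_edges \<and> mdist p E 0 (int n *s axis j 1)
      < \<eta> * real n"
    by (intro crossing_imp_zero_time_constant[OF p(1,2) _ \<eta>, of "1 / 23 ^ CARD('d)"]) simp_all
  then obtain j :: 'd and n E where jnE: "n \<ge> 1" "finite E" "E \<subseteq> lattice_edges" "mdist p E 0 (int
      n *s axis j 1) < \<eta> * real n"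
    by (elim exE conjE) (rule that)
  obtain E' where "finite E'" "E' \<subseteq> lattice_edges" "mdist p E' 0 (int n *s axis i 1) = mdist p E 0
      (int n *s axis j 1)"
    using mdist_axis_swap[where E = E and i = j and j = i and p = p and c = "int n"] jnE(2,3) by
        blast
  then show ?thesis using jnE by metis
qed

section \<open>Bad clusters are small\<close>

text \<open>Lattice animals with several roots: each component must meet \<open>S\<close>. They need
  not be connected because a walk meets many clusters, whose total size has to be bounded at
  once.\<close>

definition animals :: "(int ^ 'd) set \<Rightarrow> nat \<Rightarrow> (int ^ 'd) set set" where
  "animals S m = {Y. finite Y \<and> card Y = m \<and> (\<forall>y\<in>Y. \<exists>s\<in>S \<inter> Y. conn Y s y)}"

text \<open>Either a connection avoids \<open>v\<close>, or its part after the last visit to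
  \<open>v\<close> starts at a neighbour of \<open>v\<close>.\<close>

lemma conn_remove:
  assumes "conn Y s y" "y \<noteq> v"
  shows "(s \<noteq> v \<and> conn (Y - {v}) s y) \<or> (\<exists>u\<in>Y - {v}. lattice_adj v u \<and> conn (Y - {v}) u y)"
proof -
  have "y \<noteq> v \<longrightarrow> (s \<noteq> v \<and> conn (Y - {v}) s y) \<or> (\<exists>u\<in>Y - {v}. lattice_adj v u \<and> conn (Y - {v}) u y)"
    using assms(1)
  proof (induction rule: conn_induct)
    case (step y z)
    show ?case
    proof
      assume z: "z \<noteq> v"
      show "(s \<noteq> v \<and> conn (Y - {v}) s z) \<or> (\<exists>u\<in>Y - {v}. lattice_adj v u \<and> conn (Y - {v}) u z)"
      proof (cases "y = v")
        case True
        then show ?thesis using step z conn_refl[of z "Y - {v}"] by blast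
      next
        case False
        then have "conn (Y - {v}) y z" using step z by (intro conn_adj) auto
        then show ?thesis using step.IH False conn_trans by blast
      qed
    qed
  qed (auto intro: conn_refl)
  then show ?thesis using assms(2) by blast
qed

text \<open>An animal without \<open>v\<close> is rooted in the remaining roots. One with
  \<open>v\<close> becomes, after deleting \<open>v\<close>, a smaller animal with at most
  \<open>3 ^ CARD('d)\<close> additional roots, the vertices of \<open>cube v 1\<close>. The base
  \<open>2 ^ 3 ^ CARD('d)\<close> makes both alternatives contribute equally, so that a new root
  doubles the bound.\<close>

lemma animals_card:
  fixes S :: "(int ^ 'd::finite) set"
  assumes "finite S"
  shows "finite (animals S m) \<and> card (animals S m) \<le> 2 ^ card S * (2 ^ 3 ^ CARD('d)) ^ m"
  using assms
proof (induction m arbitrary: S)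
  case 0
  have "animals S 0 \<subseteq> {{}}" by (auto simp: animals_def)
  then show ?case using card_mono[of "{{}}" "animals S 0"] finite_subset[of "animals S 0" "{{}}"]
    by (auto intro: order_trans)
next
  case (Suc m)
  let ?C = "2 ^ 3 ^ CARD('d) :: nat"
  show ?case using Suc.prems
  proof (induction S rule: finite_induct)
    case empty
    have "animals {} (Suc m) = ({} :: (int ^ 'd) set set)" by (auto simp: animals_def)
    then show ?case by simp
  next
    case (insert v S)
    let ?S' = "S \<union> cube v 1"
    have finS': "finite ?S'" using insert cube_finite_card(1) by blast
    have sub: "animals (insert v S) (Suc m) \<subseteq> animals S (Suc m) \<union> insert v ` animals ?S' m"
    proof
      fix Y assume Y: "Y \<in> animals (insert v S) (Suc m)"
      show "Y \<in> animals S (Suc m) \<union> insert v ` animals ?S' m"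
      proof (cases "v \<in> Y")
        case False
        then have "insert v S \<inter> Y = S \<inter> Y" by auto
        then show ?thesis using Y by (auto simp: animals_def)
      next
        case True
        have "\<exists>s\<in>?S' \<inter> (Y - {v}). conn (Y - {v}) s y" if y: "y \<in> Y - {v}" for y
        proof -
          obtain s where s: "s \<in> insert v S \<inter> Y" "conn Y s y" using Y y by (auto simp: animals_def)
          from conn_remove[OF s(2), of v] y
          consider "s \<noteq> v" "conn (Y - {v}) s y" | u where "u \<in> Y - {v}" "lattice_adj v u" "conn (Y
              - {v}) u y" by blast
          then show ?thesis
          proof cases
            case 1
            then show ?thesis using s(1) by blast
          next
            case (2 u)
            then have "u \<in> cube v 1" using lattice_adj_coord[OF 2(2)] by (auto simp: cube_def
                abs_minus_commute)
            then show ?thesis using 2 by blast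
          qed
        qed
        then have "Y - {v} \<in> animals ?S' m" using Y True by (auto simp: animals_def)
        moreover have "Y = insert v (Y - {v})" using True by auto
        ultimately show ?thesis by blast
      qed
    qed
    have fin: "finite (animals S (Suc m) \<union> insert v ` animals ?S' m)" using insert.IH Suc.IH[OF
        finS'] by blast
    have "card (animals (insert v S) (Suc m)) \<le> card (animals S (Suc m) \<union> insert v ` animals ?S' m)"
      by (rule card_mono[OF fin sub])
    also have "\<dots> \<le> card (animals S (Suc m)) + card (insert v ` animals ?S' m)" by (rule card_Un_le)
    also have "\<dots> \<le> card (animals S (Suc m)) + card (animals ?S' m)"
      using Suc.IH[OF finS'] by (intro add_left_mono card_image_le) blast
    also have "\<dots> \<le> 2 ^ card S * ?C ^ Suc m + 2 ^ (card S + 3 ^ CARD('d)) * ?C ^ m"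
    proof (rule add_mono)
      show "card (animals S (Suc m)) \<le> 2 ^ card S * ?C ^ Suc m" using insert.IH by blast
      have "card ?S' \<le> card S + card (cube v 1)" by (rule card_Un_le)
      then have "card ?S' \<le> card S + 3 ^ CARD('d)" using cube_finite_card(2)[of v 1] by simp
      then have "(2::nat) ^ card ?S' \<le> 2 ^ (card S + 3 ^ CARD('d))" by (intro power_increasing) auto
      then have "2 ^ card ?S' * ?C ^ m \<le> 2 ^ (card S + 3 ^ CARD('d)) * ?C ^ m" by (rule
          mult_right_mono) simp
      then show "card (animals ?S' m) \<le> 2 ^ (card S + 3 ^ CARD('d)) * ?C ^ m" using Suc.IH[OF
          finS'] by linarith
    qed
    also have "\<dots> = 2 ^ card (insert v S) * ?C ^ Suc m" using insert by (simp add: power_add)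
    finally show ?case using finite_subset[OF sub fin] by blast
  qed
qed

text \<open>As long as \<open>Y\<close> does not exhaust the clusters, a walk in \<open>B\<close>
  from a root to a missing vertex starts outside \<open>Y\<close> or leaves it, and provides a
  vertex to add. Conversely, if no animal of size \<open>m\<close> lies in \<open>B\<close>, the
  rooted clusters are finite with fewer than \<open>m\<close> vertices in total.\<close>

lemma exists_animal:
  assumes "infinite (\<Union>v\<in>S \<inter> B. cluster B v) \<or> m \<le> card (\<Union>v\<in>S \<inter> B. cluster B v)"
  shows "\<exists>Y\<in>animals S m. Y \<subseteq> B"
  using assms
proof (induction m)
  case 0
  have "{} \<in> animals S 0" by (simp add: animals_def)
  then show ?case by blast
next
  case (Suc m)
  let ?W = "\<Union>v\<in>S \<inter> B. cluster B v"
  obtain Y where Y: "Y \<in> animals S m" "Y \<subseteq> B" using Suc by force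
  then have finY: "finite Y" "card Y = m" by (auto simp: animals_def)
  have "\<not> ?W \<subseteq> Y" using Suc.prems finY card_mono[of Y ?W] finite_subset[of ?W Y] by auto
  then obtain w v where w: "w \<notin> Y" "v \<in> S" "v \<in> B" "conn B v w" by (auto simp: cluster_def)
  have ext: "\<exists>Y\<in>animals S (Suc m). Y \<subseteq> B" if b: "b \<in> B" "b \<notin> Y" "b \<in> S \<or> (\<exists>a\<in>Y. lattice_adj a b)"
      for b
  proof -
    have old: "\<exists>s\<in>S \<inter> insert b Y. conn (insert b Y) s y" if "y \<in> Y" for y
    proof -
      obtain s where "s \<in> S \<inter> Y" "conn Y s y" using Y(1) \<open>y \<in> Y\<close> by (auto simp: animals_def)
      then show ?thesis using conn_mono[of Y s y "insert b Y"] by blast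
    qed
    have new: "\<exists>s\<in>S \<inter> insert b Y. conn (insert b Y) s b"
    proof (cases "b \<in> S")
      case True
      then show ?thesis using conn_refl[of b "insert b Y"] by blast
    next
      case False
      then obtain a where a: "a \<in> Y" "lattice_adj a b" using b by blast
      then have "conn (insert b Y) a b" by (intro conn_adj) auto
      then show ?thesis using old[OF a(1)] conn_trans by blast
    qed
    have "insert b Y \<in> animals S (Suc m)" unfolding animals_def using finY b(2) old new by auto
    then show ?thesis using Y(2) b(1) by blast
  qed
  show ?case
  proof (cases "v \<in> Y")
    case False
    then show ?thesis using ext w by blast
  next
    case True
    have "w \<notin> Y \<longrightarrow> (\<exists>a\<in>Y. \<exists>b\<in>B - Y. lattice_adj a b)"
      using w(4) by (induction rule: conn_induct) (use True in auto)
    then show ?thesis using ext w(1) by blast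
  qed
qed

lemma bad_iff: "v \<in> bad t M \<longleftrightarrow> (\<exists>e\<in>inner_edges v 1. t e > M)"
  by (auto simp: bad_def inner_edges_def)

text \<open>Given the set of open edges in \<open>E\<close>, each edge exceeds \<open>b\<close> with probability at most \<open>c\<close>,
  independently of the others.\<close>

lemma (in prob_space) bad_pattern:
  fixes \<tau> :: "(int ^ 'd::finite) set \<Rightarrow> 'a \<Rightarrow> real"
  assumes ind: "indep_vars (\<lambda>_. borel) \<tau> lattice_edges"
    and tail: "\<And>e. e \<in> lattice_edges \<Longrightarrow> prob {\<omega> \<in> space M. \<tau> e \<omega> > b} \<le> c * prob {\<omega> \<in> space M. \<tau> e
        \<omega> > 0}"
    and b: "0 \<le> b" and c: "0 \<le> c" and E: "finite E" "E \<subseteq> lattice_edges" and F: "finite F" "F \<subseteq>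
        lattice_edges"
    and A: "A \<subseteq> E"
  shows "prob {\<omega> \<in> space M. {e \<in> E. \<tau> e \<omega> \<le> 0} = A \<and> (\<forall>e\<in>F. \<tau> e \<omega> > b)} \<le>
      prob {\<omega> \<in> space M. {e \<in> E. \<tau> e \<omega> \<le> 0} = A} * c ^ card F"
    and "{\<omega> \<in> space M. {e \<in> E. \<tau> e \<omega> \<le> 0} = A \<and> (\<forall>e\<in>F. \<tau> e \<omega> > b)} \<in> events"
    and "{\<omega> \<in> space M. {e \<in> E. \<tau> e \<omega> \<le> 0} = A} \<in> events"
proof -
  define S' where "S' e = (if e \<in> E then (if e \<in> A then {..0} else {0<..}) else (UNIV :: real
      set))" for e
  define S where "S e = S' e \<inter> (if e \<in> F then {b<..} else UNIV)" for e
  have EF: "finite (E \<union> F)" "E \<union> F \<subseteq> lattice_edges" using E F by auto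
  have b': "S' e \<in> sets borel" "S e \<in> sets borel" for e by (auto simp: S_def S'_def)
  have eq': "{\<omega> \<in> space M. {e \<in> E. \<tau> e \<omega> \<le> 0} = A} = {\<omega> \<in> space M. \<forall>e\<in>E \<union> F. \<tau> e \<omega> \<in> S' e}"
  proof (intro Collect_cong conj_cong refl iffI ballI)
    fix \<omega> e assume "{e \<in> E. \<tau> e \<omega> \<le> 0} = A" "e \<in> E \<union> F"
    then show "\<tau> e \<omega> \<in> S' e" by (auto simp: S'_def not_le)
  next
    fix \<omega> assume h: "\<forall>e\<in>E \<union> F. \<tau> e \<omega> \<in> S' e"
    have "\<tau> e \<omega> \<le> 0 \<longleftrightarrow> e \<in> A" if "e \<in> E" for e using bspec[OF h, of e] that by (auto simp: S'_def
        split: if_splits)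
    then show "{e \<in> E. \<tau> e \<omega> \<le> 0} = A" using A by auto
  qed
  have eq: "{\<omega> \<in> space M. {e \<in> E. \<tau> e \<omega> \<le> 0} = A \<and> (\<forall>e\<in>F. \<tau> e \<omega> > b)} = {\<omega> \<in> space M. \<forall>e\<in>E \<union> F. \<tau>
      e \<omega> \<in> S e}"
  proof -
    have "{\<omega> \<in> space M. {e \<in> E. \<tau> e \<omega> \<le> 0} = A \<and> (\<forall>e\<in>F. \<tau> e \<omega> > b)} =
      {\<omega> \<in> space M. (\<forall>e\<in>E \<union> F. \<tau> e \<omega> \<in> S' e) \<and> (\<forall>e\<in>F. \<tau> e \<omega> > b)}" using eq' by blast
    then show ?thesis by (auto simp: S_def)
  qed
  note pat = indep_pattern[OF ind EF(2,1)]
  show "{\<omega> \<in> space M. {e \<in> E. \<tau> e \<omega> \<le> 0} = A \<and> (\<forall>e\<in>F. \<tau> e \<omega> > b)} \<in> events" unfolding eq by (rule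
      pat(2)) (rule b')
  show "{\<omega> \<in> space M. {e \<in> E. \<tau> e \<omega> \<le> 0} = A} \<in> events" unfolding eq' by (rule pat(2)) (rule b')
  have m: "\<tau> e \<in> borel_measurable M" if "e \<in> lattice_edges" for e using ind that by (auto simp:
      indep_vars_def)
  have ev: "{\<omega> \<in> space M. \<tau> e \<omega> \<in> T} \<in> events" if "e \<in> lattice_edges" "T \<in> sets borel" for e T
    using measurable_sets[OF m[OF that(1)] that(2)] by (simp add: vimage_def Int_def conj_commute)
  have "prob {\<omega> \<in> space M. \<tau> e \<omega> \<in> S e} \<le> (if e \<in> F then c else 1) * prob {\<omega> \<in> space M. \<tau> e \<omega> \<in> S'
      e}" if e: "e \<in> E \<union> F" for e
  proof (cases "e \<in> F")
    case False
    then show ?thesis by (simp add: S_def)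
  next
    case True
    have el: "e \<in> lattice_edges" using True F by auto
    consider "e \<in> A" | "e \<notin> A" by blast
    then show ?thesis
    proof cases
      \<comment> \<open>An open edge has weight at most 0 and cannot exceed
        \<open>b\<close>.\<close>
      case 1
      then have "{\<omega> \<in> space M. \<tau> e \<omega> \<in> S e} = {}" using A b True by (auto simp: S_def S'_def)
      then have "prob {\<omega> \<in> space M. \<tau> e \<omega> \<in> S e} = 0" by (simp only: measure_empty)
      then show ?thesis using True c by simp
    next
      \<comment> \<open>The edge is closed or undetermined; in both cases \<open>S' e\<close>
        contains the positive reals, whose probability appears in \<open>tail\<close>.\<close>
      case 2
      have "prob {\<omega> \<in> space M. \<tau> e \<omega> \<in> S e} \<le> prob {\<omega> \<in> space M. \<tau> e \<omega> > b}"
        using ev[OF el, of "{b<..}"] True by (intro finite_measure_mono) (auto simp: S_def)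
      also have "\<dots> \<le> c * prob {\<omega> \<in> space M. \<tau> e \<omega> > 0}" by (rule tail[OF el])
      also have "\<dots> \<le> c * prob {\<omega> \<in> space M. \<tau> e \<omega> \<in> S' e}"
        using ev[OF el b'(1)[of e]] 2 c by (intro mult_left_mono finite_measure_mono) (auto simp:
            S'_def)
      finally show ?thesis using True by simp
    qed
  qed
  then have "(\<Prod>e\<in>E \<union> F. prob {\<omega> \<in> space M. \<tau> e \<omega> \<in> S e}) \<le>
      (\<Prod>e\<in>E \<union> F. (if e \<in> F then c else 1) * prob {\<omega> \<in> space M. \<tau> e \<omega> \<in> S' e})"
    by (intro prod_mono) auto
  also have "\<dots> = (\<Prod>e\<in>E \<union> F. (if e \<in> F then c else 1)) * (\<Prod>e\<in>E \<union> F. prob {\<omega> \<in> space M. \<tau> e \<omega> \<in> S'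
      e})"
    by (rule prod.distrib)
  also have "(\<Prod>e\<in>E \<union> F. (if e \<in> F then c else 1)) = (\<Prod>e\<in>F. c)"
    using EF(1) by (intro prod.mono_neutral_cong_right) auto
  finally show "prob {\<omega> \<in> space M. {e \<in> E. \<tau> e \<omega> \<le> 0} = A \<and> (\<forall>e\<in>F. \<tau> e \<omega> > b)} \<le>
      prob {\<omega> \<in> space M. {e \<in> E. \<tau> e \<omega> \<le> 0} = A} * c ^ card F"
    unfolding eq eq' pat(1)[OF b'(1)] pat(1)[OF b'(2)] by (simp add: mult.commute)
qed

lemma card_inner_edges_1: "card (inner_edges v 1) \<le> 2 ^ 3 ^ CARD('d)" for v :: "int ^ 'd::finite"
proof -
  have "inner_edges v 1 \<subseteq> Pow (cube v 1)" by (auto simp: inner_edges_def)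
  then have "card (inner_edges v 1) \<le> card (Pow (cube v 1))" using cube_finite_card(1) by (intro
      card_mono) auto
  also have "\<dots> = 2 ^ card (cube v 1)" by (rule card_Pow[OF cube_finite_card(1)])
  also have "\<dots> \<le> 2 ^ 3 ^ CARD('d)" using cube_finite_card(2)[of v 1] by (intro power_increasing)
      auto
  finally show ?thesis .
qed

text \<open>An edge lies in the unit cubes of at most \<open>3 ^ CARD('d)\<close> vertices. So
  \<open>m\<close> bad vertices produce at least \<open>m / 3 ^ CARD('d)\<close> distinct heavy
  edges, which accounts for the exponent on \<open>bad_rate\<close> in the tail hypotheses.\<close>

lemma card_edge_choice:
  fixes Y :: "(int ^ 'd::finite) set"
  assumes "finite Y" "\<And>v. v \<in> Y \<Longrightarrow> f v \<in> inner_edges v 1"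
  shows "card Y \<le> 3 ^ CARD('d) * card (f ` Y)"
proof -
  have small: "card {v \<in> Y. f v = e} \<le> 3 ^ CARD('d)" if e: "e \<in> f ` Y" for e
  proof -
    obtain u where u: "u \<in> e" using e assms(2) lattice_edges_finite by (fastforce simp:
        inner_edges_def)
    have "{v \<in> Y. f v = e} \<subseteq> cube u 1" using assms(2) u cube_sym by (fastforce simp:
        inner_edges_def)
    then have "card {v \<in> Y. f v = e} \<le> card (cube u 1)" using cube_finite_card(1) by (intro
        card_mono)
    then show ?thesis using cube_finite_card(2)[of u 1] by simp
  qed
  have "Y = (\<Union>e\<in>f ` Y. {v \<in> Y. f v = e})" by auto
  then have "card Y \<le> (\<Sum>e\<in>f ` Y. card {v \<in> Y. f v = e})" using card_UN_le[of "f ` Y" "\<lambda>e. {v \<in> Y.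
      f v = e}"] assms(1) by simp
  also have "\<dots> \<le> (\<Sum>e\<in>f ` Y. 3 ^ CARD('d))" by (rule sum_mono) (rule small)
  finally show ?thesis by (simp add: mult.commute)
qed

text \<open>One factor \<open>2 ^ 3 ^ d\<close> pays for the choice of the animal, the other for the choice of a
    heavy edge
  near each of its vertices.\<close>

definition bad_rate :: "'d::finite itself \<Rightarrow> real" where
  "bad_rate _ = 1 / (4 * 2 ^ 3 ^ CARD('d) * 2 ^ 3 ^ CARD('d))"

text \<open>The roots may depend on the open edges of \<open>E\<close>, as they will be read off an
  optimal walk; therefore the open set \<open>A\<close> is fixed first. Animals and edge choices
  give \<open>2 ^ 3 ^ CARD('d)\<close> to the power \<open>m\<close> each, and
  \<open>bad_rate ^ m\<close> leaves \<open>1 / 4 ^ m\<close>.\<close>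

lemma (in prob_space) bad_animal_prob:
  fixes \<tau> :: "(int ^ 'd::finite) set \<Rightarrow> 'a \<Rightarrow> real"
  assumes ind: "indep_vars (\<lambda>_. borel) \<tau> lattice_edges"
    and tail: "\<And>e. e \<in> lattice_edges \<Longrightarrow>
      prob {\<omega> \<in> space M. \<tau> e \<omega> > b} \<le> bad_rate TYPE('d) ^ 3 ^ CARD('d) * prob {\<omega> \<in> space M. \<tau> e \<omega>
          > 0}"
    and b: "0 \<le> b" and E: "finite E" "E \<subseteq> lattice_edges"
    and S: "\<And>A. A \<subseteq> E \<Longrightarrow> finite (S A)" "\<And>A. A \<subseteq> E \<Longrightarrow> card (S A) \<le> s"
  shows "prob {\<omega> \<in> space M. \<exists>Y\<in>animals (S {e \<in> E. \<tau> e \<omega> \<le> 0}) m. Y \<subseteq> bad (\<lambda>e. \<tau> e \<omega>) b} \<le> 2 ^ s /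
      4 ^ m" (is "prob ?G \<le> _")
    and "{\<omega> \<in> space M. \<exists>Y\<in>animals (S {e \<in> E. \<tau> e \<omega> \<le> 0}) m. Y \<subseteq> bad (\<lambda>e. \<tau> e \<omega>) b} \<in> events"
proof -
  let ?N = "3 ^ CARD('d)"
  define R where "R A = {\<omega> \<in> space M. {e \<in> E. \<tau> e \<omega> \<le> 0} = A}" for A
  define V where "V A F = {\<omega> \<in> space M. {e \<in> E. \<tau> e \<omega> \<le> 0} = A \<and> (\<forall>e\<in>F. \<tau> e \<omega> > b)}" for A F
  \<comment> \<open>A choice of one edge near every vertex of \<open>Y\<close> turns badness of
    \<open>Y\<close> into a finite union of patterns.\<close>
  define ch where "ch Y = (PiE Y (\<lambda>v. inner_edges v 1))" for Y :: "(int ^ 'd) set"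
  have bad_rate: "0 \<le> bad_rate TYPE('d)" "bad_rate TYPE('d) \<le> 1"
  proof -
    have "(1::real) \<le> 4 * 2 ^ 3 ^ CARD('d) * 2 ^ 3 ^ CARD('d)"
      by (rule order_trans[of _ "4 * 1 * 1"], simp, intro mult_mono) auto
    then show "0 \<le> bad_rate TYPE('d)" "bad_rate TYPE('d) \<le> 1" by (simp_all add: bad_rate_def)
  qed
  have chF: "finite (f ` Y) \<and> f ` Y \<subseteq> lattice_edges" if "finite Y" "f \<in> ch Y" for Y f
    using that inner_edges_sub by (fastforce simp: ch_def PiE_def Pi_def)
  have ch: "finite (ch Y)" "card (ch Y) \<le> (2 ^ ?N) ^ card Y" if "finite Y" for Y
  proof -
    show "finite (ch Y)" unfolding ch_def using that inner_edges_finite by (intro finite_PiE) auto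
    have "card (ch Y) = (\<Prod>v\<in>Y. card (inner_edges v 1))" unfolding ch_def using that by (rule
        card_PiE)
    also have "\<dots> \<le> (\<Prod>v\<in>Y. 2 ^ ?N)" using card_inner_edges_1 by (intro prod_mono) auto
    finally show "card (ch Y) \<le> (2 ^ ?N) ^ card Y" by simp
  qed
  have Vev: "V A (f ` Y) \<in> events" "prob (V A (f ` Y)) \<le> prob (R A) * bad_rate TYPE('d) ^ card Y"
    if "A \<subseteq> E" "finite Y" "f \<in> ch Y" for A f Y
  proof -
    note fY = chF[OF that(2,3)]
    have k3: "0 \<le> bad_rate TYPE('d) ^ ?N" using bad_rate by simp
    show "V A (f ` Y) \<in> events" unfolding V_def
      using bad_pattern(2)[OF ind tail b k3 E _ _ that(1)] fY by blast
    have "prob (V A (f ` Y)) \<le> prob (R A) * (bad_rate TYPE('d) ^ ?N) ^ card (f ` Y)" unfolding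
        V_def R_def
      using bad_pattern(1)[OF ind tail b k3 E _ _ that(1)] fY by blast
    also have "\<dots> \<le> prob (R A) * bad_rate TYPE('d) ^ card Y"
    proof (rule mult_left_mono)
      have "card Y \<le> ?N * card (f ` Y)" using that by (intro card_edge_choice) (auto simp: ch_def
          PiE_def Pi_def)
      then show "(bad_rate TYPE('d) ^ ?N) ^ card (f ` Y) \<le> bad_rate TYPE('d) ^ card Y"
        unfolding power_mult[symmetric] by (intro power_decreasing bad_rate)
    qed simp
    finally show "prob (V A (f ` Y)) \<le> prob (R A) * bad_rate TYPE('d) ^ card Y" .
  qed
  define W where "W A = (\<Union>Y\<in>animals (S A) m. \<Union>f\<in>ch Y. V A (f ` Y))" for A
  have an: "finite Y" "card Y = m" if "Y \<in> animals (S A) m" for Y A using that by (auto simp: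
      animals_def)
  have G: "?G = (\<Union>A\<in>Pow E. W A)"
  proof -
    have iff: "Y \<subseteq> bad (\<lambda>e. \<tau> e \<omega>) b \<longleftrightarrow> (\<exists>f\<in>ch Y. \<forall>e\<in>f ` Y. \<tau> e \<omega> > b)" for Y \<omega>
    proof
      assume "Y \<subseteq> bad (\<lambda>e. \<tau> e \<omega>) b"
      then have "\<forall>v\<in>Y. \<exists>e. e \<in> inner_edges v 1 \<and> \<tau> e \<omega> > b" by (auto simp: bad_iff subset_iff)
      then obtain f where "\<forall>v\<in>Y. f v \<in> inner_edges v 1 \<and> \<tau> (f v) \<omega> > b" by metis
      then show "\<exists>f\<in>ch Y. \<forall>e\<in>f ` Y. \<tau> e \<omega> > b" by (intro bexI[of _ "restrict f Y"]) (auto simp: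
          ch_def)
    next
      assume "\<exists>f\<in>ch Y. \<forall>e\<in>f ` Y. \<tau> e \<omega> > b"
      then show "Y \<subseteq> bad (\<lambda>e. \<tau> e \<omega>) b" by (fastforce simp: bad_iff ch_def PiE_def Pi_def)
    qed
    show ?thesis
    proof (intro set_eqI iffI)
      fix \<omega> assume w: "\<omega> \<in> ?G"
      define A where "A = {e \<in> E. \<tau> e \<omega> \<le> 0}"
      obtain Y f where Y: "Y \<in> animals (S A) m" "f \<in> ch Y" "\<forall>e\<in>f ` Y. \<tau> e \<omega> > b"
        using w unfolding iff A_def by blast
      then have "\<omega> \<in> V A (f ` Y)" using w by (simp add: V_def A_def)
      then have "\<omega> \<in> W A" unfolding W_def using Y(1,2) by blast
      moreover have "A \<in> Pow E" by (auto simp: A_def)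
      ultimately show "\<omega> \<in> (\<Union>A\<in>Pow E. W A)" by blast
    next
      fix \<omega> assume "\<omega> \<in> (\<Union>A\<in>Pow E. W A)"
      then obtain A Y f where "Y \<in> animals (S A) m" "f \<in> ch Y" "\<omega> \<in> V A (f ` Y)" unfolding W_def
          by blast
      then show "\<omega> \<in> ?G" unfolding V_def iff by blast
    qed
  qed
  have Wev: "W A \<in> events" if "A \<subseteq> E" for A
    unfolding W_def using animals_card[OF S(1)[OF that]] an ch(1) Vev(1)[OF that]
    by (intro sets.finite_UN) auto
  show "?G \<in> events" unfolding G using E(1) Wev by (intro sets.finite_UN) auto
  have Wp: "prob (W A) \<le> prob (R A) * (2 ^ s / 4 ^ m)" if A: "A \<subseteq> E" for A
  proof -
    have inner: "prob (\<Union>f\<in>ch Y. V A (f ` Y)) \<le> (2 ^ ?N) ^ m * (prob (R A) * bad_rate TYPE('d) ^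
        m)" if Y: "Y \<in> animals (S A) m" for Y
    proof -
      have "prob (\<Union>f\<in>ch Y. V A (f ` Y)) \<le> (\<Sum>f\<in>ch Y. prob (V A (f ` Y)))"
        using ch(1)[OF an(1)[OF Y]] Vev(1)[OF A an(1)[OF Y]] by (intro
            finite_measure_subadditive_finite) auto
      also have "\<dots> \<le> (\<Sum>f\<in>ch Y. prob (R A) * bad_rate TYPE('d) ^ m)"
        using Vev(2)[OF A an(1)[OF Y]] an(2)[OF Y] by (intro sum_mono) auto
      also have "\<dots> = real (card (ch Y)) * (prob (R A) * bad_rate TYPE('d) ^ m)" by simp
      also have "\<dots> \<le> real ((2 ^ ?N) ^ m) * (prob (R A) * bad_rate TYPE('d) ^ m)"
        using ch(2)[OF an(1)[OF Y]] an(2)[OF Y] bad_rate by (intro mult_right_mono of_nat_mono) auto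
      finally show ?thesis by simp
    qed
    have "prob (W A) \<le> (\<Sum>Y\<in>animals (S A) m. prob (\<Union>f\<in>ch Y. V A (f ` Y)))"
      unfolding W_def using animals_card[OF S(1)[OF A]] an ch(1) Vev(1)[OF A]
      by (intro finite_measure_subadditive_finite) (auto intro!: sets.finite_UN)
    also have "\<dots> \<le> (\<Sum>Y\<in>animals (S A) m. (2 ^ ?N) ^ m * (prob (R A) * bad_rate TYPE('d) ^ m))"
      by (rule sum_mono) (rule inner)
    also have "\<dots> = real (card (animals (S A) m)) * ((2 ^ ?N) ^ m * (prob (R A) * bad_rate TYPE('d)
        ^ m))" by simp
    also have "\<dots> \<le> (2 ^ s * (2 ^ ?N) ^ m) * ((2 ^ ?N) ^ m * (prob (R A) * bad_rate TYPE('d) ^ m))"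
    proof (rule mult_right_mono)
      have "card (animals (S A) m) \<le> 2 ^ card (S A) * (2 ^ ?N) ^ m" using animals_card[OF S(1)[OF
          A]] by blast
      also have "\<dots> \<le> 2 ^ s * (2 ^ ?N) ^ m" using S(2)[OF A] by (intro mult_right_mono
          power_increasing) auto
      finally have "real (card (animals (S A) m)) \<le> real (2 ^ s * (2 ^ ?N) ^ m)" by (rule
          of_nat_mono)
      then show "real (card (animals (S A) m)) \<le> 2 ^ s * (2 ^ ?N) ^ m" by simp
    qed (use bad_rate in auto)
    also have "\<dots> = prob (R A) * (2 ^ s * (2 ^ ?N * 2 ^ ?N * bad_rate TYPE('d)) ^ m)" by (simp add:
        power_mult_distrib mult_ac)
    also have "2 ^ ?N * 2 ^ ?N * bad_rate TYPE('d) = 1 / 4" by (simp add: bad_rate_def field_simps)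
    finally show ?thesis by (simp add: power_divide)
  qed
  have "prob ?G \<le> (\<Sum>A\<in>Pow E. prob (W A))" unfolding G
    using E(1) Wev by (intro finite_measure_subadditive_finite) auto
  also have "\<dots> \<le> (\<Sum>A\<in>Pow E. prob (R A) * (2 ^ s / 4 ^ m))" using Wp by (intro sum_mono) auto
  also have "\<dots> = (\<Sum>A\<in>Pow E. prob (R A)) * (2 ^ s / 4 ^ m)" by (rule sum_distrib_right[symmetric])
  finally have GR: "prob ?G \<le> (\<Sum>A\<in>Pow E. prob (R A)) * (2 ^ s / 4 ^ m)" .
  \<comment> \<open>The possible open sets form disjoint events, so no factor is lost by fixing
    \<open>A\<close>.\<close>
  have "(\<Sum>A\<in>Pow E. prob (R A)) = prob (\<Union>A\<in>Pow E. R A)"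
  proof (rule finite_measure_finite_Union[symmetric])
    show "R ` Pow E \<subseteq> events" unfolding R_def
      using bad_pattern(3)[OF ind tail b _ E _ _, of "{}"] bad_rate by auto
  qed (use E in \<open>auto simp: disjoint_family_on_def R_def\<close>)
  also have "\<dots> \<le> 1" by simp
  finally have "(\<Sum>A\<in>Pow E. prob (R A)) * (2 ^ s / 4 ^ m) \<le> 1 * (2 ^ s / 4 ^ m)"
    by (intro mult_right_mono) auto
  then show "prob ?G \<le> 2 ^ s / 4 ^ m" using GR by simp
qed

section \<open>Geodesics\<close>

text \<open>The roots from which bad clusters are explored: heavy edges of the walk are among its
  closed ones, so the number of roots is twice the cost of the walk instead of its length.\<close>

fun closed_ends :: "'v set set \<Rightarrow> 'v list \<Rightarrow> 'v list" where
  "closed_ends A [] = []"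
| "closed_ends A [x] = []"
| "closed_ends A (x # y # vs) = (if {x, y} \<in> A then [] else [x, y]) @ closed_ends A (y # vs)"

lemma length_closed_ends: "real (length (closed_ends A vs)) = 2 * wt (closed_ind A) vs"
  by (induction A vs rule: closed_ends.induct) (auto simp: closed_ind_def)

lemma closed_ends_successively:
  "set (closed_ends A vs) \<subseteq> X \<Longrightarrow> successively (\<lambda>u v. {u, v} \<in> A \<or> u \<in> X \<and> v \<in> X) vs"
  by (induction A vs rule: closed_ends.induct) (auto split: if_splits)

lemma infinite_lattice: "infinite (UNIV :: (int ^ 'd::finite) set)"
proof -
  have "inj (\<lambda>n::nat. (\<chi> i. int n) :: int ^ 'd)" by (auto simp: inj_def vec_eq_iff)
  then have "infinite (range (\<lambda>n::nat. (\<chi> i. int n) :: int ^ 'd))" by (rule range_inj_infinite)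
  then show ?thesis by (meson finite_subset subset_UNIV)
qed

lemma cluster_small:
  assumes "v \<in> B" "\<forall>Y\<in>animals {v} r. \<not> Y \<subseteq> B"
  shows "finite (cluster B v)" "card (cluster B v) < r"
proof -
  have "(\<Union>v'\<in>{v} \<inter> B. cluster B v') = cluster B v" using assms(1) by auto
  then have "\<not> (infinite (cluster B v) \<or> r \<le> card (cluster B v))"
    using exists_animal[where S = "{v}" and B = B and m = r] assms(2) by auto
  then show "finite (cluster B v)" "card (cluster B v) < r" by auto
qed

text \<open>The deterministic part of a good scale. The parameter \<open>mm\<close> bounds the total
  size of the clusters charged to one walk, and \<open>r\<close> the size of a single cluster, hence
  the size of the region it can enclose.\<close>

lemma connection_scale:
  fixes t :: "(int ^ 'd::finite) set \<Rightarrow> real" and mm :: nat and b c :: real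
  assumes d2: "CARD('d) \<ge> 2" and b0: "0 \<le> b" and finX: "finite X" and A: "\<And>e. e \<in> A \<Longrightarrow> t e \<le> 0"
    and \<pi>: "\<And>x y. x \<in> X \<Longrightarrow> y \<in> X \<Longrightarrow> lpath (\<pi> x y) x y" "\<And>x y. x \<in> X \<Longrightarrow> y \<in> X \<Longrightarrow> wt (closed_ind A) (\<pi> x
        y) \<le> c"
    and an: "\<And>x y. x \<in> X \<Longrightarrow> y \<in> X \<Longrightarrow> \<forall>Y\<in>animals (set (closed_ends A (\<pi> x y))) mm. \<not> Y \<subseteq> bad t b"
    and sm: "\<And>x y v. x \<in> X \<Longrightarrow> y \<in> X \<Longrightarrow> v \<in> set (closed_ends A (\<pi> x y)) \<Longrightarrow> \<forall>Y\<in>animals {v} r. \<not> Y \<subseteq> bad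
        t b"
  shows "\<exists>safe. (\<forall>x\<in>X. \<forall>y\<in>X. safe x \<longrightarrow> safe y \<longrightarrow> reach t x y (b * c + 9 ^ CARD('d) * CARD('d) * b *
      mm)) \<and>
    (\<forall>vs. successively lattice_adj vs \<longrightarrow> distinct vs \<longrightarrow> length vs > (4 * r + 1) ^ CARD('d) \<longrightarrow>
        (\<exists>i<length vs. safe (vs ! i)))"
proof -
  define B where "B = bad t b"
  define V where "V = (\<Union>x\<in>X. \<Union>y\<in>X. set (closed_ends A (\<pi> x y)))"
  define \<C> where "\<C> = cluster B ` (V \<inter> B)"
  have finV: "finite V" using finX by (simp add: V_def)
  \<comment> \<open>The vertex \<open>w\<close> taken outside these cubes serves as infinity for all
    clusters of this scale.\<close>
  have "finite (\<Union>v\<in>V. cube v r)" using finV cube_finite_card(1) by blast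
  then obtain w where w: "w \<notin> (\<Union>v\<in>V. cube v r)" using ex_new_if_finite[OF infinite_lattice] by blast
  have clus: "finite (cluster B v)" "card (cluster B v) < r" if "v \<in> V" "v \<in> B" for v
    using cluster_small[OF that(2), of r] sm that(1) by (auto simp: V_def B_def)
  have con: "conn C u v" if "C \<in> \<C>" "u \<in> C" "v \<in> C" for C u v
    using that cluster_connected by (auto simp: \<C>_def)
  have sep: "C = C'" if "C \<in> \<C>" "C' \<in> \<C>" "u \<in> C" "v \<in> C'" "u = v \<or> lattice_adj u v" for C C' u v
    using that cluster_eq unfolding \<C>_def by blast
  \<comment> \<open>Safety refers to the clusters of all pairs together, so it is a property of the
    vertex alone; the family of a single pair is a subfamily.\<close>
  define safe where "safe x \<longleftrightarrow> (\<forall>C\<in>\<C>. conn (- C) x w)" for x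
  have "\<exists>i<length vs. safe (vs ! i)"
    if vs: "successively lattice_adj vs" "distinct vs" "length vs > (4 * r + 1) ^ CARD('d)" for vs
    unfolding safe_def
  proof (rule safe_vertex[OF con sep _ vs])
    fix C assume C: "C \<in> \<C>"
    then obtain v where v: "v \<in> V" "v \<in> B" "C = cluster B v" by (auto simp: \<C>_def)
    have "{x. \<not> conn (- C) x w} \<subseteq> cube v r"
      using clus[OF v(1,2)] cluster_self[OF v(2)] w v(1) con[OF C]
      by (intro enclosed_in_cube[OF d2]) (auto simp: v(3))
    then show "\<exists>v. {x. \<not> conn (- C) x w} \<subseteq> cube v r" by blast
  qed
  moreover have "reach t x y (b * c + 9 ^ CARD('d) * CARD('d) * b * mm)"
    if xy: "x \<in> X" "y \<in> X" "safe x" "safe y" for x y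
  proof -
    define S where "S = set (closed_ends A (\<pi> x y))"
    \<comment> \<open>Clusters met only along open edges are left out: such edges weigh at most 0
      and can be used even when they run through bad vertices.\<close>
    define \<C>' where "\<C>' = cluster B ` (S \<inter> B)"
    have SV: "S \<subseteq> V" using xy unfolding S_def V_def by blast
    then have sub: "\<C>' \<subseteq> \<C>" by (auto simp: \<C>'_def \<C>_def)
    have fin': "finite \<C>'" by (simp add: \<C>'_def S_def)
    have finC: "finite C" if "C \<in> \<C>'" for C using that clus(1) SV by (auto simp: \<C>'_def)
    have inU: "u \<in> \<Union>\<C>'" if "u \<in> S" "u \<in> B" for u using that cluster_self unfolding \<C>'_def by blast
    have step: "t {u, v} \<le> b * closed_ind A {u, v}"
      if h: "lattice_adj u v" "{u, v} \<in> A \<or> u \<in> S \<and> v \<in> S" "u \<notin> \<Union>\<C>'" for u v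
    proof (cases "{u, v} \<in> A")
      case True
      then show ?thesis using A by (simp add: closed_ind_def)
    next
      case False
      then have "u \<notin> B" using h inU by blast
      moreover have "v \<in> cube u 1" using lattice_adj_coord[OF h(1)] by (auto simp: cube_def
          abs_minus_commute)
      ultimately have "\<not> t {u, v} > b" using lattice_edgesI[OF h(1)] by (auto simp: B_def bad_def)
      then show ?thesis using False by (simp add: closed_ind_def)
    qed
    have succ: "successively (\<lambda>u v. u \<notin> \<Union>\<C>' \<longrightarrow> v \<notin> \<Union>\<C>' \<longrightarrow> t {u, v} \<le> b * closed_ind A {u, v}) (\<pi> x y)"
    proof -
      have "successively (\<lambda>u v. {u, v} \<in> A \<or> u \<in> S \<and> v \<in> S) (\<pi> x y)" by (rule
          closed_ends_successively) (simp add: S_def)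
      moreover have "successively lattice_adj (\<pi> x y)" using \<pi>(1)[OF xy(1,2)] by (simp add:
          lpath_def)
      ultimately have "successively (\<lambda>u v. lattice_adj u v \<and> ({u, v} \<in> A \<or> u \<in> S \<and> v \<in> S)) (\<pi> x y)"
        unfolding successively_conv_nth by blast
      then show ?thesis by (rule successively_mono) (use step in blast)
    qed
    have "reach t x y (b * wt (closed_ind A) (\<pi> x y) + 9 ^ CARD('d) * CARD('d) * b * (\<Sum>C | C \<in> \<C>'
        \<and> C \<inter> set (\<pi> x y) \<noteq> {}. real (card C)))"
    proof (rule detour_walk[where w = w])
      show "outer_bd C \<inter> bad t b = {}" if "C \<in> \<C>'" for C
        using that cluster_outer_bd[of B] by (auto simp: \<C>'_def B_def)
      show "C = C'" if "C \<in> \<C>'" "C' \<in> \<C>'" "u \<in> C" "v \<in> C'" "u = v \<or> lattice_adj u v" for C C' u v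
        using sep that sub by blast
      show "conn C u v" if "C \<in> \<C>'" "u \<in> C" "v \<in> C" for C u v using con that sub by blast
      show "conn (- C) y w" "conn (- C) x w" if "C \<in> \<C>'" for C using xy(3,4) that sub unfolding
          safe_def by blast+
    qed (use fin' finC b0 closed_ind_nonneg \<pi>(1)[OF xy(1,2)] succ in auto)
    moreover have "(\<Sum>C | C \<in> \<C>' \<and> C \<inter> set (\<pi> x y) \<noteq> {}. real (card C)) \<le> mm"
    proof -
      have "(\<Sum>C | C \<in> \<C>' \<and> C \<inter> set (\<pi> x y) \<noteq> {}. card C) \<le> (\<Sum>C\<in>\<C>'. card C)"
        using fin' by (intro sum_mono2) auto
      also have "\<dots> = card (\<Union>\<C>')"
      proof (rule card_Union_disjoint[symmetric])
        have "C \<inter> C' = {}" if "C \<in> \<C>'" "C' \<in> \<C>'" "C \<noteq> C'" for C C'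
          using sep[of C C'] that sub by blast
        then show "pairwise disjnt \<C>'" by (simp add: pairwise_def disjnt_def)
      qed (rule finC)
      also have "\<dots> \<le> mm"
      proof -
        have "\<Union>\<C>' = (\<Union>v\<in>S \<inter> B. cluster B v)" by (auto simp: \<C>'_def)
        then have "mm \<le> card (\<Union>\<C>') \<Longrightarrow> \<exists>Y\<in>animals S mm. Y \<subseteq> B"
          using exists_animal[where S = S and B = B and m = mm] by simp
        moreover have "\<not> (\<exists>Y\<in>animals S mm. Y \<subseteq> B)" using an[OF xy(1,2)] unfolding S_def B_def by
            blast
        ultimately show ?thesis by linarith
      qed
      finally have "real (\<Sum>C | C \<in> \<C>' \<and> C \<inter> set (\<pi> x y) \<noteq> {}. card C) \<le> real mm" by (simp only:
          of_nat_le_iff)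
      then show ?thesis by simp
    qed
    then have "9 ^ CARD('d) * CARD('d) * b * (\<Sum>C | C \<in> \<C>' \<and> C \<inter> set (\<pi> x y) \<noteq> {}. real (card C))
        \<le> 9 ^ CARD('d) * CARD('d) * b * mm"
      using b0 by (intro mult_left_mono) auto
    moreover have "b * wt (closed_ind A) (\<pi> x y) \<le> b * c" using \<pi>(2)[OF xy(1,2)] b0 by (intro
        mult_left_mono)
    ultimately show ?thesis by (elim reach_mono) linarith
  qed
  ultimately show ?thesis by blast
qed

section \<open>Deterministic estimates along one geodesic\<close>

lemma reach_segment:
  assumes "successively lattice_adj vs" "i \<le> j" "j < length vs"
  shows "reach t (vs ! i) (vs ! j) (\<Sum>n\<in>{i..<j}. t {vs ! n, vs ! Suc n})"
  using assms(2,3)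
proof (induction j rule: dec_induct)
  case (step n)
  then have "reach t (vs ! n) (vs ! Suc n) (t {vs ! n, vs ! Suc n})"
    using assms(1) by (intro reach_adj) (auto simp: successively_conv_nth)
  from reach_trans[OF step.IH this] step show ?case by simp
qed (simp add: reach_refl)

text \<open>The vertices are recovered for each \<open>l\<close> separately, because the definition
  supplies end points for every prefix on its own. Segments are optimal since a cheaper walk between
  \<open>vs ! i\<close> and \<open>vs ! j\<close> could be spliced into the prefix.\<close>

lemma infinite_geodesic_segment:
  assumes "\<Gamma> \<in> infinite_geodesics t" "l \<ge> 1" and nn: "\<And>e. e \<in> lattice_edges \<Longrightarrow> 0 \<le> t e"
  obtains vs where "length vs = Suc l" "distinct vs" "successively lattice_adj vs"
    "\<And>n. n < l \<Longrightarrow> \<Gamma> n = {vs ! n, vs ! Suc n}"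
    "\<And>i j c. i \<le> j \<Longrightarrow> j \<le> l \<Longrightarrow> reach t (vs ! i) (vs ! j) c \<Longrightarrow> (\<Sum>n\<in>{i..<j}. t (\<Gamma> n)) \<le> c"
proof -
  obtain x y where g: "finite_geodesic t x y (initial_path \<Gamma> l)"
    using assms(1,2) by (auto simp: infinite_geodesics_def)
  then obtain vs where vs: "vs \<noteq> []" "hd vs = x" "last vs = y" "distinct vs" "successively
      lattice_adj vs"
    "initial_path \<Gamma> l = map2 (\<lambda>u v. {u, v}) (butlast vs) (tl vs)"
    by (auto simp: finite_geodesic_def self_avoiding_path_def)
  have "length (initial_path \<Gamma> l) = length vs - 1" unfolding vs(6) by simp
  then have len: "length vs = Suc l" using vs(1) assms(2) by (simp add: initial_path_def)
  have \<Gamma>: "\<Gamma> n = {vs ! n, vs ! Suc n}" if "n < l" for n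
  proof -
    have "\<Gamma> n = initial_path \<Gamma> l ! n" using that by (simp add: initial_path_def)
    also have "\<dots> = {vs ! n, vs ! Suc n}" unfolding vs(6) using that len by (simp add: nth_butlast
        nth_tl)
    finally show ?thesis .
  qed
  have "(\<Sum>n\<in>{i..<j}. t (\<Gamma> n)) \<le> c" if ij: "i \<le> j" "j \<le> l" "reach t (vs ! i) (vs ! j) c" for i j c
  proof -
    have ends: "vs ! 0 = x" "vs ! l = y" using vs(1-3) len by (auto simp: hd_conv_nth last_conv_nth)
    have r: "reach t (vs ! 0) (vs ! i) (\<Sum>n\<in>{0..<i}. t {vs ! n, vs ! Suc n})"
      "reach t (vs ! j) (vs ! l) (\<Sum>n\<in>{j..<l}. t {vs ! n, vs ! Suc n})"
      using ij len by (auto intro!: reach_segment vs(5))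
    have "reach t x y ((\<Sum>n\<in>{0..<i}. t {vs ! n, vs ! Suc n}) + (c + (\<Sum>n\<in>{j..<l}. t {vs ! n, vs !
        Suc n})))"
      using reach_trans[OF r(1) reach_trans[OF ij(3) r(2)]] unfolding ends .
    from geodesic_reach[OF g this nn]
    have "passage_time t (initial_path \<Gamma> l) \<le> (\<Sum>n\<in>{0..<i}. t {vs ! n, vs ! Suc n}) + (c +
        (\<Sum>n\<in>{j..<l}. t {vs ! n, vs ! Suc n}))" .
    moreover have "passage_time t (initial_path \<Gamma> l) = (\<Sum>n\<in>{0..<l}. t (\<Gamma> n))"
      by (simp add: passage_time_def initial_path_def o_def interv_sum_list_conv_sum_set_nat)
    moreover have "\<dots> = (\<Sum>n\<in>{0..<i}. t (\<Gamma> n)) + (\<Sum>n\<in>{i..<j}. t (\<Gamma> n)) + (\<Sum>n\<in>{j..<l}. t (\<Gamma> n))"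
      using ij by (simp add: sum.atLeastLessThan_concat)
    moreover have "(\<Sum>n\<in>{0..<i}. t {vs ! n, vs ! Suc n}) = (\<Sum>n\<in>{0..<i}. t (\<Gamma> n))"
      "(\<Sum>n\<in>{j..<l}. t {vs ! n, vs ! Suc n}) = (\<Sum>n\<in>{j..<l}. t (\<Gamma> n))"
      using ij \<Gamma> by (auto intro!: sum.cong)
    ultimately show ?thesis by linarith
  qed
  then show ?thesis using that[OF len vs(4,5)] \<Gamma> by blast
qed

text \<open>A vertex is safe if no heavy cluster relevant to the scale encloses it; these clusters have
  fewer than \<open>(2 d + 2) k\<close> vertices.\<close>

definition scale_good :: "((int ^ 'd::finite) set \<Rightarrow> real) \<Rightarrow> real \<Rightarrow> nat \<Rightarrow> nat \<Rightarrow> bool" where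
  "scale_good t c m k \<longleftrightarrow> (\<exists>safe.
     (\<forall>x\<in>cube 0 (m * 2 ^ k). \<forall>y\<in>cube 0 (m * 2 ^ k). safe x \<longrightarrow> safe y \<longrightarrow> reach t x y (c * 2 ^ k)) \<and>
     (\<forall>vs. successively lattice_adj vs \<longrightarrow> distinct vs \<longrightarrow> length vs > (4 * ((2 * CARD('d) + 2) * k) +
         1) ^ CARD('d) \<longrightarrow>
        (\<exists>i<length vs. safe (vs ! i))))"

lemma path_in_cube:
  fixes vs :: "(int ^ 'd::finite) list"
  assumes "successively lattice_adj vs" "vs ! 0 \<in> cube 0 R" "n < length vs"
  shows "vs ! n \<in> cube 0 (n + R)"
  using assms(3)
proof (induction n)
  case (Suc n)
  then have "lattice_adj (vs ! n) (vs ! Suc n)" using assms(1) by (auto simp: successively_conv_nth)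
  then have "vs ! Suc n \<in> cube (vs ! n) 1" using lattice_adj_coord by (auto simp: cube_def
      abs_minus_commute)
  then show ?case using cube_trans[of "vs ! Suc n" "vs ! n" 1 0 "n + R"] Suc by simp
qed (use assms in simp)

text \<open>Between a safe vertex among the first \<open>\<rho> + 1\<close> and another at or after
  position \<open>l\<close>, the passage time is at most \<open>c * 2 ^ k\<close>. Markov's
  inequality bounds the heavy edges there, and at most \<open>\<rho>\<close> edges precede.\<close>

lemma geodesic_scale_count:
  fixes t :: "(int ^ 'd::finite) set \<Rightarrow> real"
  assumes good: "scale_good t c m k" and nn: "\<And>e. e \<in> lattice_edges \<Longrightarrow> 0 \<le> t e"
    and \<Gamma>: "\<Gamma> \<in> infinite_geodesics t" and R: "\<Gamma> 0 \<subseteq> cube 0 R" and \<epsilon>: "\<epsilon> > 0"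
    and \<rho>: "(4 * ((2 * CARD('d) + 2) * k) + 1) ^ CARD('d) = \<rho>" "\<rho> \<le> l" "R + 2 * l \<le> m * 2 ^ k" and
        l: "l \<ge> 1"
  shows "real (card {n. n < l \<and> t (\<Gamma> n) > \<epsilon>}) \<le> \<rho> + c * 2 ^ k / \<epsilon>"
proof -
  obtain safe where safe: "\<And>x y. x \<in> cube 0 (m * 2 ^ k) \<Longrightarrow> y \<in> cube 0 (m * 2 ^ k) \<Longrightarrow> safe x \<Longrightarrow> safe y
      \<Longrightarrow> reach t x y (c * 2 ^ k)"
    "\<And>vs. successively lattice_adj vs \<Longrightarrow> distinct vs \<Longrightarrow> length vs > \<rho> \<Longrightarrow> \<exists>i<length vs. safe (vs ! i)"
    using good unfolding scale_good_def \<rho>(1) by blast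
  \<comment> \<open>The prefix runs \<open>\<rho>\<close> edges beyond \<open>l\<close>, so that
    \<open>\<rho> + 1\<close> vertices are available for the second safe vertex.\<close>
  have "l + \<rho> \<ge> 1" using l by simp
  from infinite_geodesic_segment[OF \<Gamma> this nn]
  obtain vs where vs: "length vs = Suc (l + \<rho>)" "distinct vs" "successively lattice_adj vs"
    "\<And>n. n < l + \<rho> \<Longrightarrow> \<Gamma> n = {vs ! n, vs ! Suc n}"
    "\<And>i j c. i \<le> j \<Longrightarrow> j \<le> l + \<rho> \<Longrightarrow> reach t (vs ! i) (vs ! j) c \<Longrightarrow> (\<Sum>n\<in>{i..<j}. t (\<Gamma> n)) \<le> c"
    by blast
  have v0: "vs ! 0 \<in> cube 0 R" using vs(4)[of 0] R l by auto
  have cub: "vs ! n \<in> cube 0 (m * 2 ^ k)" if "n \<le> l + \<rho>" for n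
    using path_in_cube[OF vs(3) v0, of n] that vs(1) cube_mono[of "n + R" "m * 2 ^ k" 0] \<rho>(2,3) by
        auto
  have sub: "successively lattice_adj (take (Suc \<rho>) vs)" "successively lattice_adj (drop l vs)"
    using vs(3) by (auto simp: successively_conv_nth)
  obtain i where i: "i \<le> \<rho>" "safe (vs ! i)"
    using safe(2)[OF sub(1)] vs(1,2) by (auto simp: less_Suc_eq_le)
  obtain j' where j': "j' < Suc \<rho>" "safe (drop l vs ! j')"
    using safe(2)[OF sub(2)] vs(1,2) by auto
  define j where "j = l + j'"
  have j: "l \<le> j" "j \<le> l + \<rho>" "safe (vs ! j)" using j' vs(1) by (auto simp: j_def)
  have ij: "i \<le> j" using i j \<rho>(2) by linarith
  have le: "(\<Sum>n\<in>{i..<j}. t (\<Gamma> n)) \<le> c * 2 ^ k"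
    using i j ij \<rho>(2) by (intro vs(5) safe(1) cub) auto
  have tn: "0 \<le> t (\<Gamma> n)" if "n < l + \<rho>" for n
  proof -
    have "lattice_adj (vs ! n) (vs ! Suc n)" using vs(1,3) that by (simp add: successively_conv_nth)
    then show ?thesis using nn lattice_edgesI vs(4)[OF that] by metis
  qed
  let ?P = "{n. n < l \<and> t (\<Gamma> n) > \<epsilon>}"
  have "\<epsilon> * real (card (?P \<inter> {i..})) = (\<Sum>n\<in>?P \<inter> {i..}. \<epsilon>)" by simp
  also have "\<dots> \<le> (\<Sum>n\<in>?P \<inter> {i..}. t (\<Gamma> n))" by (intro sum_mono) auto
  also have "\<dots> \<le> (\<Sum>n\<in>{i..<j}. t (\<Gamma> n))" using j tn by (intro sum_mono2) auto
  finally have "real (card (?P \<inter> {i..})) \<le> c * 2 ^ k / \<epsilon>" using le \<epsilon> by (simp add: field_simps)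
  moreover have "card ?P \<le> card {..<i} + card (?P \<inter> {i..})"
    by (rule order_trans[OF card_mono card_Un_le]) auto
  ultimately show ?thesis using i(1) by simp
qed

text \<open>Writing \<open>k ^ d / 2 ^ k\<close> as the \<open>d\<close>-th power of
  \<open>k * x ^ k\<close>, with \<open>x\<close> the \<open>d\<close>-th root of
  \<open>1/2\<close>, reduces the claim to a linear factor.\<close>

lemma power_over_exp:
  assumes d: "d > 0"
  shows "(\<lambda>k. real ((4 * (a * k) + 1) ^ d) / 2 ^ k) \<longlonglongrightarrow> 0"
proof -
  define x where "x = root d (1/2)"
  have x: "0 \<le> x" "x < 1" using d real_root_lt_1_iff[of d "1/2"] by (auto simp: x_def)
  have "(\<lambda>k. (real k * x ^ k) ^ d) \<longlonglongrightarrow> 0 ^ d"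
    using powser_times_n_limit_0[of x] x by (intro tendsto_power) auto
  moreover have "(real k * x ^ k) ^ d = real k ^ d * (1/2) ^ k" for k
  proof -
    have "(x ^ k) ^ d = (x ^ d) ^ k" by (simp add: power_mult[symmetric] mult.commute)
    then show ?thesis using d by (simp add: power_mult_distrib x_def)
  qed
  ultimately have "(\<lambda>k. real k ^ d * (1/2) ^ k) \<longlonglongrightarrow> 0" using d by (simp add: power_0_left)
  then have "(\<lambda>k. real (Suc k) ^ d * (1/2) ^ Suc k) \<longlonglongrightarrow> 0" by (rule LIMSEQ_Suc)
  then have lim: "(\<lambda>k. (2 * real (4 * a + 1) ^ d) * (real (Suc k) ^ d * (1/2) ^ Suc k)) \<longlonglongrightarrow> 0"
    by (rule tendsto_mult_right_zero)
  show ?thesis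
  proof (rule tendsto_sandwich[OF _ _ tendsto_const lim])
    show "\<forall>\<^sub>F k in sequentially. real ((4 * (a * k) + 1) ^ d) / 2 ^ k \<le> (2 * real (4 * a + 1) ^ d)
        * (real (Suc k) ^ d * (1/2) ^ Suc k)"
    proof (intro always_eventually allI)
      fix k
      have "4 * (a * k) + 1 \<le> (4 * a + 1) * Suc k" by (simp add: algebra_simps)
      then have "(4 * (a * k) + 1) ^ d \<le> ((4 * a + 1) * Suc k) ^ d" by (rule power_mono) simp
      then have "real ((4 * (a * k) + 1) ^ d) \<le> real (((4 * a + 1) * Suc k) ^ d)" by (simp only:
          of_nat_le_iff)
      then have "real ((4 * (a * k) + 1) ^ d) / 2 ^ k \<le> real (((4 * a + 1) * Suc k) ^ d) / 2 ^ k"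
          by (rule divide_right_mono) simp
      also have "real (((4 * a + 1) * Suc k) ^ d) = real (4 * a + 1) ^ d * real (Suc k) ^ d"
        by (simp only: of_nat_power of_nat_mult power_mult_distrib)
      also have "real (4 * a + 1) ^ d * real (Suc k) ^ d / 2 ^ k = (2 * real (4 * a + 1) ^ d) *
          (real (Suc k) ^ d * (1/2) ^ Suc k)"
        by (simp add: power_one_over field_simps)
      finally show "real ((4 * (a * k) + 1) ^ d) / 2 ^ k \<le> (2 * real (4 * a + 1) ^ d) * (real (Suc
          k) ^ d * (1/2) ^ Suc k)" .
    qed
  qed auto
qed

text \<open>For the least scale whose box contains the segment, \<open>2 ^ k\<close> is at most
  \<open>6 * l / m\<close>. Since \<open>c\<close> does not depend on \<open>m\<close>, a large
  \<open>m\<close> makes the fraction of heavy edges as small as desired.\<close>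

lemma geodesic_density:
  fixes t :: "(int ^ 'd::finite) set \<Rightarrow> real"
  assumes good: "\<And>m. m \<ge> 1 \<Longrightarrow> \<forall>\<^sub>F k in sequentially. scale_good t c m k" and c: "c \<ge> 0"
    and nn: "\<And>e. e \<in> lattice_edges \<Longrightarrow> 0 \<le> t e"
    and \<Gamma>: "\<Gamma> \<in> infinite_geodesics t" and \<epsilon>: "\<epsilon> > 0"
  shows "(\<lambda>l. real (card {n. n < l \<and> t (\<Gamma> n) > \<epsilon>}) / l) \<longlonglongrightarrow> 0"
proof (rule LIMSEQ_I)
  fix \<theta> :: real assume \<theta>: "\<theta> > 0"
  obtain vs0 where vs0: "\<Gamma> 0 = {vs0 ! 0, vs0 ! Suc 0}" using infinite_geodesic_segment[OF \<Gamma>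
      order_refl nn] by (metis zero_less_one)
  define R where "R = nat (\<Sum>v\<in>\<Gamma> 0. \<Sum>i\<in>UNIV. \<bar>v $ i\<bar>)"
  have R: "\<Gamma> 0 \<subseteq> cube 0 R"
  proof
    fix v assume v: "v \<in> \<Gamma> 0"
    have "\<bar>v $ i\<bar> \<le> int R" for i
    proof -
      have "\<bar>v $ i\<bar> \<le> (\<Sum>i\<in>UNIV. \<bar>v $ i\<bar>)" by (rule member_le_sum) auto
      also have "\<dots> \<le> (\<Sum>v\<in>\<Gamma> 0. \<Sum>i\<in>UNIV. \<bar>v $ i\<bar>)" using v vs0 by (intro member_le_sum) (auto simp:
          sum_nonneg)
      finally show ?thesis unfolding R_def by linarith
    qed
    then show "v \<in> cube 0 R" by (simp add: cube_def)
  qed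
  \<comment> \<open>The fraction bound is \<open>(6 / m) * (1 + c / \<epsilon>)\<close>; the summand
    6 ensures \<open>2 ^ k \<le> l\<close>.\<close>
  define m where "m = 6 + nat \<lceil>6 * (1 + c / \<epsilon>) / \<theta>\<rceil>"
  have m: "m \<ge> 6" "m > 0" by (auto simp: m_def)
  have "6 * (1 + c / \<epsilon>) / \<theta> < m" unfolding m_def by linarith
  then have m\<theta>: "(6 / m) * (1 + c / \<epsilon>) < \<theta>" using \<theta> m by (simp add: field_simps)
  define \<rho> where "\<rho> k = (4 * ((2 * CARD('d) + 2) * k) + 1) ^ CARD('d)" for k
  have "\<forall>\<^sub>F k in sequentially. real (\<rho> k) / 2 ^ k < 1 / m"
        using order_tendstoD(2)[OF power_over_exp[of "CARD('d)" "2 * CARD('d) + 2"], of "1 / m"] m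
            by (simp add: \<rho>_def)
  moreover have "\<forall>\<^sub>F k in sequentially. scale_good t c m k" using good m by simp
  ultimately have "\<forall>\<^sub>F k in sequentially. real (\<rho> k) / 2 ^ k < 1 / m \<and> scale_good t c m k" by
      eventually_elim auto
  then obtain K where K: "\<And>k. k \<ge> K \<Longrightarrow> real (\<rho> k) / 2 ^ k < 1 / m" "\<And>k. k \<ge> K \<Longrightarrow> scale_good t c m k"
    unfolding eventually_sequentially by blast
  have "norm (real (card {n. n < l \<and> t (\<Gamma> n) > \<epsilon>}) / l - 0) < \<theta>" if l: "l \<ge> R + m * 2 ^ K + 1" for l
  proof -
    define k where "k = (LEAST k. R + 2 * l \<le> m * 2 ^ k)"
    have ex: "R + 2 * l \<le> m * 2 ^ (R + 2 * l)"
    proof -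
      have "R + 2 * l \<le> 2 ^ (R + 2 * l)" using less_exp[of "R + 2 * l"] by linarith
      also have "\<dots> \<le> m * 2 ^ (R + 2 * l)" using m by simp
      finally show ?thesis .
    qed
    have k: "R + 2 * l \<le> m * 2 ^ k" unfolding k_def by (rule LeastI[of "\<lambda>k. R + 2 * l \<le> m * 2 ^
        k", OF ex])
    have "k > K"
    proof (rule ccontr)
      assume "\<not> k > K"
      then have "m * 2 ^ k \<le> m * 2 ^ K" by (intro mult_left_mono power_increasing) auto
      then show False using k l by linarith
    qed
    then obtain k' where k': "k = Suc k'" by (cases k) auto
    \<comment> \<open>Minimality of \<open>k\<close> loses only a factor 2, and
      \<open>R \<le> l\<close> turns the bound into \<open>6 * l\<close>.\<close>
    have "\<not> R + 2 * l \<le> m * 2 ^ k'" using not_less_Least[of k' "\<lambda>k. R + 2 * l \<le> m * 2 ^ k"] k'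
        unfolding k_def by simp
    then have "m * 2 ^ k < 2 * (R + 2 * l)" using k' by simp
    moreover have "R \<le> l" using l by simp
    ultimately have "m * 2 ^ k < 6 * l" by simp
    then have "real (m * 2 ^ k) < real (6 * l)" by (simp only: of_nat_less_iff)
    then have kl: "(2::real) ^ k \<le> 6 * l / m" using m by (simp add: field_simps)
    have "real (\<rho> k) < 2 ^ k / m" using K(1)[of k] \<open>k > K\<close> by (simp add: field_simps)
    also have "\<dots> \<le> 2 ^ k" using m by (simp add: field_simps)
    finally have \<rho>k: "real (\<rho> k) \<le> 2 ^ k" by simp
    also have "\<dots> \<le> l"
    proof -
      have "real l * 6 \<le> real l * real m" using m by (intro mult_left_mono) auto
      then have "6 * real l / m \<le> l" using m by (simp add: field_simps)
      then show ?thesis using kl by linarith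
    qed
    finally have \<rho>l: "\<rho> k \<le> l" by simp
    have "real (card {n. n < l \<and> t (\<Gamma> n) > \<epsilon>}) \<le> \<rho> k + c * 2 ^ k / \<epsilon>"
      by (rule geodesic_scale_count[OF K(2) nn \<Gamma> R \<epsilon> _ \<rho>l k]) (use \<open>k > K\<close> l in \<open>auto simp: \<rho>_def\<close>)
    also have "\<dots> \<le> 2 ^ k * (1 + c / \<epsilon>)" using \<rho>k by (simp add: algebra_simps)
    also have "\<dots> \<le> (6 * l / m) * (1 + c / \<epsilon>)" using kl c \<epsilon> by (intro mult_right_mono) auto
    also have "\<dots> = l * ((6 / m) * (1 + c / \<epsilon>))" by simp
    also have "\<dots> < l * \<theta>" using m\<theta> l by (intro mult_strict_left_mono) auto
    finally have "real (card {n. n < l \<and> t (\<Gamma> n) > \<epsilon>}) / l < \<theta>" using l by (simp add: field_simps)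
    then show ?thesis by simp
  qed
  then show "\<exists>l0. \<forall>l\<ge>l0. norm (real (card {n. n < l \<and> t (\<Gamma> n) > \<epsilon>}) / real l - 0) < \<theta>" by blast
qed

section \<open>From vanishing density to weak convergence\<close>

lemma empirical_cdf:
  fixes \<Gamma> :: "nat \<Rightarrow> 'e" and t :: "'e \<Rightarrow> real"
  assumes "l \<ge> 1"
  shows "cdf (empirical_measure t (initial_path \<Gamma> l)) x = real (card {n. n < l \<and> t (\<Gamma> n) \<le> x}) / l"
proof -
  have "(\<Sum>e\<leftarrow>initial_path \<Gamma> l. emeasure (return borel (t e)) {..x}) = ennreal (real (card {n. n < l
      \<and> t (\<Gamma> n) \<le> x}))"
  proof (induction l)
    case (Suc l)
    have "{n. n < Suc l \<and> t (\<Gamma> n) \<le> x} = {n. n < l \<and> t (\<Gamma> n) \<le> x} \<union> (if t (\<Gamma> l) \<le> x then {l} else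
        {})"
      by (auto simp: less_Suc_eq)
    then have "card {n. n < Suc l \<and> t (\<Gamma> n) \<le> x} = card {n. n < l \<and> t (\<Gamma> n) \<le> x} + (if t (\<Gamma> l) \<le> x
        then 1 else 0)"
      by (simp add: card_insert_if)
    then show ?case using Suc by (simp add: initial_path_def indicator_def add.commute)
  qed (simp add: initial_path_def)
  then have "emeasure (empirical_measure t (initial_path \<Gamma> l)) {..x} = ennreal (real (card {n. n <
      l \<and> t (\<Gamma> n) \<le> x}) / l)"
    using assms by (subst emeasure_empirical_measure) (auto simp: initial_path_def divide_ennreal)
  then show ?thesis by (simp add: cdf_def measure_def)
qed

text \<open>The limit distribution function is discontinuous only at 0. To the left nonnegativity
  suffices; to the right the density of edges above \<open>x\<close> is the defect from 1.\<close>

lemma weak_conv_zero: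
  fixes \<Gamma> :: "nat \<Rightarrow> 'e" and t :: "'e \<Rightarrow> real"
  assumes nn: "\<And>n. 0 \<le> t (\<Gamma> n)"
    and dens: "\<And>\<epsilon>. \<epsilon> > 0 \<Longrightarrow> (\<lambda>l. real (card {n. n < l \<and> t (\<Gamma> n) > \<epsilon>}) / l) \<longlonglongrightarrow> 0"
  shows "weak_conv_m (\<lambda>l. empirical_measure t (initial_path \<Gamma> l)) (return borel 0)"
  unfolding weak_conv_m_def weak_conv_def
proof (intro allI impI)
  fix x :: real
  assume cont: "isCont (cdf (return borel 0)) x"
  have c0: "cdf (return borel 0) y = (if 0 \<le> y then 1 else 0)" for y :: real
    by (simp add: cdf_def measure_return indicator_def)
  have "x \<noteq> 0"
  proof
    assume "x = 0"
    have "(\<lambda>n. - inverse (real (Suc n))) \<longlonglongrightarrow> - 0" by (intro tendsto_minus LIMSEQ_inverse_real_of_nat)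
    then have "(\<lambda>n. cdf (return borel 0) (- inverse (real (Suc n)))) \<longlonglongrightarrow> cdf (return borel 0) x"
      using isCont_tendsto_compose[OF cont] \<open>x = 0\<close> by simp
    then show False using \<open>x = 0\<close> by (simp add: c0 LIMSEQ_const_iff)
  qed
  then consider "x < 0" | "x > 0" by linarith
  then show "(\<lambda>l. cdf (empirical_measure t (initial_path \<Gamma> l)) x) \<longlonglongrightarrow> cdf (return borel 0) x"
  proof cases
    case 1
    have "\<forall>\<^sub>F l in sequentially. 0 = cdf (empirical_measure t (initial_path \<Gamma> l)) x"
      using eventually_ge_at_top[of 1]
    proof eventually_elim
      case (elim l)
      have "{n. n < l \<and> t (\<Gamma> n) \<le> x} = {}" using nn 1 by (auto simp: not_le intro: less_le_trans)
      then show ?case by (simp add: empirical_cdf[OF elim])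
    qed
    from Lim_transform_eventually[OF tendsto_const this] show ?thesis using 1 by (simp add: c0)
  next
    case 2
    have "\<forall>\<^sub>F l in sequentially. 1 - real (card {n. n < l \<and> t (\<Gamma> n) > x}) / l = cdf
        (empirical_measure t (initial_path \<Gamma> l)) x"
      using eventually_ge_at_top[of 1]
    proof eventually_elim
      case (elim l)
      have "{..<l} = {n. n < l \<and> t (\<Gamma> n) \<le> x} \<union> {n. n < l \<and> t (\<Gamma> n) > x}" by auto
      then have "l = card ({n. n < l \<and> t (\<Gamma> n) \<le> x} \<union> {n. n < l \<and> t (\<Gamma> n) > x})" by (metis
          card_lessThan)
      also have "\<dots> = card {n. n < l \<and> t (\<Gamma> n) \<le> x} + card {n. n < l \<and> t (\<Gamma> n) > x}" by (rule
          card_Un_disjoint) auto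
      finally have "real (card {n. n < l \<and> t (\<Gamma> n) \<le> x}) = real l - real (card {n. n < l \<and> t (\<Gamma> n)
          > x})" by linarith
      then show ?case using elim by (simp add: empirical_cdf[OF elim] diff_divide_distrib)
    qed
    moreover have "(\<lambda>l. 1 - real (card {n. n < l \<and> t (\<Gamma> n) > x}) / l) \<longlonglongrightarrow> 1 - 0"
      by (intro tendsto_diff tendsto_const dens 2)
    ultimately have "(\<lambda>l. cdf (empirical_measure t (initial_path \<Gamma> l)) x) \<longlonglongrightarrow> 1 - 0"
      by (rule Lim_transform_eventually[rotated])
    then show ?thesis using 2 by (simp add: c0)
  qed
qed

section \<open>Almost sure regularity of the scales\<close>

text \<open>Only \<open>F n\<close> tending to 1 is used, no moment. If \<open>F 0 = 1\<close>, both
  sides vanish for \<open>b = 0\<close>; otherwise the right-hand side is a fixed positive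
  number.\<close>

lemma (in prob_space) tail_threshold:
  fixes \<tau> :: "(int ^ 'd::finite) set \<Rightarrow> 'a \<Rightarrow> real"
  assumes rv: "\<And>e. e \<in> lattice_edges \<Longrightarrow> \<tau> e \<in> borel_measurable M"
    and F: "\<And>e t. e \<in> lattice_edges \<Longrightarrow> F t = prob {\<omega> \<in> space M. \<tau> e \<omega> \<le> t}"
    and \<kappa>: "\<kappa> > 0"
  shows "\<exists>b\<ge>0. \<forall>e\<in>lattice_edges. prob {\<omega> \<in> space M. \<tau> e \<omega> > b} \<le> \<kappa> * prob {\<omega> \<in> space M. \<tau> e \<omega> > 0}"
proof -
  have compl: "prob {\<omega> \<in> space M. \<tau> e \<omega> > t} = 1 - F t" if e: "e \<in> lattice_edges" for e t
  proof -
    have "{\<omega> \<in> space M. \<tau> e \<omega> \<le> t} \<in> events" using rv[OF e] by measurable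
    moreover have "{\<omega> \<in> space M. \<tau> e \<omega> > t} = space M - {\<omega> \<in> space M. \<tau> e \<omega> \<le> t}" by auto
    ultimately show ?thesis using prob_compl F[OF e] by simp
  qed
  obtain e0 :: "(int ^ 'd) set" where e0: "e0 \<in> lattice_edges" using lattice_edges_nonempty by blast
  have ev: "{\<omega> \<in> space M. \<tau> e0 \<omega> \<le> t} \<in> events" for t using rv[OF e0] by measurable
  have "(\<lambda>n. prob {\<omega> \<in> space M. \<tau> e0 \<omega> \<le> real n}) \<longlonglongrightarrow> prob (\<Union>n. {\<omega> \<in> space M. \<tau> e0 \<omega> \<le> real n})"
    using ev by (intro finite_Lim_measure_incseq) (auto simp: incseq_def intro: order_trans)
  moreover have "(\<Union>n. {\<omega> \<in> space M. \<tau> e0 \<omega> \<le> real n}) = space M" using real_arch_simple by blast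
  ultimately have lim: "(\<lambda>n. 1 - F (real n)) \<longlonglongrightarrow> 1 - 1"
    using F[OF e0] by (intro tendsto_diff tendsto_const) (simp add: prob_space)
  show ?thesis
  proof (cases "F 0 = 1")
    case True
    then show ?thesis using compl by (intro exI[of _ 0]) auto
  next
    case False
    have "F 0 \<le> 1" using F[OF e0] by simp
    then have "\<kappa> * (1 - F 0) > 0" using \<kappa> False by simp
    then have "\<forall>\<^sub>F n in sequentially. 1 - F (real n) < \<kappa> * (1 - F 0)" using order_tendstoD(2)[OF
        lim] by simp
    then obtain n where "1 - F (real n) < \<kappa> * (1 - F 0)" using eventually_happens
        trivial_limit_sequentially by blast
    then show ?thesis using compl by (intro exI[of _ "real n"]) auto
  qed
qed

text \<open>There are about \<open>2 ^ (2 * d * k)\<close> pairs of vertices and, in the second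
  bound, about \<open>2 ^ k\<close> roots for each. Fixed-root clusters thus need a size linear in
  \<open>k\<close>, whence \<open>r\<close>; for the total size of order \<open>2 ^ k\<close> the
  decay is far stronger than required.\<close>

lemma scale_sum_bound:
  fixes m k d :: nat
  assumes "m \<ge> 1" "d \<ge> 1"
  defines "N \<equiv> (2 * (m * 2 ^ k) + 1) ^ d" and "s \<equiv> 8 * d * 2 ^ k" and "r \<equiv> (2 * d + 2) * k"
  shows "real N * (real N * (2 ^ s / 4 ^ s)) \<le> (3 * m) ^ (2 * d) * (1/2) ^ k"
    and "real N * (real N * (real s * (2 / 4 ^ r))) \<le> (3 * m) ^ (2 * d) * (16 * d) * (1/2) ^ k"
proof -
  have "1 \<le> m * 2 ^ k" using assms(1) by simp
  then have "2 * (m * 2 ^ k) + 1 \<le> 3 * m * 2 ^ k" by simp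
  then have N: "N \<le> (3 * m * 2 ^ k) ^ d" unfolding N_def by (rule power_mono) simp
  have "N * N \<le> (3 * m * 2 ^ k) ^ d * (3 * m * 2 ^ k) ^ d" using N by (intro mult_mono) auto
  also have "\<dots> = (3 * m * 2 ^ k) ^ (2 * d)" by (simp only: mult_2 power_add)
  also have "\<dots> = (3 * m) ^ (2 * d) * (2 ^ k) ^ (2 * d)" by (simp only: power_mult_distrib)
  also have "(2 ^ k) ^ (2 * d) = (2 ^ (2 * d * k) :: nat)" by (simp add: power_mult[symmetric]
      mult.commute)
  finally have "real (N * N) \<le> real ((3 * m) ^ (2 * d) * 2 ^ (2 * d * k))" by (simp only:
      of_nat_le_iff)
  define P where "P = real N * real N"
  define Q where "Q = (3 * real m) ^ (2 * d)"
  have NN: "P \<le> Q * 2 ^ (2 * d * k)" using \<open>real (N * N) \<le> _\<close> by (simp add: P_def Q_def)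
  have Q: "0 \<le> Q" by (simp add: Q_def)
  have s: "(2 ^ s / 4 ^ s :: real) = (1/2) ^ s" by (simp add: power_divide[symmetric])
  have "2 * d * k + k \<le> s"
  proof -
    have "(2 * d + 1) * k \<le> (8 * d) * 2 ^ k" using less_exp[of k] assms(2) by (intro mult_mono) auto
    then show ?thesis by (simp add: s_def)
  qed
  then have "((1/2) ^ s :: real) \<le> (1/2) ^ (2 * d * k + k)" by (intro power_decreasing) auto
  then have "P * (2 ^ s / 4 ^ s) \<le> (Q * 2 ^ (2 * d * k)) * (1/2) ^ (2 * d * k + k)"
    unfolding s using NN Q by (intro mult_mono) auto
  also have "\<dots> = Q * (1/2) ^ k" by (simp add: power_add power_one_over)
  finally show "real N * (real N * (2 ^ s / 4 ^ s)) \<le> (3 * m) ^ (2 * d) * (1/2) ^ k" by (simp add: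
      P_def Q_def mult.assoc)
  have r: "(2 / 4 ^ r :: real) = 2 * (1/2) ^ (2 * r)" by (simp add: power_mult power_one_over)
  have "2 * d * k + k + k \<le> 2 * r" by (simp add: r_def algebra_simps)
  then have "((1/2) ^ (2 * r) :: real) \<le> (1/2) ^ (2 * d * k + k + k)" by (intro power_decreasing)
      auto
  then have "P * (real s * (2 / 4 ^ r)) \<le> (Q * 2 ^ (2 * d * k)) * (real s * (2 * (1/2) ^ (2 * d *
      k + k + k)))"
    unfolding r using NN Q by (intro mult_mono mult_left_mono) auto
  also have "\<dots> = Q * (16 * d) * (2 ^ (2 * d * k) * 2 ^ k * (1/2) ^ (2 * d * k + k + k))" by (simp
      add: s_def)
  also have "(2 ^ (2 * d * k) * 2 ^ k * (1/2) ^ (2 * d * k + k + k)) =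
      (2 * (1/2)) ^ (2 * d * k) * (2 * (1/2)) ^ k * ((1/2) ^ k :: real)"
    by (simp only: power_add power_mult_distrib mult_ac)
  finally show "real N * (real N * (real s * (2 / 4 ^ r))) \<le> (3 * m) ^ (2 * d) * (16 * d) * (1/2)
      ^ k"
    by (simp add: P_def Q_def mult.assoc)
qed

text \<open>In \<open>c\<close>, the distance bound supplies \<open>4 * CARD('d)\<close>, and
  \<open>8 * CARD('d)\<close> is the total cluster size allowed per walk, equal to the maximal
  number of its closed ends. Neither depends on \<open>m\<close>.\<close>

lemma (in prob_space) AE_scale_good:
  fixes \<tau> :: "(int ^ 'd::finite) set \<Rightarrow> 'a \<Rightarrow> real" and b p :: real
  assumes d2: "CARD('d) \<ge> 2" and ind: "indep_vars (\<lambda>_. borel) \<tau> lattice_edges"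
    and tail: "\<And>e. e \<in> lattice_edges \<Longrightarrow>
      prob {\<omega> \<in> space M. \<tau> e \<omega> > b} \<le> bad_rate TYPE('d) ^ 3 ^ CARD('d) * prob {\<omega> \<in> space M. \<tau> e \<omega>
          > 0}"
    and b: "0 \<le> b" and p: "0 \<le> p" "p \<le> 1" "critical_prob TYPE('d) \<le> p"
    and marg: "\<And>e. e \<in> lattice_edges \<Longrightarrow> prob {\<omega> \<in> space M. \<tau> e \<omega> \<le> 0} = p" and m: "m \<ge> 1"
  defines "c \<equiv> b * (4 * CARD('d)) + 9 ^ CARD('d) * CARD('d) * b * (8 * CARD('d))"
  shows "AE \<omega> in M. \<forall>\<^sub>F k in sequentially. scale_good (\<lambda>e. \<tau> e \<omega>) c m k"
proof -
  define X where "X k = cube (0 :: int ^ 'd) (m * 2 ^ k)" for k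
  \<comment> \<open>Local notion, hiding the relation on coarse sites: some distance in the box
    exceeds the bound of \<open>uniform_distance_bound\<close>.\<close>
  define far where "far k A \<longleftrightarrow> (\<exists>x\<in>X k. \<exists>y\<in>X k. cdist A x y > 4 * CARD('d) * 2 ^ k)" for k and A ::
      "(int ^ 'd) set set"
  have small: "\<exists>n E. n \<ge> 1 \<and> finite E \<and> E \<subseteq> lattice_edges \<and> mdist p E 0 (int n *s axis i 1) < \<eta> *
      real n"
    if "\<eta> > 0" for i :: 'd and \<eta> by (rule zero_time_constant[OF p that])
  have "\<exists>C h1. \<forall>h\<ge>h1. \<exists>F::(int ^ 'd) set set. finite F \<and> F \<subseteq> lattice_edges \<and>
    bern p F (\<lambda>A. of_bool (\<exists>x\<in>cube 0 (m * h). \<exists>y\<in>cube 0 (m * h). cdist A x y > 4 * CARD('d) * h))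
        \<le> C / real h"
    by (rule uniform_distance_bound[OF p(1,2) m]) (rule small)
  then obtain C h1 where C: "\<forall>h\<ge>h1. \<exists>F::(int ^ 'd) set set. finite F \<and> F \<subseteq> lattice_edges \<and>
    bern p F (\<lambda>A. of_bool (\<exists>x\<in>cube 0 (m * h). \<exists>y\<in>cube 0 (m * h). cdist A x y > 4 * CARD('d) * h))
        \<le> C / real h"
    by (elim exE) (rule that)
  have "\<exists>F::(int ^ 'd) set set. finite F \<and> F \<subseteq> lattice_edges \<and> (h1 \<le> 2 ^ k \<longrightarrow> bern p F (\<lambda>A. of_bool
      (far k A)) \<le> C / 2 ^ k)" for k
  proof (cases "h1 \<le> 2 ^ k")
    case True
    then show ?thesis using C[rule_format, of "2 ^ k"] unfolding far_def X_def by simp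
  qed (auto intro: exI[of _ "{}"])
  then have "\<exists>E::nat \<Rightarrow> (int ^ 'd) set set. \<forall>k. finite (E k) \<and> E k \<subseteq> lattice_edges \<and>
      (h1 \<le> 2 ^ k \<longrightarrow> bern p (E k) (\<lambda>A. of_bool (far k A)) \<le> C / 2 ^ k)"
    by (intro choice allI)
  then obtain E :: "nat \<Rightarrow> (int ^ 'd) set set" where E0: "\<forall>k. finite (E k) \<and> E k \<subseteq> lattice_edges \<and>
      (h1 \<le> 2 ^ k \<longrightarrow> bern p (E k) (\<lambda>A. of_bool (far k A)) \<le> C / 2 ^ k)" ..
  have E: "finite (E k)" "E k \<subseteq> lattice_edges"
      "h1 \<le> 2 ^ k \<Longrightarrow> bern p (E k) (\<lambda>A. of_bool (far k A)) \<le> C / 2 ^ k" for k using E0 by auto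
  define \<sigma> where "\<sigma> k \<omega> = {e \<in> E k. \<tau> e \<omega> \<le> 0}" for k \<omega>
  define s where "s k = 8 * CARD('d) * 2 ^ k" for k :: nat
  define r where "r k = (2 * CARD('d) + 2) * k" for k :: nat
  \<comment> \<open>The optimal walk is a function of the open set alone, as the roots in
    \<open>bad_animal_prob\<close> must be.\<close>
  define \<pi> where "\<pi> A x y = (SOME vs. lpath vs x y \<and> wt (closed_ind A) vs = real (cdist A x y))"
      for A and x y :: "int ^ 'd"
  have \<pi>: "lpath (\<pi> A x y) x y" "wt (closed_ind A) (\<pi> A x y) = real (cdist A x y)" for A x y
    using someI_ex[OF cdist_path[of x y A]] by (simp_all add: \<pi>_def)
  \<comment> \<open>The list is emptied when the distance is too large, because the bound
    \<open>s k\<close> on the number of roots has to hold for every \<open>A\<close>.\<close>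
  define L where "L k A x y = (if cdist A x y \<le> 4 * CARD('d) * 2 ^ k then closed_ends A (\<pi> A x y)
      else [])" for k A x y
  have len: "length (L k A x y) \<le> s k" for k A x y
  proof (cases "cdist A x y \<le> 4 * CARD('d) * 2 ^ k")
    case True
    have "real (length (closed_ends A (\<pi> A x y))) = real (2 * cdist A x y)" by (simp add:
        length_closed_ends \<pi>(2))
    then have "length (closed_ends A (\<pi> A x y)) = 2 * cdist A x y" by (simp only: of_nat_eq_iff)
    then show ?thesis using True by (simp add: L_def s_def)
  qed (simp add: L_def)
  \<comment> \<open>The \<open>j\<close>-th root alone. Indexing by position permits a union bound
    although the root itself is random.\<close>
  define V where "V k A x y j = (if j < length (L k A x y) then {L k A x y ! j} else {})" for k A
      x y j
  define G1 where "G1 k = {\<omega> \<in> space M. far k (\<sigma> k \<omega>)}" for k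
  define H2 where "H2 k x y = {\<omega> \<in> space M. \<exists>Y\<in>animals (set (L k (\<sigma> k \<omega>) x y)) (s k). Y \<subseteq> bad (\<lambda>e.
      \<tau> e \<omega>) b}" for k x y
  define H3 where "H3 k x y j = {\<omega> \<in> space M. \<exists>Y\<in>animals (V k (\<sigma> k \<omega>) x y j) (r k). Y \<subseteq> bad (\<lambda>e. \<tau>
      e \<omega>) b}" for k x y j
  define G2 where "G2 k = (\<Union>x\<in>X k. \<Union>y\<in>X k. H2 k x y)" for k
  define G3 where "G3 k = (\<Union>x\<in>X k. \<Union>y\<in>X k. \<Union>j<s k. H3 k x y j)" for k
  have finX: "finite (X k)" for k unfolding X_def by (rule cube_finite_card(1))
  have G1: "G1 k \<in> events" "prob (G1 k) = bern p (E k) (\<lambda>A. of_bool (far k A))" for k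
    unfolding G1_def \<sigma>_def using prob_bern[OF ind E(2,1), of "{..0}" k p "far k"] marg E(2)[of k]
        by (auto simp: subset_iff)
  have H2: "H2 k x y \<in> events" "prob (H2 k x y) \<le> 2 ^ s k / 4 ^ s k" for k x y
    unfolding H2_def \<sigma>_def
    using bad_animal_prob[OF ind tail b E(1,2), of k "\<lambda>A. set (L k A x y)" "s k" "s k"]
      order_trans[OF card_length len] by simp_all
  have cV: "card (V k A x y j) \<le> 1" "finite (V k A x y j)" for k A x y j by (auto simp: V_def)
  have H3: "H3 k x y j \<in> events" "prob (H3 k x y j) \<le> 2 / 4 ^ r k" for k x y j
    unfolding H3_def \<sigma>_def
    using bad_animal_prob[OF ind tail b E(1,2), of k "\<lambda>A. V k A x y j" 1 "r k"] cV by simp_all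
  have G2: "G2 k \<in> events" "prob (G2 k) \<le> card (X k) * (card (X k) * (2 ^ s k / 4 ^ s k))" for k
  proof -
    show "G2 k \<in> events" unfolding G2_def using finX H2(1) by (intro sets.finite_UN) auto
    have "prob (G2 k) \<le> (\<Sum>x\<in>X k. prob (\<Union>y\<in>X k. H2 k x y))"
      unfolding G2_def using finX H2(1) by (intro finite_measure_subadditive_finite) (auto intro!:
          sets.finite_UN)
    also have "\<dots> \<le> (\<Sum>x\<in>X k. \<Sum>y\<in>X k. prob (H2 k x y))"
      using finX H2(1) by (intro sum_mono finite_measure_subadditive_finite) auto
    also have "\<dots> \<le> (\<Sum>x\<in>X k. \<Sum>y\<in>X k. 2 ^ s k / 4 ^ s k)" by (intro sum_mono H2(2))
    finally show "prob (G2 k) \<le> card (X k) * (card (X k) * (2 ^ s k / 4 ^ s k))" by simp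
  qed
  have G3: "G3 k \<in> events" "prob (G3 k) \<le> card (X k) * (card (X k) * (s k * (2 / 4 ^ r k)))" for k
  proof -
    have ev: "(\<Union>j<s k. H3 k x y j) \<in> events" for x y by (intro sets.finite_UN H3(1)) auto
    have ev': "(\<Union>y\<in>X k. \<Union>j<s k. H3 k x y j) \<in> events" for x by (intro sets.finite_UN finX ev)
    show "G3 k \<in> events" unfolding G3_def by (intro sets.finite_UN finX ev')
    have "prob (G3 k) \<le> (\<Sum>x\<in>X k. prob (\<Union>y\<in>X k. \<Union>j<s k. H3 k x y j))"
      unfolding G3_def using finX ev' by (intro finite_measure_subadditive_finite) auto
    also have "\<dots> \<le> (\<Sum>x\<in>X k. \<Sum>y\<in>X k. prob (\<Union>j<s k. H3 k x y j))"
      using finX ev by (intro sum_mono finite_measure_subadditive_finite) auto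
    also have "\<dots> \<le> (\<Sum>x\<in>X k. \<Sum>y\<in>X k. \<Sum>j<s k. prob (H3 k x y j))"
      using H3(1) by (intro sum_mono finite_measure_subadditive_finite) auto
    also have "\<dots> \<le> (\<Sum>x\<in>X k. \<Sum>y\<in>X k. \<Sum>j<s k. 2 / 4 ^ r k)" by (intro sum_mono H3(2))
    finally show "prob (G3 k) \<le> card (X k) * (card (X k) * (s k * (2 / 4 ^ r k)))" by simp
  qed
  define G where "G k = G1 k \<union> (G2 k \<union> G3 k)" for k
  have Gev: "G k \<in> events" for k unfolding G_def using G1(1) G2(1) G3(1) by blast
  define Q where "Q = (3 * real m) ^ (2 * CARD('d))"
  have Gp: "prob (G k) \<le> (C + Q + Q * (16 * CARD('d))) * (1/2) ^ k" if k: "h1 \<le> k" for k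
  proof -
    let ?N = "(2 * (m * 2 ^ k) + 1) ^ CARD('d)"
    have X: "card (X k) \<le> ?N" unfolding X_def by (rule cube_finite_card(2))
    have "h1 \<le> 2 ^ k" using k less_exp[of k] by linarith
    then have "prob (G1 k) \<le> C * (1/2) ^ k" using E(3)[of k] G1(2)[of k] by (simp add:
        power_one_over field_simps)
    moreover have "prob (G2 k) \<le> Q * (1/2) ^ k"
    proof -
      have "prob (G2 k) \<le> card (X k) * (card (X k) * (2 ^ s k / 4 ^ s k))" by (rule G2(2))
      also have "\<dots> \<le> real ?N * (real ?N * (2 ^ s k / 4 ^ s k))" using X by (intro mult_mono
          of_nat_mono) auto
      also have "\<dots> \<le> Q * (1/2) ^ k" using scale_sum_bound(1)[OF m, of "CARD('d)" k] d2 unfolding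
          s_def Q_def by simp
      finally show ?thesis .
    qed
    moreover have "prob (G3 k) \<le> Q * (16 * CARD('d)) * (1/2) ^ k"
    proof -
      have "prob (G3 k) \<le> card (X k) * (card (X k) * (s k * (2 / 4 ^ r k)))" by (rule G3(2))
      also have "\<dots> \<le> real ?N * (real ?N * (s k * (2 / 4 ^ r k)))" using X by (intro mult_mono
          of_nat_mono) auto
      also have "\<dots> \<le> Q * (16 * CARD('d)) * (1/2) ^ k"
        using scale_sum_bound(2)[OF m, of "CARD('d)" k] d2 unfolding s_def r_def Q_def by simp
      finally show ?thesis .
    qed
    moreover have "prob (G k) \<le> prob (G1 k) + (prob (G2 k) + prob (G3 k))"
      unfolding G_def using G1(1) G2(1) G3(1)
      by (intro order_trans[OF measure_Un_le] add_left_mono measure_Un_le) auto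
    ultimately show ?thesis by (simp add: algebra_simps)
  qed
  \<comment> \<open>The exceptional probabilities decay geometrically in \<open>k\<close>; the
    factor growing with \<open>m\<close> is constant here, since \<open>m\<close> is fixed.\<close>
  have "summable (\<lambda>k. (C + Q + Q * (16 * CARD('d))) * (1/2::real) ^ k)" by (intro summable_mult
      summable_geometric) simp
  then have "summable (\<lambda>k. prob (G k))" by (rule summable_comparison_test'[where N = h1]) (use Gp
      in simp)
  then have "AE \<omega> in M. \<forall>\<^sub>F k in sequentially. \<omega> \<in> space M - G k"
    using Gev by (intro borel_cantelli_AE1) (auto simp: emeasure_eq_measure)
  then show ?thesis
  proof (rule AE_mp, intro AE_I2 impI)
    fix \<omega> assume "\<omega> \<in> space M" and "\<forall>\<^sub>F k in sequentially. \<omega> \<in> space M - G k"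
    from this(2) show "\<forall>\<^sub>F k in sequentially. scale_good (\<lambda>e. \<tau> e \<omega>) c m k"
    proof eventually_elim
      case (elim k)
      let ?A = "\<sigma> k \<omega>"
      have w: "\<omega> \<in> space M" "\<omega> \<notin> G1 k" "\<omega> \<notin> G2 k" "\<omega> \<notin> G3 k" using elim by (auto simp: G_def)
      have near: "cdist ?A x y \<le> 4 * CARD('d) * 2 ^ k" if xy: "x \<in> X k" "y \<in> X k" for x y
      proof (rule ccontr)
        assume "\<not> ?thesis"
        then have "far k ?A" unfolding far_def using xy by (intro bexI[of _ x] bexI[of _ y])
            (simp_all only: not_le)
        then show False using w(1,2) by (simp add: G1_def)
      qed
      have L: "L k ?A x y = closed_ends ?A (\<pi> ?A x y)" if "x \<in> X k" "y \<in> X k" for x y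
        using near[OF that] by (simp add: L_def)
      have "\<exists>safe. (\<forall>x\<in>X k. \<forall>y\<in>X k. safe x \<longrightarrow> safe y \<longrightarrow>
          reach (\<lambda>e. \<tau> e \<omega>) x y (b * real (4 * CARD('d) * 2 ^ k) + 9 ^ CARD('d) * CARD('d) * b * s
              k)) \<and>
        (\<forall>vs. successively lattice_adj vs \<longrightarrow> distinct vs \<longrightarrow> length vs > (4 * r k + 1) ^ CARD('d) \<longrightarrow>
            (\<exists>i<length vs. safe (vs ! i)))"
      proof (rule connection_scale[OF d2 b finX, where A = "?A" and \<pi> = "\<pi> ?A"])
        show "wt (closed_ind ?A) (\<pi> ?A x y) \<le> real (4 * CARD('d) * 2 ^ k)" if "x \<in> X k" "y \<in> X k"
            for x y
          unfolding \<pi>(2) using near[OF that] by (simp only: of_nat_le_iff)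
        show "\<forall>Y\<in>animals (set (closed_ends ?A (\<pi> ?A x y))) (s k). \<not> Y \<subseteq> bad (\<lambda>e. \<tau> e \<omega>) b" if xy:
            "x \<in> X k" "y \<in> X k" for x y
        proof -
          have "\<omega> \<notin> H2 k x y" using w(3) xy unfolding G2_def by blast
          then show ?thesis using w(1) L[OF xy] unfolding H2_def by auto
        qed
        show "\<forall>Y\<in>animals {v} (r k). \<not> Y \<subseteq> bad (\<lambda>e. \<tau> e \<omega>) b"
          if xy: "x \<in> X k" "y \<in> X k" and v: "v \<in> set (closed_ends ?A (\<pi> ?A x y))" for x y v
        proof -
          obtain j where j: "j < length (L k ?A x y)" "L k ?A x y ! j = v"
            using v unfolding L[OF xy, symmetric] by (auto simp: in_set_conv_nth)
          then have "j < s k" using len less_le_trans by blast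
          then have "\<omega> \<notin> H3 k x y j" using w(4) xy unfolding G3_def by blast
          moreover have "V k ?A x y j = {v}" using j by (simp add: V_def)
          ultimately show ?thesis using w(1) unfolding H3_def by auto
        qed
      qed (auto simp: \<pi>(1) \<sigma>_def)
      moreover have "b * real (4 * CARD('d) * 2 ^ k) + 9 ^ CARD('d) * CARD('d) * b * s k = c * 2 ^
          k"
        by (simp add: c_def s_def algebra_simps)
      ultimately show ?case unfolding scale_good_def X_def r_def by simp
    qed
  qed
qed

theorem theorem1p13:
  fixes M :: "'w measure"
    and \<tau> :: "(int ^ 'd::finite) set \<Rightarrow> 'w \<Rightarrow> real"
    and F :: "real \<Rightarrow> real"
  assumes "CARD('d) \<ge> 2"
    and "prob_space M" and "complete_measure M"
    and "prob_space.indep_vars M (\<lambda>_. borel) \<tau> lattice_edges"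
    and "\<And>e e'. e \<in> lattice_edges \<Longrightarrow> e' \<in> lattice_edges \<Longrightarrow>
           distr M borel (\<tau> e) = distr M borel (\<tau> e')"
    and "\<And>e \<omega>. e \<in> lattice_edges \<Longrightarrow> \<omega> \<in> space M \<Longrightarrow> 0 \<le> \<tau> e \<omega>"
    and "\<And>e t. e \<in> lattice_edges \<Longrightarrow> F t = measure M {\<omega> \<in> space M. \<tau> e \<omega> \<le> t}"
    and "F 0 \<ge> critical_prob TYPE('d)"
  shows "AE \<omega> in M. \<forall>\<Gamma> \<in> infinite_geodesics (\<lambda>e. \<tau> e \<omega>).
           weak_conv_m (\<lambda>l. empirical_measure (\<lambda>e. \<tau> e \<omega>) (initial_path \<Gamma> l)) (return borel 0)"
proof -
  interpret prob_space M by (rule assms(2))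
  obtain e0 :: "(int ^ 'd) set" where e0: "e0 \<in> lattice_edges" using lattice_edges_nonempty by blast
  have rv: "\<tau> e \<in> borel_measurable M" if "e \<in> lattice_edges" for e
    using assms(4) that by (auto simp: indep_vars_def)
  have bad_rate: "bad_rate TYPE('d) ^ 3 ^ CARD('d) > 0" by (simp add: bad_rate_def)
  have "\<exists>b\<ge>0. \<forall>e\<in>lattice_edges. prob {\<omega> \<in> space M. \<tau> e \<omega> > b} \<le> bad_rate TYPE('d) ^ 3 ^ CARD('d) *
      prob {\<omega> \<in> space M. \<tau> e \<omega> > 0}"
    by (rule tail_threshold[OF _ _ bad_rate]; (rule rv | rule assms(7)); assumption)
  then obtain b where b: "b \<ge> 0" and tail: "\<forall>e\<in>lattice_edges.
      prob {\<omega> \<in> space M. \<tau> e \<omega> > b} \<le> bad_rate TYPE('d) ^ 3 ^ CARD('d) * prob {\<omega> \<in> space M. \<tau> e \<omega>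
          > 0}"
    by (elim exE conjE) (rule that)
  have p: "0 \<le> F 0" "F 0 \<le> 1" using assms(7)[OF e0, of 0] by auto
  define c where "c = b * (4 * CARD('d)) + 9 ^ CARD('d) * CARD('d) * b * (8 * CARD('d))"
  have c: "c \<ge> 0" using b by (simp add: c_def)
  \<comment> \<open>A single null set must serve all \<open>m\<close>, because
    \<open>geodesic_density\<close> picks \<open>m\<close> depending on the precision; there are
    only countably many.\<close>
  have "AE \<omega> in M. \<forall>m. m \<ge> 1 \<longrightarrow> (\<forall>\<^sub>F k in sequentially. scale_good (\<lambda>e. \<tau> e \<omega>) c m k)"
    unfolding AE_all_countable
  proof
    fix m :: nat
    show "AE \<omega> in M. m \<ge> 1 \<longrightarrow> (\<forall>\<^sub>F k in sequentially. scale_good (\<lambda>e. \<tau> e \<omega>) c m k)"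
    proof (cases "m \<ge> 1")
      case True
      have "AE \<omega> in M. \<forall>\<^sub>F k in sequentially. scale_good (\<lambda>e. \<tau> e \<omega>) c m k"
        unfolding c_def
      proof (rule AE_scale_good[OF assms(1,4) _ b p assms(8) _ True])
        show "prob {\<omega> \<in> space M. \<tau> e \<omega> > b} \<le> bad_rate TYPE('d) ^ 3 ^ CARD('d) * prob {\<omega> \<in> space
            M. \<tau> e \<omega> > 0}"
          if "e \<in> lattice_edges" for e using tail that by blast
        show "prob {\<omega> \<in> space M. \<tau> e \<omega> \<le> 0} = F 0" if "e \<in> lattice_edges" for e
          using assms(7)[OF that, of 0] by simp
      qed
      then show ?thesis by (rule AE_mp) (auto intro!: AE_I2)
    qed simp
  qed
  then show ?thesis
  proof (rule AE_mp, intro AE_I2 impI ballI)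
    fix \<omega> \<Gamma> assume w: "\<omega> \<in> space M" and \<Gamma>: "\<Gamma> \<in> infinite_geodesics (\<lambda>e. \<tau> e \<omega>)"
      and good: "\<forall>m. m \<ge> 1 \<longrightarrow> (\<forall>\<^sub>F k in sequentially. scale_good (\<lambda>e. \<tau> e \<omega>) c m k)"
    have nn: "0 \<le> \<tau> e \<omega>" if "e \<in> lattice_edges" for e using assms(6) that w by blast
    show "weak_conv_m (\<lambda>l. empirical_measure (\<lambda>e. \<tau> e \<omega>) (initial_path \<Gamma> l)) (return borel 0)"
    proof (rule weak_conv_zero)
      show "0 \<le> \<tau> (\<Gamma> n) \<omega>" for n
      proof -
        obtain vs where "length vs = Suc (Suc n)" "successively lattice_adj vs" "\<Gamma> n = {vs ! n, vs
            ! Suc n}"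
          using infinite_geodesic_segment[OF \<Gamma>, of "Suc n"] nn by (metis lessI le_add1
              plus_1_eq_Suc)
        moreover from this have "lattice_adj (vs ! n) (vs ! Suc n)" by (simp add:
            successively_conv_nth)
        ultimately show ?thesis using nn[OF lattice_edgesI] by metis
      qed
      show "(\<lambda>l. real (card {n. n < l \<and> \<tau> (\<Gamma> n) \<omega> > \<epsilon>}) / real l) \<longlonglongrightarrow> 0" if "\<epsilon> > 0" for \<epsilon>
        using geodesic_density[OF _ c nn \<Gamma> that] good by blast
    qed
  qed
qed

end
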